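(* Assume that the weights $\mathbf W$ satisfy Conditions 1 (given in the context). Let $f(n)=o(n^{1/3})$ with $\lim_{n\to\infty}f(n)=+\infty$. Let $(|C_1|,|C_2|,|C_3|,\dots)$ denote the sequence of sizes of the connected components of $G(\mathbf W,p_{f(n)})$ taken in decreasing order, with the convention $|C_i|=0$ if there is no $i$-th largest component. Then for any $p>7/3$ we have the following convergence in probability, in $\ell^p$ (the space of $p$-summable sequences with its usual norm), as $n\to\infty$: $$\left(\frac{|C_1|}{2f(n)\ell_n^{2/3}},\frac{|C_2|}{\ell_n^{2/3}},\frac{|C_3|}{\ell_n^{2/3}},\frac{|C_4|}{\ell_n^{2/3}},\dots\right)\longrightarrow\left(\frac1C,0,0,\dots\right).$$
   Context: Model. For each $n\ge1$, $\mathbf W=(w_1,\dots,w_n)$ is a deterministic vector of weights (depending implicitly on $n$) with $0<w_n\le w_{n-1}\le\dots\le w_1$, and $\ell_n=\sum_{i=1}^n w_i$. For $q\in[0,+\infty]$, $G(\mathbf W,q)$ is the random graph on $\{1,\dots,n\}$ in which each edge $\{i,j\}$ is present with probability $1-e^{-w_iw_jq}$, independently of everything else. Conditions 1. There is a positive random variable $W$ such that: (i) the distribution of a uniformly chosen weight (uniform among $w_1,\dots,w_n$) converges weakly to $W$ as $n\to\infty$; (ii) $\mathbb E[W^3]<\infty$; (iii) $\mathbb E[W^2]=\mathbb E[W]$; (iv) $\ell_n=\mathbb E[W]n+o(n^{2/3})$; (v) $\sum_{k=1}^n w_k^2=\mathbb E[W^2]n+o(n^{2/3})$; (vi) $\sum_{k=1}^n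 w_k^3=\mathbb E[W^3]n+o(1)$; (vii) $\max_{i\le n}w_i=o(n^{1/3})$. Notation. $C=\mathbb E[W^3]/\mathbb E[W]$ and $p_{f(n)}=\dfrac{\ell_n^{1/3}+f(n)}{\ell_n^{4/3}}$. The size of a connected component is its number of vertices. *)

theory Defs
  imports "HOL-Probability.Probability" "HOL-Library.Landau_Symbols"
begin

section \<open>The random graph \<open>G(W, q)\<close>\<close>

definition possible_edges :: "nat \<Rightarrow> nat set set" where
  "possible_edges n = {e. e \<subseteq> {1..n} \<and> card e = 2}"

text \<open>
  The law, on edge sets, of the graph on \<open>{1..n}\<close> with weights \<open>v 1, \<dots>, v n\<close>. For \<open>e = {i, j}\<close> the
  product is \<open>v i * v j\<close>. Only finite \<open>q\<close> is covered. For \<open>q < 0\<close>, where the model is undefined,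
  \<^const>\<open>bernoulli_pmf\<close> truncates the negative parameter to \<open>0\<close> and the graph has no edges.
\<close>

definition random_graph :: "nat \<Rightarrow> (nat \<Rightarrow> real) \<Rightarrow> real \<Rightarrow> nat set set pmf" where
  "random_graph n v q =
     map_pmf (\<lambda>b. {e \<in> possible_edges n. b e})
       (Pi_pmf (possible_edges n) False
         (\<lambda>e. bernoulli_pmf (1 - exp (- (\<Prod>i\<in>e. v i) * q))))"

definition components :: "nat \<Rightarrow> nat set set \<Rightarrow> nat set set" where
  "components n E = {1..n} // {(u, v). {u, v} \<in> E}\<^sup>*"

definition component_sizes :: "nat \<Rightarrow> nat set set \<Rightarrow> nat list" where
  "component_sizes n E =
     rev (sorted_list_of_multiset (image_mset card (mset_set (components n E))))"

text \<open>Numbering starts at \<open>0\<close>: \<open>component_size n E k\<close> is \<open>|C\<^sub>k\<^sub>+\<^sub>1|\<close>.\<close>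

definition component_size :: "nat \<Rightarrow> nat set set \<Rightarrow> nat \<Rightarrow> nat" where
  "component_size n E k =
     (if k < length (component_sizes n E) then component_sizes n E ! k else 0)"


section \<open>Weights\<close>

text \<open>A triangular array \<open>w\<close>: \<open>w n i\<close> is the \<open>i\<close>-th weight for the graph on \<open>n\<close> vertices.\<close>

definition weight_array :: "(nat \<Rightarrow> nat \<Rightarrow> real) \<Rightarrow> bool" where
  "weight_array w \<longleftrightarrow>
     (\<forall>n. (\<forall>i\<in>{1..n}. 0 < w n i) \<and> (\<forall>i\<in>{1..n}. \<forall>j\<in>{1..n}. i \<le> j \<longrightarrow> w n j \<le> w n i))"

definition total_weight :: "(nat \<Rightarrow> nat \<Rightarrow> real) \<Rightarrow> nat \<Rightarrow> real" where
  "total_weight w n = (\<Sum>i=1..n. w n i)"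

definition conditions1 :: "(nat \<Rightarrow> nat \<Rightarrow> real) \<Rightarrow> 'a measure \<Rightarrow> ('a \<Rightarrow> real) \<Rightarrow> bool" where
  "conditions1 w M W \<longleftrightarrow>
     prob_space M \<and> W \<in> borel_measurable M \<and> (AE x in M. 0 < W x) \<and>
     weak_conv_m (\<lambda>n. distr (measure_pmf (pmf_of_set {1..n})) borel (w n)) (distr M borel W) \<and>
     integrable M (\<lambda>x. W x ^ 3) \<and>
     (\<integral>x. W x ^ 2 \<partial>M) = (\<integral>x. W x \<partial>M) \<and>
     (\<lambda>n. total_weight w n - (\<integral>x. W x \<partial>M) * real n) \<in> o(\<lambda>n. real n powr (2/3)) \<and>
     (\<lambda>n. (\<Sum>k=1..n. w n k ^ 2) - (\<integral>x. W x ^ 2 \<partial>M) * real n) \<in> o(\<lambda>n. real n powr (2/3)) \<and>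
     (\<lambda>n. (\<Sum>k=1..n. w n k ^ 3) - (\<integral>x. W x ^ 3 \<partial>M) * real n) \<in> o(\<lambda>n. 1) \<and>
     (\<lambda>n. Max (w n ` {1..n})) \<in> o(\<lambda>n. real n powr (1/3))"

definition crit_param :: "(nat \<Rightarrow> nat \<Rightarrow> real) \<Rightarrow> (nat \<Rightarrow> real) \<Rightarrow> nat \<Rightarrow> real" where
  "crit_param w f n =
     (total_weight w n powr (1/3) + f n) / total_weight w n powr (4/3)"


section \<open>Convergence in probability in \<open>\<ell>\<^sup>p\<close>\<close>

definition lp_space :: "real \<Rightarrow> (nat \<Rightarrow> real) set" where
  "lp_space p = {x. summable (\<lambda>i. \<bar>x i\<bar> powr p)}"

definition lp_norm :: "real \<Rightarrow> (nat \<Rightarrow> real) \<Rightarrow> real" where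
  "lp_norm p x = (\<Sum>i. \<bar>x i\<bar> powr p) powr (1 / p)"

text \<open>
  The random sequences \<open>X n\<close> live on different probability spaces \<open>P n\<close>; the limit is deterministic.
\<close>

definition lp_tendsto_in_prob ::
    "real \<Rightarrow> (nat \<Rightarrow> 'b pmf) \<Rightarrow> (nat \<Rightarrow> 'b \<Rightarrow> nat \<Rightarrow> real) \<Rightarrow> (nat \<Rightarrow> real) \<Rightarrow> bool" where
  "lp_tendsto_in_prob p P X x \<longleftrightarrow>
     x \<in> lp_space p \<and> (\<forall>n. \<forall>\<omega>\<in>set_pmf (P n). X n \<omega> \<in> lp_space p) \<and>
     (\<forall>\<epsilon>>0. (\<lambda>n. measure_pmf.prob (P n) {\<omega>. lp_norm p (\<lambda>i. X n \<omega> i - x i) > \<epsilon>})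
               \<longlonglongrightarrow> 0)"

end

theory Submission
  imports Defs
begin

text \<open>
  For a set \<open>B\<close> of vertices, the probability that exactly \<open>S\<close> is reached from \<open>B\<close> is
  \<open>c(B, S) exp (- q w(S) w(V - S))\<close>, where \<open>c\<close> does not depend on \<open>V\<close>. Keeping each vertex \<open>i\<close>
  outside \<open>B\<close> only with probability \<open>exp (- a i)\<close> multiplies it by an explicit factor \<open>exp (g S)\<close>, and
  the tilted probabilities still sum to one. So a large lower bound on \<open>g\<close> on a family of sets makes
  the family exponentially unlikely, while upper bounds on \<open>g\<close> together with the subcriticality of the thinned
  graph bound the probability of a heavy component from above.

  Let \<open>q \<Sum> w\<^sup>2 = 1 + e\<close> and \<open>q \<Sum> w\<^sup>3 = D\<close>, so that the giant component should have weight about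
  \<open>T = 2 e / (q D)\<close>. Suitable choices of \<open>a\<close> show that with high probability some component has weight above
  a small multiple \<open>K\<close> of \<open>T\<close>, that none has weight between \<open>K\<close> and \<open>(1 - 4 \<delta>) T\<close>, and that the number of
  vertices and the sum of squared weights of a heavy component are nearly proportional to its weight.
  The expected number of vertices in heavy components is at most about \<open>T\<close>, which
  gives the matching upper bound. Removing a heavy component leaves a subcritical graph, whose squared
  component sizes sum to \<open>O(n / e)\<close>, which is \<open>o(n\<^sup>4\<^sup>/\<^sup>3)\<close>; as \<open>p \<ge> 2\<close>, this controls the \<open>\<ell>\<^sup>p\<close> norm of the rest.
\<close>

section \<open>Random subsets with independent elements\<close>

text \<open>The exponents won by tilting are of order \<open>f(n)^3\<close>, and \<open>f\<close>
  may grow arbitrarily slowly, so they cannot pay for a union bound over vertices, which costs a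
  factor of order \<open>1 / x\<close> with \<open>x = e / D\<close>. Hence \<open>big v K\<close>,
  the probability that \<open>v\<close> lies in a component heavier than \<open>K\<close>, is first
  bounded by about \<open>2 * x * w v\<close>. Each family of atypical heavy components then costs
  its exponential factor times \<open>4 / \<delta>\<close>, a bound on the mean number of heavy
  components.

  With \<open>a i\<close> close to \<open>\<theta> * w i\<close> and \<open>\<theta>\<close> small,
  the exponent on a set of weight \<open>s\<close> is about
  \<open>\<theta> * s * (e - q * s * D / 2)\<close>. It is positive exactly below
  \<open>2 * e / (q * D)\<close>: this is the origin of \<open>T\<close>, and the reason why this
  tilt gives nothing above \<open>T\<close>. The factor \<open>2 * x * w v\<close> is to first order
  the survival probability of the branching process started at \<open>v\<close>.

  Second-order expansions of the exponent need bounded weights. A cutoff \<open>L\<close> that does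
  not depend on \<open>n\<close> suffices, since the weights above it carry at most a fraction
  \<open>\<delta>\<close> of the third moment.\<close>

definition bexp :: "('a \<Rightarrow> real) \<Rightarrow> 'a set \<Rightarrow> ('a set \<Rightarrow> real) \<Rightarrow> real" where
  "bexp p D f = (\<Sum>F\<in>Pow D. (\<Prod>e\<in>F. p e) * (\<Prod>e\<in>D - F. 1 - p e) * f F)"

lemma bexp_cong:
  assumes "\<And>F. F \<subseteq> D \<Longrightarrow> f F = g F"
  shows "bexp p D f = bexp p D g"
  unfolding bexp_def by (rule sum.cong) (use assms in auto)

lemma bexp_mono:
  assumes "\<And>e. e \<in> D \<Longrightarrow> 0 \<le> p e \<and> p e \<le> 1" and "\<And>F. F \<subseteq> D \<Longrightarrow> f F \<le> g F"
  shows "bexp p D f \<le> bexp p D g"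
  unfolding bexp_def
  by (intro sum_mono mult_left_mono mult_nonneg_nonneg prod_nonneg)
    (use assms in \<open>auto simp: subset_iff\<close>)

lemma bexp_nonneg:
  assumes "\<And>e. e \<in> D \<Longrightarrow> 0 \<le> p e \<and> p e \<le> 1" and "\<And>F. F \<subseteq> D \<Longrightarrow> 0 \<le> f F"
  shows "0 \<le> bexp p D f"
  unfolding bexp_def
  by (intro sum_nonneg mult_nonneg_nonneg prod_nonneg) (use assms in \<open>auto simp: subset_iff\<close>)

lemma bexp_add: "bexp p D (\<lambda>F. f F + g F) = bexp p D f + bexp p D g"
  by (simp add: bexp_def sum.distrib algebra_simps)

lemma bexp_diff: "bexp p D (\<lambda>F. f F - g F) = bexp p D f - bexp p D g"
  by (simp add: bexp_def sum_subtractf algebra_simps)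

lemma bexp_cmult: "bexp p D (\<lambda>F. c * f F) = c * bexp p D f"
  unfolding bexp_def sum_distrib_left by (intro sum.cong) (simp_all add: mult_ac)

lemma bexp_multc: "bexp p D (\<lambda>F. f F * c) = bexp p D f * c"
  unfolding bexp_def sum_distrib_right by (intro sum.cong) (simp_all add: mult_ac)

lemma bexp_sum: "bexp p D (\<lambda>F. \<Sum>i\<in>I. f i F) = (\<Sum>i\<in>I. bexp p D (f i))"
  unfolding bexp_def by (subst sum.swap) (simp add: sum_distrib_left)

lemma bexp_const [simp]:
  assumes "finite D"
  shows "bexp p D (\<lambda>_. c) = c"
proof -
  have "(\<Sum>F\<in>Pow D. (\<Prod>e\<in>F. p e) * (\<Prod>e\<in>D - F. 1 - p e)) = (\<Prod>e\<in>D. p e + (1 - p e))"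
    by (rule prod_add[symmetric]) (rule assms)
  then show ?thesis by (simp add: bexp_def flip: sum_distrib_right)
qed

text \<open>Generating function of independent indicators. In \<open>tilt_eq\<close> it averages
  over the retained vertices outside the reached set.\<close>

lemma bexp_prod:
  assumes "finite D"
  shows "bexp p D (\<lambda>F. \<Prod>e\<in>F. y e) = (\<Prod>e\<in>D. 1 - p e + p e * y e)"
proof -
  have "(\<Prod>e\<in>D. p e * y e + (1 - p e)) = bexp p D (\<lambda>F. \<Prod>e\<in>F. y e)"
    by (subst prod_add[OF assms]) (simp add: bexp_def prod.distrib mult_ac)
  then show ?thesis by (simp add: add.commute)
qed

lemma bexp_eq_indicator:
  assumes "finite D" "A \<subseteq> D"
  shows "bexp p D (\<lambda>F. if F = A then f F else 0) = (\<Prod>e\<in>A. p e) * (\<Prod>e\<in>D - A. 1 - p e) * f A"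
proof -
  have "bexp p D (\<lambda>F. if F = A then f F else 0) =
      (\<Sum>F\<in>Pow D. if F = A then (\<Prod>e\<in>F. p e) * (\<Prod>e\<in>D - F. 1 - p e) * f F else 0)"
    unfolding bexp_def by (rule sum.cong) auto
  also have "\<dots> = (\<Prod>e\<in>A. p e) * (\<Prod>e\<in>D - A. 1 - p e) * f A"
    using assms by (subst sum.delta) auto
  finally show ?thesis .
qed

lemma bexp_union:
  assumes "finite D1" "finite D2" "D1 \<inter> D2 = {}"
  shows "bexp p (D1 \<union> D2) f = bexp p D1 (\<lambda>F1. bexp p D2 (\<lambda>F2. f (F1 \<union> F2)))"
proof -
  have inj: "inj_on (\<lambda>(F1, F2). F1 \<union> F2) (Pow D1 \<times> Pow D2)"
  proof (rule inj_onI, clarsimp)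
    fix a b a' b' assume "a \<subseteq> D1" "b \<subseteq> D2" "a' \<subseteq> D1" "b' \<subseteq> D2" "a \<union> b = a' \<union> b'"
    moreover from this have "a = (a \<union> b) \<inter> D1" "a' = (a' \<union> b') \<inter> D1" "b = (a \<union> b) \<inter> D2" "b' = (a' \<union> b') \<inter> D2"
      using assms(3) by blast+
    ultimately show "a = a' \<and> b = b'" by metis
  qed
  have img: "(\<lambda>(F1, F2). F1 \<union> F2) ` (Pow D1 \<times> Pow D2) = Pow (D1 \<union> D2)"
  proof (intro equalityI subsetI)
    fix x assume "x \<in> Pow (D1 \<union> D2)"
    then have "x = (\<lambda>(F1, F2). F1 \<union> F2) (x \<inter> D1, x \<inter> D2)" "(x \<inter> D1, x \<inter> D2) \<in> Pow D1 \<times> Pow D2"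
      by auto
    then show "x \<in> (\<lambda>(F1, F2). F1 \<union> F2) ` (Pow D1 \<times> Pow D2)" by blast
  qed auto
  have wt: "prod p (F1 \<union> F2) * (\<Prod>e\<in>D1 \<union> D2 - (F1 \<union> F2). 1 - p e) * f (F1 \<union> F2)
     = (prod p F1 * (\<Prod>e\<in>D1 - F1. 1 - p e)) * (prod p F2 * (\<Prod>e\<in>D2 - F2. 1 - p e) * f (F1 \<union> F2))"
    if "F1 \<subseteq> D1" "F2 \<subseteq> D2" for F1 F2
  proof -
    have *: "D1 \<union> D2 - (F1 \<union> F2) = (D1 - F1) \<union> (D2 - F2)" using that assms(3) by blast
    have "finite F1" "finite F2" "F1 \<inter> F2 = {}" "(D1 - F1) \<inter> (D2 - F2) = {}"
      using that assms finite_subset by blast+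
    then show ?thesis unfolding * using assms by (simp add: prod.union_disjoint)
  qed
  have "bexp p (D1 \<union> D2) f = (\<Sum>(F1, F2)\<in>Pow D1 \<times> Pow D2.
      prod p (F1 \<union> F2) * (\<Prod>e\<in>D1 \<union> D2 - (F1 \<union> F2). 1 - p e) * f (F1 \<union> F2))"
    unfolding bexp_def img[symmetric] by (subst sum.reindex[OF inj]) (simp add: case_prod_unfold)
  also have "\<dots> = (\<Sum>(F1, F2)\<in>Pow D1 \<times> Pow D2.
      (prod p F1 * (\<Prod>e\<in>D1 - F1. 1 - p e)) * (prod p F2 * (\<Prod>e\<in>D2 - F2. 1 - p e) * f (F1 \<union> F2)))"
    by (rule sum.cong) (auto simp: wt)
  also have "\<dots> = bexp p D1 (\<lambda>F1. bexp p D2 (\<lambda>F2. f (F1 \<union> F2)))"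
    unfolding bexp_def by (simp add: sum.cartesian_product[symmetric] sum_distrib_left)
  finally show ?thesis .
qed

lemma bexp_singleton: "bexp p {x} f = p x * f {x} + (1 - p x) * f {}"
  by (simp add: bexp_def Pow_insert)

lemma bexp_insert:
  assumes "finite D" "x \<notin> D"
  shows "bexp p (insert x D) f = p x * bexp p D (\<lambda>F. f (insert x F)) + (1 - p x) * bexp p D f"
  using bexp_union[of "{x}" D p f] assms by (simp add: bexp_singleton)

lemma bexp_restrict:
  assumes "finite D" "D' \<subseteq> D"
  shows "bexp p D (\<lambda>F. f (F \<inter> D')) = bexp p D' f"
proof -
  have fin: "finite D'" "finite (D - D')" using assms finite_subset by auto
  have "bexp p D (\<lambda>F. f (F \<inter> D')) = bexp p (D' \<union> (D - D')) (\<lambda>F. f (F \<inter> D'))"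
    using assms by (metis Diff_partition)
  also have "\<dots> = bexp p D' (\<lambda>F1. bexp p (D - D') (\<lambda>F2. f ((F1 \<union> F2) \<inter> D')))"
    using fin by (intro bexp_union) auto
  also have "\<dots> = bexp p D' (\<lambda>F1. bexp p (D - D') (\<lambda>F2. f F1))"
    by (intro bexp_cong arg_cong[of _ _ f]) blast
  finally show ?thesis using fin by simp
qed

text \<open>Disintegration along the values of \<open>h\<close>. With \<open>h F = reach B F\<close>
  it turns weighted sums of exact-set probabilities into expectations.\<close>

lemma bexp_delta:
  assumes "finite T" "\<And>F. F \<subseteq> D \<Longrightarrow> h F \<in> T"
  shows "(\<Sum>S\<in>T. bexp p D (\<lambda>F. of_bool (h F = S)) * f S) = bexp p D (\<lambda>F. f (h F))"
proof -
  have "(\<Sum>S\<in>T. bexp p D (\<lambda>F. of_bool (h F = S)) * f S) = bexp p D (\<lambda>F. \<Sum>S\<in>T. of_bool (h F = S) * f S)"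
    by (simp add: bexp_sum bexp_multc)
  also have "\<dots> = bexp p D (\<lambda>F. f (h F))"
  proof (rule bexp_cong)
    fix F assume "F \<subseteq> D"
    have "(\<Sum>S\<in>T. of_bool (h F = S) * f S) = (\<Sum>S\<in>T. if h F = S then f S else 0)"
      by (rule sum.cong) auto
    then show "(\<Sum>S\<in>T. of_bool (h F = S) * f S) = f (h F)"
      using assms \<open>F \<subseteq> D\<close> by simp
  qed
  finally show ?thesis .
qed

text \<open>The bridge from the product \<open>pmf\<close> of the model to finite sums; all
  estimates on the graph are made for the latter.\<close>

lemma prob_eq_bexp:
  assumes "finite D" "\<And>e. e \<in> D \<Longrightarrow> 0 \<le> p e \<and> p e \<le> 1"
  shows "measure_pmf.prob (map_pmf (\<lambda>b. {e \<in> D. b e}) (Pi_pmf D False (\<lambda>e. bernoulli_pmf (p e)))) A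
    = bexp p D (\<lambda>F. of_bool (F \<in> A))" (is "measure_pmf.prob ?G A = _")
proof -
  have pmfG: "pmf ?G F = (\<Prod>e\<in>F. p e) * (\<Prod>e\<in>D - F. 1 - p e)" if "F \<subseteq> D" for F
  proof -
    let ?P = "Pi_pmf D False (\<lambda>e. bernoulli_pmf (p e))"
    have "pmf ?G F = measure_pmf.prob ?P ((\<lambda>b. {e \<in> D. b e}) -` {F} \<inter> set_pmf ?P)"
      by (simp add: pmf_map measure_Int_set_pmf)
    \<comment> \<open>A function in the support is \<open>False\<close> outside \<open>D\<close>, so
      on the support the set \<open>F\<close> determines the function.\<close>
    also have "(\<lambda>b. {e \<in> D. b e}) -` {F} \<inter> set_pmf ?P = {\<lambda>e. e \<in> F} \<inter> set_pmf ?P"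
      using set_Pi_pmf_subset[OF assms(1), of False "\<lambda>e. bernoulli_pmf (p e)"] that
      by (auto simp: fun_eq_iff subset_iff)
    also have "measure_pmf.prob ?P ({\<lambda>e. e \<in> F} \<inter> set_pmf ?P) = pmf ?P (\<lambda>e. e \<in> F)"
      by (simp add: measure_Int_set_pmf pmf.rep_eq)
    also have "\<dots> = (\<Prod>e\<in>D. pmf (bernoulli_pmf (p e)) (e \<in> F))"
      using that by (subst pmf_Pi') (auto simp: assms)
    also have "\<dots> = (\<Prod>e\<in>F \<union> (D - F). if e \<in> F then p e else 1 - p e)"
      using that assms(2) by (intro prod.cong) (auto simp: subset_iff)
    also have "\<dots> = (\<Prod>e\<in>F. p e) * (\<Prod>e\<in>D - F. 1 - p e)"
      using assms that finite_subset[OF that] by (subst prod.union_disjoint) (auto intro!: prod.cong)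
    finally show ?thesis .
  qed
  have "measure_pmf.prob ?G A = measure_pmf.prob ?G (A \<inter> Pow D)"
    by (intro measure_prob_cong_0) (auto simp: set_pmf_iff[symmetric])
  also have "\<dots> = (\<Sum>F\<in>A \<inter> Pow D. pmf ?G F)"
    using assms(1) by (intro measure_measure_pmf_finite) auto
  also have "\<dots> = (\<Sum>F\<in>A \<inter> Pow D. (\<Prod>e\<in>F. p e) * (\<Prod>e\<in>D - F. 1 - p e))"
    by (intro sum.cong) (auto simp: pmfG)
  also have "\<dots> = bexp p D (\<lambda>F. of_bool (F \<in> A))"
    unfolding bexp_def using assms(1) by (intro sum.mono_neutral_cong_left) auto
  finally show ?thesis .
qed

section \<open>Exploration in rank-one random graphs\<close>

definition eds :: "'a set \<Rightarrow> 'a set set" where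
  "eds U = {e. e \<subseteq> U \<and> card e = 2}"

definition crossing :: "'a set \<Rightarrow> 'a set \<Rightarrow> 'a set set" where
  "crossing S R = (\<lambda>(i, j). {i, j}) ` (S \<times> R)"

definition reach :: "'a set \<Rightarrow> 'a set set \<Rightarrow> 'a set" where
  "reach B F = {(u, v). {u, v} \<in> F}\<^sup>* `` B"

lemma finite_eds [simp]: "finite U \<Longrightarrow> finite (eds U)"
  by (rule finite_subset[of _ "Pow U"]) (auto simp: eds_def)

lemma eds_mono: "S \<subseteq> U \<Longrightarrow> eds S \<subseteq> eds U"
  by (auto simp: eds_def)

lemma eds_iff: "e \<in> eds U \<longleftrightarrow> (\<exists>i\<in>U. \<exists>j\<in>U. i \<noteq> j \<and> e = {i, j})"
  by (auto simp: eds_def card_2_iff)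

lemma pair_in_eds: "{i, j} \<in> eds U \<longleftrightarrow> i \<in> U \<and> j \<in> U \<and> i \<noteq> j"
  by (auto simp: eds_iff doubleton_eq_iff)

lemma finite_crossing [simp]: "finite S \<Longrightarrow> finite R \<Longrightarrow> finite (crossing S R)"
  by (simp add: crossing_def)

lemma crossing_iff: "e \<in> crossing S R \<longleftrightarrow> (\<exists>i\<in>S. \<exists>j\<in>R. e = {i, j})"
  by (auto simp: crossing_def)

lemma pair_in_crossing: "{i, j} \<in> crossing S R \<longleftrightarrow> i \<in> S \<and> j \<in> R \<or> i \<in> R \<and> j \<in> S"
  by (auto simp: crossing_iff doubleton_eq_iff)

lemma eds_Un:
  assumes "S \<inter> R = {}"
  shows "eds (S \<union> R) = eds S \<union> (crossing S R \<union> eds R)"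
    and "eds S \<inter> (crossing S R \<union> eds R) = {}" and "crossing S R \<inter> eds R = {}"
proof -
  show "eds (S \<union> R) = eds S \<union> (crossing S R \<union> eds R)"
  proof (rule set_eqI)
    fix e
    show "e \<in> eds (S \<union> R) \<longleftrightarrow> e \<in> eds S \<union> (crossing S R \<union> eds R)"
    proof (cases "\<exists>i j. e = {i, j}")
      case True
      then show ?thesis using assms by (elim exE) (auto simp: pair_in_eds pair_in_crossing)
    qed (auto simp: eds_iff crossing_iff)
  qed
  have "e \<notin> eds R" if "e \<in> crossing S R" for e
    using that assms by (auto simp: crossing_iff pair_in_eds)
  then show "crossing S R \<inter> eds R = {}" by blast
  have "e \<notin> crossing S R \<union> eds R" if "e \<in> eds S" for e
    using that assms by (auto simp: eds_iff pair_in_crossing doubleton_eq_iff)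
  then show "eds S \<inter> (crossing S R \<union> eds R) = {}" by blast
qed

lemma reach_self: "B \<subseteq> reach B F"
  by (auto simp: reach_def)

lemma reach_step: "u \<in> reach B F \<Longrightarrow> {u, v} \<in> F \<Longrightarrow> v \<in> reach B F"
  by (auto simp: reach_def intro: rtrancl_into_rtrancl)

lemma reach_closed:
  assumes "B \<subseteq> S" "\<And>u v. {u, v} \<in> F \<Longrightarrow> u \<in> S \<Longrightarrow> v \<in> S"
  shows "reach B F \<subseteq> S"
proof
  fix x assume "x \<in> reach B F"
  then obtain b where "b \<in> B" "(b, x) \<in> {(u, v). {u, v} \<in> F}\<^sup>*" by (auto simp: reach_def)
  from this(2,1) show "x \<in> S" by (induction) (use assms in auto)
qed

lemma reach_subset: "F \<subseteq> eds U \<Longrightarrow> B \<subseteq> U \<Longrightarrow> reach B F \<subseteq> U"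
  by (rule reach_closed) (auto simp: pair_in_eds)

lemma reach_mono: "F \<subseteq> F' \<Longrightarrow> B \<subseteq> B' \<Longrightarrow> reach B F \<subseteq> reach B' F'"
proof (rule reach_closed)
  assume "F \<subseteq> F'" "B \<subseteq> B'"
  then show "B \<subseteq> reach B' F'" using reach_self[of B' F'] by blast
  show "v \<in> reach B' F'" if "{u, v} \<in> F" "u \<in> reach B' F'" for u v
    using reach_step[of u B' F' v] that \<open>F \<subseteq> F'\<close> by blast
qed

lemma reach_UN: "reach B F = (\<Union>b\<in>B. reach {b} F)"
  by (auto simp: reach_def)

lemma rel_converse: "({(u, v). {u, v} \<in> F}\<^sup>*)\<inverse> = {(u, v). {u, v} \<in> F}\<^sup>*"
proof -
  have "sym {(u, v). {u, v} \<in> F}" by (rule symI) (simp add: insert_commute)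
  from sym_rtrancl[OF this] show ?thesis by (simp add: sym_conv_converse_eq)
qed

lemma reach_sym: "u \<in> reach {v} F \<Longrightarrow> v \<in> reach {u} F"
  using rel_converse[of F] unfolding reach_def by (metis (no_types, lifting) Image_singleton_iff converse_iff)

lemma reach_eq: "u \<in> reach {v} F \<Longrightarrow> reach {u} F = reach {v} F"
proof -
  have *: "reach {u} F \<subseteq> reach {v} F" if "u \<in> reach {v} F" for u v
    using that by (intro reach_closed) (auto intro: reach_step)
  assume "u \<in> reach {v} F"
  then show ?thesis using *[of u v] *[of v u] reach_sym[of u v F] by blast
qed

text \<open>An edge from \<open>S\<close> to \<open>R\<close> would enlarge the reached set, and
  edges inside \<open>R\<close> cannot touch it. As the three classes of edges are independent, this
  equivalence is what makes \<open>markov_reach\<close> a product.\<close>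

lemma reach_split:
  assumes "B \<subseteq> S" "S \<inter> R = {}" "F1 \<subseteq> eds S" "F2 \<subseteq> crossing S R" "F3 \<subseteq> eds R"
  shows "reach B (F1 \<union> (F2 \<union> F3)) = S \<longleftrightarrow> reach B F1 = S \<and> F2 = {}"
proof
  assume eq: "reach B (F1 \<union> (F2 \<union> F3)) = S"
  have F2: "F2 = {}"
  proof (rule ccontr)
    assume "F2 \<noteq> {}"
    then obtain e where "e \<in> F2" by blast
    moreover from this have "e \<in> crossing S R" using assms(4) by blast
    then obtain i j where "e = {i, j}" "i \<in> S" "j \<in> R" unfolding crossing_iff by blast
    ultimately have "{i, j} \<in> F2" "i \<in> S" "j \<in> R" by simp_all
    then have "j \<in> S" using reach_step[of i B "F1 \<union> (F2 \<union> F3)" j] eq by simp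
    then show False using \<open>j \<in> R\<close> assms(2) by blast
  qed
  have "reach B (F1 \<union> (F2 \<union> F3)) \<subseteq> reach B F1"
  proof (rule reach_closed)
    fix u v assume uv: "{u, v} \<in> F1 \<union> (F2 \<union> F3)" and u: "u \<in> reach B F1"
    from u have "u \<in> S" by (rule subsetD[OF reach_subset[OF assms(3,1)]])
    then have "{u, v} \<notin> eds R" using assms(2) by (auto simp: pair_in_eds)
    then have "{u, v} \<in> F1" using uv F2 subsetD[OF assms(5), of "{u, v}"] by auto
    then show "v \<in> reach B F1" by (rule reach_step[OF u])
  qed (rule reach_self)
  moreover have "reach B F1 \<subseteq> S" by (rule reach_subset) fact+
  ultimately show "reach B F1 = S \<and> F2 = {}" using eq F2 by (metis subset_antisym)
next
  assume a: "reach B F1 = S \<and> F2 = {}"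
  have "reach B (F1 \<union> (F2 \<union> F3)) \<subseteq> S"
  proof (rule reach_closed)
    fix u v assume uv: "{u, v} \<in> F1 \<union> (F2 \<union> F3)" and u: "u \<in> S"
    then have "{u, v} \<in> eds S \<or> {u, v} \<in> eds R" using a subsetD[OF assms(3), of "{u, v}"] subsetD[OF assms(5), of "{u, v}"] by auto
    then show "v \<in> S" using u assms(2) by (auto simp: pair_in_eds)
  qed (rule assms(1))
  moreover have "reach B F1 \<subseteq> reach B (F1 \<union> (F2 \<union> F3))" by (rule reach_mono) auto
  ultimately show "reach B (F1 \<union> (F2 \<union> F3)) = S" using a by (metis subset_antisym)
qed

text \<open>Decompose a path from \<open>v\<close> at its last visit to \<open>v\<close>.\<close>
lemma reach_star:
  assumes "v \<notin> A" "F1 \<subseteq> eds {v}" "F2 \<subseteq> crossing {v} A" "F3 \<subseteq> eds A"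
    and "j \<in> reach {v} (F1 \<union> (F2 \<union> F3))" "j \<noteq> v"
  shows "\<exists>k\<in>A. {v, k} \<in> F2 \<and> j \<in> reach {k} F3"
proof -
  have F1: "F1 = {}" using assms(2) by (auto simp: eds_iff)
  let ?S = "insert v {j. \<exists>k\<in>A. {v, k} \<in> F2 \<and> j \<in> reach {k} F3}"
  have "reach {v} (F1 \<union> (F2 \<union> F3)) \<subseteq> ?S"
  proof (rule reach_closed)
    fix x y assume xy: "{x, y} \<in> F1 \<union> (F2 \<union> F3)" and x: "x \<in> ?S"
    show "y \<in> ?S"
    proof (cases "{x, y} \<in> F2")
      case True
      then have "{x, y} \<in> crossing {v} A" using assms(3) by blast
      then show ?thesis using True reach_self[of "{y}"] by (auto simp: pair_in_crossing insert_commute)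
    next
      case False
      then have 3: "{x, y} \<in> F3" using xy F1 by blast
      then have "{x, y} \<in> eds A" using assms(4) by blast
      then have "x \<noteq> v" using assms(1) by (auto simp: pair_in_eds)
      then show ?thesis using x reach_step[OF _ 3] by blast
    qed
  qed auto
  then show ?thesis using assms(5,6) by blast
qed

section \<open>Rank-one edge probabilities and the Markov property of exploration\<close>

definition edge_prob :: "('a \<Rightarrow> real) \<Rightarrow> real \<Rightarrow> 'a set \<Rightarrow> real" where
  "edge_prob w q e = 1 - exp (- (\<Prod>i\<in>e. w i) * q)"

definition gexp :: "('a \<Rightarrow> real) \<Rightarrow> real \<Rightarrow> 'a set \<Rightarrow> ('a set set \<Rightarrow> real) \<Rightarrow> real" where
  "gexp w q U f = bexp (edge_prob w q) (eds U) f"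

locale rank_one =
  fixes V :: "'a set" and w :: "'a \<Rightarrow> real" and q :: real
  assumes fin: "finite V" and w_pos: "\<And>i. i \<in> V \<Longrightarrow> 0 < w i" and q_nonneg: "0 \<le> q"
begin

abbreviation G :: "'a set \<Rightarrow> ('a set set \<Rightarrow> real) \<Rightarrow> real" where
  "G \<equiv> gexp w q"

abbreviation wt :: "'a set \<Rightarrow> real" where
  "wt S \<equiv> sum w S"

abbreviation m2 :: real where
  "m2 \<equiv> \<Sum>i\<in>V. w i ^ 2"

abbreviation m3 :: real where
  "m3 \<equiv> \<Sum>i\<in>V. w i ^ 3"

abbreviation m3_upto :: "real \<Rightarrow> real" where
  "m3_upto L \<equiv> \<Sum>i\<in>{i\<in>V. w i \<le> L}. w i ^ 3"

lemma fin_sub: "U \<subseteq> V \<Longrightarrow> finite U"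
  using fin by (rule rev_finite_subset)

lemma edge_prob01:
  assumes "e \<in> eds U" "U \<subseteq> V"
  shows "0 \<le> edge_prob w q e \<and> edge_prob w q e \<le> 1"
proof -
  have "0 \<le> (\<Prod>i\<in>e. w i)" using assms w_pos by (intro prod_nonneg) (force simp: eds_def)
  then show ?thesis using q_nonneg by (simp add: edge_prob_def)
qed

lemma edge_prob_le:
  assumes "i \<noteq> j"
  shows "edge_prob w q {i, j} \<le> q * w i * w j"
  using exp_ge_add_one_self[of "- (w i * w j) * q"] assms by (simp add: edge_prob_def algebra_simps)

lemma wt_nonneg: "S \<subseteq> V \<Longrightarrow> 0 \<le> wt S"
  using w_pos by (intro sum_nonneg) (auto intro: less_imp_le)

lemma wt_mono: "S \<subseteq> S' \<Longrightarrow> S' \<subseteq> V \<Longrightarrow> wt S \<le> wt S'"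
  using w_pos by (intro sum_mono2 fin_sub) (auto intro: less_imp_le)

lemma G_mono: "U \<subseteq> V \<Longrightarrow> (\<And>F. F \<subseteq> eds U \<Longrightarrow> f F \<le> g F) \<Longrightarrow> G U f \<le> G U g"
  unfolding gexp_def by (rule bexp_mono) (use edge_prob01 in auto)

lemma G_nonneg: "U \<subseteq> V \<Longrightarrow> (\<And>F. F \<subseteq> eds U \<Longrightarrow> 0 \<le> f F) \<Longrightarrow> 0 \<le> G U f"
  unfolding gexp_def by (rule bexp_nonneg) (use edge_prob01 in auto)

lemma G_const [simp]: "U \<subseteq> V \<Longrightarrow> G U (\<lambda>_. c) = c"
  unfolding gexp_def by (intro bexp_const finite_eds fin_sub)

lemma G_le_const:
  assumes "U \<subseteq> V" "\<And>F. F \<subseteq> eds U \<Longrightarrow> f F \<le> c"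
  shows "G U f \<le> c"
  using G_mono[of U f "\<lambda>_. c"] assms by simp

lemma G_cong: "(\<And>F. F \<subseteq> eds U \<Longrightarrow> f F = g F) \<Longrightarrow> G U f = G U g"
  unfolding gexp_def by (rule bexp_cong)

lemma G_restrict: "U \<subseteq> V \<Longrightarrow> U' \<subseteq> U \<Longrightarrow> G U (\<lambda>F. f (F \<inter> eds U')) = G U' f"
  unfolding gexp_def by (intro bexp_restrict eds_mono finite_eds fin_sub)

lemma prod_crossing:
  assumes "S \<subseteq> V" "R \<subseteq> V" "S \<inter> R = {}"
  shows "(\<Prod>e\<in>crossing S R. 1 - edge_prob w q e) = exp (- q * wt S * wt R)"
proof -
  have inj: "inj_on (\<lambda>(i, j). {i, j}) (S \<times> R)"
    using assms(3) by (auto simp: inj_on_def doubleton_eq_iff)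
  have finS: "finite S" "finite R" using assms fin_sub by auto
  have "(\<Prod>e\<in>crossing S R. 1 - edge_prob w q e) = (\<Prod>(i, j)\<in>S \<times> R. 1 - edge_prob w q {i, j})"
    unfolding crossing_def by (subst prod.reindex[OF inj]) (simp add: case_prod_unfold)
  also have "\<dots> = (\<Prod>(i, j)\<in>S \<times> R. exp (- q * (w i * w j)))"
  proof (rule prod.cong[OF refl], clarify)
    fix i j assume "i \<in> S" "j \<in> R"
    then have "i \<noteq> j" using assms(3) by auto
    then show "1 - edge_prob w q {i, j} = exp (- q * (w i * w j))"
      by (simp add: edge_prob_def mult_ac)
  qed
  also have "\<dots> = exp (\<Sum>(i, j)\<in>S \<times> R. - q * (w i * w j))"
    by (subst exp_sum) (auto simp: finS case_prod_unfold)
  also have "(\<Sum>(i, j)\<in>S \<times> R. - q * (w i * w j)) = - q * wt S * wt R"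
    by (simp add: sum.cartesian_product[symmetric] sum_distrib_left sum_distrib_right mult_ac sum_negf)
  finally show ?thesis .
qed

text \<open>The factor of the exploration law that sees only edges inside \<open>S\<close>, hence is
  the same in every induced subgraph containing \<open>S\<close>.\<close>

definition hit :: "'a set \<Rightarrow> 'a set \<Rightarrow> real" where
  "hit B S = G S (\<lambda>F. of_bool (reach B F = S))"

definition law :: "'a set \<Rightarrow> 'a set \<Rightarrow> real" where
  "law B S = G V (\<lambda>F. of_bool (reach B F = S))"

text \<open>The event is decided by the edges that meet \<open>S\<close>, so the edges inside
  \<open>U - S\<close> are still fresh: the rest is an independent rank-one graph. The exponential
  is the probability that no edge joins \<open>S\<close> to \<open>U - S\<close>.\<close>

lemma markov_reach:
  assumes "B \<subseteq> S" "S \<subseteq> U" "U \<subseteq> V"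
  shows "G U (\<lambda>F. of_bool (reach B F = S) * f (F \<inter> eds (U - S)))
    = hit B S * exp (- q * wt S * wt (U - S)) * G (U - S) f"
proof -
  have fU: "finite U" "finite S" "finite (U - S)" using assms by (auto intro!: fin_sub)
  have SU: "S \<union> (U - S) = U" using assms by auto
  note E = eds_Un[of S "U - S", unfolded SU]
  have dj: "S \<inter> (U - S) = {}" by auto
  let ?p = "edge_prob w q"
  have "G U (\<lambda>F. of_bool (reach B F = S) * f (F \<inter> eds (U - S)))
     = bexp ?p (eds S) (\<lambda>F1. bexp ?p (crossing S (U - S)) (\<lambda>F2. bexp ?p (eds (U - S)) (\<lambda>F3.
         of_bool (reach B (F1 \<union> (F2 \<union> F3)) = S) * f ((F1 \<union> (F2 \<union> F3)) \<inter> eds (U - S)))))"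
    unfolding gexp_def E(1)[OF dj]
    by (subst bexp_union, simp_all add: fU E(2)[OF dj], subst bexp_union, simp_all add: fU E(3)[OF dj])
  also have "\<dots> = bexp ?p (eds S) (\<lambda>F1. bexp ?p (crossing S (U - S)) (\<lambda>F2. bexp ?p (eds (U - S)) (\<lambda>F3.
         (of_bool (reach B F1 = S) * (if F2 = {} then 1 else 0)) * f F3)))"
  proof (intro bexp_cong)
    fix F1 F2 F3 assume F: "F1 \<subseteq> eds S" "F2 \<subseteq> crossing S (U - S)" "F3 \<subseteq> eds (U - S)"
    have "(F1 \<union> (F2 \<union> F3)) \<inter> eds (U - S) = F3"
      using F E(2,3)[OF dj] by blast
    then show "of_bool (reach B (F1 \<union> (F2 \<union> F3)) = S) * f ((F1 \<union> (F2 \<union> F3)) \<inter> eds (U - S)) =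
      (of_bool (reach B F1 = S) * (if F2 = {} then 1 else 0)) * f F3"
      using reach_split[OF assms(1) dj F] by auto
  qed
  also have "\<dots> = hit B S * bexp ?p (crossing S (U - S)) (\<lambda>F2. if F2 = {} then 1 else 0) * G (U - S) f"
    by (simp add: bexp_cmult bexp_multc hit_def gexp_def mult.assoc)
  also have "bexp ?p (crossing S (U - S)) (\<lambda>F2. if F2 = {} then 1 else 0) = exp (- q * wt S * wt (U - S))"
    using bexp_eq_indicator[of "crossing S (U - S)" "{}" ?p "\<lambda>_. 1"] prod_crossing[of S "U - S"] assms fU by auto
  finally show ?thesis .
qed

lemma hit_law:
  assumes "B \<subseteq> S" "S \<subseteq> U" "U \<subseteq> V"
  shows "G U (\<lambda>F. of_bool (reach B F = S)) = hit B S * exp (- q * wt S * wt (U - S))"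
proof -
  have "U - S \<subseteq> V" using assms by auto
  then show ?thesis using markov_reach[OF assms, of "\<lambda>_. 1"] by simp
qed

lemma markov_law:
  assumes "B \<subseteq> S" "S \<subseteq> V"
  shows "G V (\<lambda>F. of_bool (reach B F = S) * f (F \<inter> eds (V - S))) = law B S * G (V - S) f"
  using markov_reach[OF assms order_refl, of f] hit_law[OF assms order_refl] by (simp add: law_def)

lemma law_nonneg: "0 \<le> law B S"
  unfolding law_def by (rule G_nonneg) auto

lemma sum_law:
  assumes "B \<subseteq> V"
  shows "(\<Sum>S\<in>Pow V. law B S * f S) = G V (\<lambda>F. f (reach B F))"
  unfolding law_def gexp_def by (rule bexp_delta) (use fin reach_subset[OF _ assms] in auto)

end

section \<open>Tilting by vertex deletion\<close>

lemma bexp_member: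
  assumes "finite D" "x \<in> D"
  shows "bexp p D (\<lambda>F. of_bool (x \<in> F)) = p x"
proof -
  have "bexp p (insert x (D - {x})) (\<lambda>F. of_bool (x \<in> F))
    = p x * bexp p (D - {x}) (\<lambda>F. 1) + (1 - p x) * bexp p (D - {x}) (\<lambda>F. of_bool (x \<in> F))"
    using assms by (subst bexp_insert) auto
  also have "bexp p (D - {x}) (\<lambda>F. of_bool (x \<in> F)) = bexp p (D - {x}) (\<lambda>F. 0)"
    by (rule bexp_cong) auto
  finally show ?thesis using assms by (simp add: insert_absorb)
qed

lemma bexp_one:
  assumes "finite D"
  shows "bexp (\<lambda>_. 1) D f = f D"
  using assms by (induction D arbitrary: f) (simp_all add: bexp_insert, simp add: bexp_def)

text \<open>The cumulant generating function at \<open>b\<close> of a Bernoulli variable with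
  parameter \<open>1 - exp (- a)\<close>. A vertex outside \<open>S\<close> that gets deleted no
  longer has to avoid \<open>S\<close>, which is worth a factor \<open>exp b\<close> with
  \<open>b = q * wt S * w i\<close>.\<close>

definition psi :: "real \<Rightarrow> real \<Rightarrow> real" where
  "psi a b = ln (1 + (1 - exp (- a)) * (exp b - 1))"

lemma psi_arg_ge_1:
  fixes a b :: real
  assumes "0 \<le> a" "0 \<le> b"
  shows "1 \<le> 1 + (1 - exp (- a)) * (exp b - 1)"
  using assms by simp

lemma exp_psi:
  assumes "0 \<le> a" "0 \<le> b"
  shows "exp (psi a b) = exp (- a) + (1 - exp (- a)) * exp b"
  using psi_arg_ge_1[OF assms] by (simp add: psi_def algebra_simps)

lemma psi_le_arg:
  assumes "0 \<le> a" "0 \<le> b"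
  shows "psi a b \<le> (1 - exp (- a)) * (exp b - 1)"
  using ln_add_one_self_le_self[of "(1 - exp (- a)) * (exp b - 1)"] psi_arg_ge_1[OF assms]
  by (simp add: psi_def)

text \<open>A vertex inside \<open>S\<close> pays \<open>a\<close> for being retained and
  contributes no \<open>psi\<close> term. Relative to a sum of \<open>psi\<close> over all of
  \<open>V\<close> its cost is therefore \<open>a + psi a b\<close>.\<close>

lemma psi_add_le:
  assumes "0 \<le> a" "0 \<le> b"
  shows "a + psi a b \<le> a * exp b"
proof -
  have "psi a b \<le> (1 - exp (- a)) * (exp b - 1)"
    by (rule psi_le_arg) fact+
  also have "\<dots> \<le> a * (exp b - 1)"
    using exp_ge_add_one_self[of "- a"] assms by (intro mult_right_mono) auto
  finally show ?thesis by (simp add: algebra_simps)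
qed

context rank_one
begin

text \<open>The start \<open>B\<close> is never deleted, so thinning runs over \<open>V - B\<close>
  only, and each set reached from \<open>B\<close> contains \<open>B\<close>.\<close>

definition tilt :: "'a set \<Rightarrow> ('a \<Rightarrow> real) \<Rightarrow> 'a set \<Rightarrow> real" where
  "tilt B \<pi> S = bexp \<pi> (V - B) (\<lambda>A. G (B \<union> A) (\<lambda>F. of_bool (reach B F = S)))"

lemma tilt_nonneg:
  assumes "\<And>i. i \<in> V \<Longrightarrow> 0 \<le> \<pi> i \<and> \<pi> i \<le> 1" "B \<subseteq> V"
  shows "0 \<le> tilt B \<pi> S"
  unfolding tilt_def using assms by (intro bexp_nonneg G_nonneg) auto

lemma sum_tilt:
  assumes "B \<subseteq> V"
  shows "(\<Sum>S\<in>Pow V. tilt B \<pi> S * f S) = bexp \<pi> (V - B) (\<lambda>A. G (B \<union> A) (\<lambda>F. f (reach B F)))"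
proof -
  have "(\<Sum>S\<in>Pow V. tilt B \<pi> S * f S)
    = bexp \<pi> (V - B) (\<lambda>A. \<Sum>S\<in>Pow V. G (B \<union> A) (\<lambda>F. of_bool (reach B F = S)) * f S)"
    by (simp add: tilt_def bexp_sum bexp_multc)
  also have "\<dots> = bexp \<pi> (V - B) (\<lambda>A. G (B \<union> A) (\<lambda>F. f (reach B F)))"
  proof (rule bexp_cong)
    fix A assume "A \<subseteq> V - B"
    then have "reach B F \<in> Pow V" if "F \<subseteq> eds (B \<union> A)" for F
      using reach_subset[OF that, of B] assms by auto
    then show "(\<Sum>S\<in>Pow V. G (B \<union> A) (\<lambda>F. of_bool (reach B F = S)) * f S) = G (B \<union> A) (\<lambda>F. f (reach B F))"
      unfolding gexp_def using fin by (intro bexp_delta) auto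
  qed
  finally show ?thesis .
qed

text \<open>For the reached set to be \<open>S\<close>, every vertex of \<open>S - B\<close> must be
  retained; this gives the product of the \<open>\<pi> i\<close>. Given the retained set
  \<open>A\<close> outside \<open>S\<close>, the non-edge factor is
  \<open>exp (- q * wt S * wt A)\<close>. Its average, divided by the corresponding factor for
  \<open>A = V - S\<close> that is part of \<open>law\<close>, is the second product.\<close>

lemma tilt_eq:
  assumes "B \<subseteq> S" "S \<subseteq> V"
  shows "tilt B \<pi> S = law B S * (\<Prod>i\<in>S - B. \<pi> i) * (\<Prod>i\<in>V - S. \<pi> i + (1 - \<pi> i) * exp (q * wt S * w i))"
proof -
  have VB: "V - B = (S - B) \<union> (V - S)" using assms by auto
  have fins: "finite (S - B)" "finite (V - S)" using assms by (auto intro!: fin_sub)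
  let ?K = "bexp \<pi> (V - S) (\<lambda>A. hit B S * exp (- q * wt S * wt A))"
  have "tilt B \<pi> S = bexp \<pi> (S - B) (\<lambda>A1. bexp \<pi> (V - S) (\<lambda>A2.
      G (B \<union> (A1 \<union> A2)) (\<lambda>F. of_bool (reach B F = S))))"
    unfolding tilt_def VB using fins by (intro bexp_union) auto
  also have "\<dots> = bexp \<pi> (S - B) (\<lambda>A1. if A1 = S - B then ?K else 0)"
  proof (rule bexp_cong)
    fix A1 assume A1: "A1 \<subseteq> S - B"
    show "bexp \<pi> (V - S) (\<lambda>A2. G (B \<union> (A1 \<union> A2)) (\<lambda>F. of_bool (reach B F = S)))
      = (if A1 = S - B then ?K else 0)"
    proof (cases "A1 = S - B")
      case True
      have "G (B \<union> (A1 \<union> A2)) (\<lambda>F. of_bool (reach B F = S)) = hit B S * exp (- q * wt S * wt A2)"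
        if "A2 \<subseteq> V - S" for A2
      proof -
        have "B \<union> (A1 \<union> A2) = S \<union> A2" "S \<union> A2 - S = A2" using True that assms by auto
        moreover have "S \<union> A2 \<subseteq> V" using assms that by auto
        ultimately show ?thesis using hit_law[of B S "S \<union> A2"] assms by simp
      qed
      then show ?thesis using True by (auto intro!: bexp_cong)
    next
      case False
      have "G (B \<union> (A1 \<union> A2)) (\<lambda>F. of_bool (reach B F = S)) = 0" if "A2 \<subseteq> V - S" for A2
      proof -
        have "reach B F \<noteq> S" if F: "F \<subseteq> eds (B \<union> (A1 \<union> A2))" for F
          using reach_subset[OF F, of B] False A1 \<open>A2 \<subseteq> V - S\<close> by auto
        then have "G (B \<union> (A1 \<union> A2)) (\<lambda>F. of_bool (reach B F = S)) = G (B \<union> (A1 \<union> A2)) (\<lambda>F. 0)"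
          by (intro G_cong) auto
        then show ?thesis using that A1 assms by (subst (asm) G_const) auto
      qed
      then have "bexp \<pi> (V - S) (\<lambda>A2. G (B \<union> (A1 \<union> A2)) (\<lambda>F. of_bool (reach B F = S)))
         = bexp \<pi> (V - S) (\<lambda>A2. 0)"
        by (intro bexp_cong) auto
      then show ?thesis using False fins by simp
    qed
  qed
  also have "\<dots> = (\<Prod>i\<in>S - B. \<pi> i) * ?K"
    using fins by (subst bexp_eq_indicator) auto
  also have "?K = hit B S * bexp \<pi> (V - S) (\<lambda>A. \<Prod>i\<in>A. exp (- q * wt S * w i))"
    by (simp add: bexp_cmult sum_distrib_left flip: exp_sum cong: bexp_cong)
      (intro disjI2 bexp_cong, subst exp_sum[symmetric], auto simp: sum_distrib_left sum_negf intro: finite_subset[OF _ fins(2)])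
  also have "bexp \<pi> (V - S) (\<lambda>A. \<Prod>i\<in>A. exp (- q * wt S * w i))
    = (\<Prod>i\<in>V - S. exp (- q * wt S * w i) * (\<pi> i + (1 - \<pi> i) * exp (q * wt S * w i)))"
    using fins by (subst bexp_prod) (auto intro!: prod.cong simp: algebra_simps simp flip: exp_add)
  also have "\<dots> = exp (- q * wt S * wt (V - S)) * (\<Prod>i\<in>V - S. \<pi> i + (1 - \<pi> i) * exp (q * wt S * w i))"
    using fins by (simp add: prod.distrib sum_distrib_left sum_negf flip: exp_sum)
  finally show ?thesis using hit_law[OF assms order_refl] by (simp add: law_def)
qed

lemma tilt_exp:
  assumes "B \<subseteq> S" "S \<subseteq> V" "\<And>i. i \<in> V \<Longrightarrow> 0 \<le> a i"
  shows "tilt B (\<lambda>i. exp (- a i)) S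
    = law B S * exp ((\<Sum>i\<in>V - S. psi (a i) (q * wt S * w i)) - (\<Sum>i\<in>S - B. a i))"
proof -
  have fins: "finite (S - B)" "finite (V - S)" using assms by (auto intro!: fin_sub)
  have "(\<Prod>i\<in>V - S. exp (- a i) + (1 - exp (- a i)) * exp (q * wt S * w i))
     = (\<Prod>i\<in>V - S. exp (psi (a i) (q * wt S * w i)))"
    using assms w_pos q_nonneg wt_nonneg[of S]
    by (intro prod.cong exp_psi[symmetric] mult_nonneg_nonneg) (auto intro: less_imp_le)
  also have "\<dots> = exp (\<Sum>i\<in>V - S. psi (a i) (q * wt S * w i))" using fins by (simp add: exp_sum)
  finally have 1: "(\<Prod>i\<in>V - S. exp (- a i) + (1 - exp (- a i)) * exp (q * wt S * w i))
    = exp (\<Sum>i\<in>V - S. psi (a i) (q * wt S * w i))" .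
  have "(\<Prod>i\<in>S - B. exp (- a i)) = exp (- (\<Sum>i\<in>S - B. a i))"
    using fins by (simp add: exp_sum sum_negf[symmetric])
  with 1 show ?thesis by (simp add: tilt_eq[OF assms(1,2)] mult.assoc flip: exp_add)
qed

text \<open>The exponent \<open>d i * exp (- q * t * w i)\<close> is chosen so that the contributions of the vertices
  inside \<open>S\<close> add up to at most \<open>sum d S\<close>, whatever the composition of \<open>S\<close>.\<close>
lemma law_le_tilt:
  assumes "B \<subseteq> S" "S \<subseteq> V" "\<And>i. i \<in> V \<Longrightarrow> 0 \<le> d i" "wt S \<le> t"
    and a: "a = (\<lambda>i. d i * exp (- q * t * w i))"
    and g: "g \<le> (\<Sum>i\<in>V. psi (a i) (q * wt S * w i)) - sum d S + sum a B"
  shows "law B S \<le> exp (- g) * tilt B (\<lambda>i. exp (- a i)) S"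
proof -
  have a0: "0 \<le> a i" if "i \<in> V" for i using assms(3)[OF that] a by simp
  have b0: "0 \<le> q * wt S * w i" if "i \<in> V" for i
    using q_nonneg wt_nonneg[OF assms(2)] w_pos[OF that] by simp
  have fins: "finite S" "finite V" using assms by (auto intro!: fin_sub)
  have le: "a i + psi (a i) (q * wt S * w i) \<le> d i" if "i \<in> V" for i
  proof -
    have "a i + psi (a i) (q * wt S * w i) \<le> a i * exp (q * wt S * w i)"
      by (rule psi_add_le) (use a0 b0 that in auto)
    also have "\<dots> = d i * exp (q * (wt S - t) * w i)"
      by (simp add: a algebra_simps flip: exp_add)
    also have "\<dots> \<le> d i * 1"
    proof (intro mult_left_mono assms(3) that)
      have "q * (wt S - t) * w i \<le> 0"
        using assms(4) q_nonneg w_pos[OF that] by (intro mult_nonpos_nonneg mult_nonneg_nonpos) auto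
      then show "exp (q * (wt S - t) * w i) \<le> 1" by simp
    qed
    finally show ?thesis by simp
  qed
  have "(\<Sum>i\<in>S. a i + psi (a i) (q * wt S * w i)) \<le> sum d S"
    by (rule sum_mono) (use le assms(2) in auto)
  moreover have "(\<Sum>i\<in>V - S. psi (a i) (q * wt S * w i)) =
     (\<Sum>i\<in>V. psi (a i) (q * wt S * w i)) - (\<Sum>i\<in>S. psi (a i) (q * wt S * w i))"
    by (rule sum_diff) (use fins assms in auto)
  moreover have "sum a (S - B) = sum a S - sum a B" by (rule sum_diff) (use fins assms in auto)
  ultimately have "g \<le> (\<Sum>i\<in>V - S. psi (a i) (q * wt S * w i)) - sum a (S - B)"
    using g by (simp add: sum.distrib)
  then have "law B S * exp g \<le> tilt B (\<lambda>i. exp (- a i)) S"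
    using law_nonneg[of B S] by (subst tilt_exp[OF assms(1,2)]) (auto intro!: mult_left_mono a0)
  then show ?thesis by (simp add: exp_minus field_simps)
qed

section \<open>Connection probabilities and mean component sizes of subcritical thinned
  graphs\<close>

lemma G_insert_le:
  assumes "v \<notin> A" "insert v A \<subseteq> V" "j \<noteq> v"
  shows "G (insert v A) (\<lambda>F. of_bool (j \<in> reach {v} F))
    \<le> (\<Sum>k\<in>A. edge_prob w q {v, k} * G A (\<lambda>F. of_bool (j \<in> reach {k} F)))"
proof -
  have dj: "{v} \<inter> A = {}" using assms by auto
  have ins: "insert v A = {v} \<union> A" by auto
  have fA: "finite A" "finite {v}" using assms by (auto intro!: fin_sub)
  note E = eds_Un[OF dj]
  let ?p = "edge_prob w q"
  have sub: "e \<in> eds V" if "e \<in> eds {v} \<or> e \<in> crossing {v} A \<or> e \<in> eds A" for e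
    using that E(1) eds_mono[of "{v} \<union> A" V] assms(2) by auto
  have p01: "0 \<le> ?p e \<and> ?p e \<le> 1" if "e \<in> eds {v} \<or> e \<in> crossing {v} A \<or> e \<in> eds A" for e
    using edge_prob01[OF sub[OF that] order_refl] .
  have "G (insert v A) (\<lambda>F. of_bool (j \<in> reach {v} F))
     = bexp ?p (eds {v}) (\<lambda>F1. bexp ?p (crossing {v} A) (\<lambda>F2. bexp ?p (eds A) (\<lambda>F3.
         of_bool (j \<in> reach {v} (F1 \<union> (F2 \<union> F3))))))"
    unfolding gexp_def ins E(1)
    by (subst bexp_union, simp_all add: fA E(2), subst bexp_union, simp_all add: fA E(3))
  also have "\<dots> \<le> bexp ?p (eds {v}) (\<lambda>F1. bexp ?p (crossing {v} A) (\<lambda>F2. bexp ?p (eds A) (\<lambda>F3.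
         \<Sum>k\<in>A. of_bool ({v, k} \<in> F2) * of_bool (j \<in> reach {k} F3))))"
  proof (intro bexp_mono p01; (simp; fail)?)
    fix F1 F2 F3 assume F: "F1 \<subseteq> eds {v}" "F2 \<subseteq> crossing {v} A" "F3 \<subseteq> eds A"
    show "of_bool (j \<in> reach {v} (F1 \<union> (F2 \<union> F3)))
      \<le> (\<Sum>k\<in>A. of_bool ({v, k} \<in> F2) * of_bool (j \<in> reach {k} F3) :: real)"
    proof (cases "j \<in> reach {v} (F1 \<union> (F2 \<union> F3))")
      case True
      obtain k where k: "k \<in> A" "{v, k} \<in> F2" "j \<in> reach {k} F3"
        using reach_star[OF assms(1) F True assms(3)] by blast
      have "(\<Sum>i\<in>{k}. of_bool ({v, i} \<in> F2) * of_bool (j \<in> reach {i} F3) :: real)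
        \<le> (\<Sum>k\<in>A. of_bool ({v, k} \<in> F2) * of_bool (j \<in> reach {k} F3))"
        using k(1) fA by (intro sum_mono2) auto
      then show ?thesis using True k by simp
    qed (simp add: sum_nonneg)
  qed
  also have "\<dots> = (\<Sum>k\<in>A. bexp ?p (crossing {v} A) (\<lambda>F2. of_bool ({v, k} \<in> F2)) * G A (\<lambda>F. of_bool (j \<in> reach {k} F)))"
    using fA by (simp only: bexp_sum bexp_cmult bexp_multc gexp_def bexp_const finite_eds)
  also have "\<dots> = (\<Sum>k\<in>A. edge_prob w q {v, k} * G A (\<lambda>F. of_bool (j \<in> reach {k} F)))"
    using fA by (intro sum.cong refl arg_cong2[of _ _ _ _ "(*)"] bexp_member) (auto simp: pair_in_crossing)
  finally show ?thesis .
qed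

text \<open>Path counting without paths. The first step from \<open>v\<close> leads to a retained
  \<open>k\<close>, and the remaining connection avoids \<open>v\<close>, so induction applies to
  \<open>k\<close> and \<open>U - {k}\<close>. The bound is the geometric series over path lengths:
  each additional intermediate vertex contributes a factor at most \<open>\<nu>\<close>.\<close>

lemma connect_le:
  assumes "U \<subseteq> V" "v \<in> V - U" "j \<in> U" "\<And>i. i \<in> V \<Longrightarrow> 0 \<le> \<pi> i \<and> \<pi> i \<le> 1"
    "q * (\<Sum>i\<in>U. \<pi> i * w i ^ 2) \<le> \<nu>" "\<nu> < 1"
  shows "bexp \<pi> U (\<lambda>A. of_bool (j \<in> A) * G (insert v A) (\<lambda>F. of_bool (j \<in> reach {v} F)))
    \<le> \<pi> j * (q * w v * w j / (1 - \<nu>))"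
  using assms(1,2,3,5)
proof (induction "card U" arbitrary: U v rule: less_induct)
  case less
  have finU: "finite U" using less.prems fin_sub by auto
  have jv: "j \<noteq> v" using less.prems by auto
  have \<pi>01: "0 \<le> \<pi> i \<and> \<pi> i \<le> 1" if "i \<in> U" for i using assms(4) less.prems that by auto
  let ?g = "\<lambda>k A. of_bool (j \<in> A \<and> k \<in> A) * G A (\<lambda>F. of_bool (j \<in> reach {k} F))"
  have "bexp \<pi> U (\<lambda>A. of_bool (j \<in> A) * G (insert v A) (\<lambda>F. of_bool (j \<in> reach {v} F)))
    \<le> bexp \<pi> U (\<lambda>A. \<Sum>k\<in>U. edge_prob w q {v, k} * ?g k A)"
  proof (rule bexp_mono)
    fix A assume A: "A \<subseteq> U"
    have "G (insert v A) (\<lambda>F. of_bool (j \<in> reach {v} F))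
      \<le> (\<Sum>k\<in>A. edge_prob w q {v, k} * G A (\<lambda>F. of_bool (j \<in> reach {k} F)))"
      using A less.prems jv by (intro G_insert_le) auto
    also have "\<dots> = (\<Sum>k\<in>U. edge_prob w q {v, k} * (of_bool (k \<in> A) * G A (\<lambda>F. of_bool (j \<in> reach {k} F))))"
      using A finU by (intro sum.mono_neutral_cong_left) auto
    finally have "of_bool (j \<in> A) * G (insert v A) (\<lambda>F. of_bool (j \<in> reach {v} F))
      \<le> of_bool (j \<in> A) * (\<Sum>k\<in>U. edge_prob w q {v, k} * (of_bool (k \<in> A) * G A (\<lambda>F. of_bool (j \<in> reach {k} F))))"
      by (intro mult_left_mono) auto
    then show "of_bool (j \<in> A) * G (insert v A) (\<lambda>F. of_bool (j \<in> reach {v} F))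
      \<le> (\<Sum>k\<in>U. edge_prob w q {v, k} * ?g k A)"
      by (simp add: sum_distrib_left of_bool_conj mult_ac)
  qed (rule \<pi>01)
  also have "\<dots> = (\<Sum>k\<in>U. edge_prob w q {v, k} * bexp \<pi> U (?g k))"
    by (simp only: bexp_sum bexp_cmult)
  \<comment> \<open>The term \<open>k = j\<close> is the direct edge, where only the retention of
    \<open>j\<close> is needed. For \<open>k \<noteq> j\<close> the retention of \<open>k\<close> is
    split off by \<open>bexp_insert\<close> and the induction hypothesis bounds what
    remains.\<close>
  also have "\<dots> \<le> (\<Sum>k\<in>U. if k = j then q * w v * w j * \<pi> j else q * w v * w k * (\<pi> k * (\<pi> j * (q * w k * w j / (1 - \<nu>)))))"
  proof (rule sum_mono)
    fix k assume k: "k \<in> U"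
    have kv: "v \<noteq> k" using k less.prems by auto
    have e0: "0 \<le> edge_prob w q {v, k}"
      by (rule conjunct1[OF edge_prob01[of _ V]]) (use k less.prems kv in \<open>auto simp: pair_in_eds\<close>)
    have ele: "edge_prob w q {v, k} \<le> q * w v * w k" by (rule edge_prob_le[OF kv])
    have ge0: "0 \<le> q * w v * w k" using e0 ele by simp
    have gnn: "0 \<le> bexp \<pi> U (?g k)"
      using \<pi>01 less.prems by (intro bexp_nonneg mult_nonneg_nonneg G_nonneg) auto
    show "edge_prob w q {v, k} * bexp \<pi> U (?g k)
      \<le> (if k = j then q * w v * w j * \<pi> j else q * w v * w k * (\<pi> k * (\<pi> j * (q * w k * w j / (1 - \<nu>)))))"
    proof (cases "k = j")
      case True
      have "bexp \<pi> U (?g k) \<le> bexp \<pi> U (\<lambda>A. of_bool (j \<in> A))"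
      proof (rule bexp_mono)
        fix A assume A: "A \<subseteq> U"
        have "G A (\<lambda>F. of_bool (j \<in> reach {k} F)) \<le> 1" using A less.prems by (intro G_le_const) auto
        then show "?g k A \<le> of_bool (j \<in> A)" by (auto simp: of_bool_def)
      qed (rule \<pi>01)
      also have "\<dots> = \<pi> j" using finU less.prems by (intro bexp_member)
      finally show ?thesis using True ele e0 ge0 gnn by (auto intro!: mult_mono)
    next
      case False
      have U: "U = insert k (U - {k})" using k by auto
      have "bexp \<pi> (insert k (U - {k})) (?g k) = \<pi> k * bexp \<pi> (U - {k}) (\<lambda>A. ?g k (insert k A)) + (1 - \<pi> k) * bexp \<pi> (U - {k}) (?g k)"
        using finU by (intro bexp_insert) auto
      also have "bexp \<pi> (U - {k}) (?g k) = bexp \<pi> (U - {k}) (\<lambda>A. 0)"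
        by (intro bexp_cong) auto
      also have "\<dots> = 0" using finU by simp
      also have "bexp \<pi> (U - {k}) (\<lambda>A. ?g k (insert k A))
        = bexp \<pi> (U - {k}) (\<lambda>A. of_bool (j \<in> A) * G (insert k A) (\<lambda>F. of_bool (j \<in> reach {k} F)))"
        using False by (intro bexp_cong) auto
      also have "\<dots> \<le> \<pi> j * (q * w k * w j / (1 - \<nu>))" if "0 \<le> \<pi> k"
      proof (rule less.hyps)
        show "card (U - {k}) < card U" using k finU by (intro psubset_card_mono) auto
        have "q * (\<Sum>i\<in>U - {k}. \<pi> i * (w i)\<^sup>2) \<le> q * (\<Sum>i\<in>U. \<pi> i * (w i)\<^sup>2)"
          using q_nonneg \<pi>01 finU by (intro mult_left_mono sum_mono2) auto
        then show "q * (\<Sum>i\<in>U - {k}. \<pi> i * (w i)\<^sup>2) \<le> \<nu>" using less.prems by simp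
      qed (use k False less.prems in auto)
      finally have "bexp \<pi> U (?g k) \<le> \<pi> k * (\<pi> j * (q * w k * w j / (1 - \<nu>)))"
        using U \<pi>01[OF k] by (simp add: mult_left_mono)
      from mult_mono[OF ele this ge0 gnn] False show ?thesis by simp
    qed
  qed
  also have "\<dots> = q * w v * w j * \<pi> j + (\<Sum>k\<in>U - {j}. q * w v * w k * (\<pi> k * (\<pi> j * (q * w k * w j / (1 - \<nu>)))))"
    using finU less.prems by (subst sum.remove[of _ j]) auto
  also have "\<dots> \<le> q * w v * w j * \<pi> j + (\<Sum>k\<in>U. q * w v * w k * (\<pi> k * (\<pi> j * (q * w k * w j / (1 - \<nu>)))))"
    using finU less.prems assms(4,6) q_nonneg w_pos
    by (intro add_left_mono sum_mono2 mult_nonneg_nonneg divide_nonneg_pos) (auto intro!: less_imp_le[OF w_pos])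
  also have "(\<Sum>k\<in>U. q * w v * w k * (\<pi> k * (\<pi> j * (q * w k * w j / (1 - \<nu>)))))
    = (\<pi> j * (q * w v * w j / (1 - \<nu>))) * (q * (\<Sum>k\<in>U. \<pi> k * w k ^ 2))"
    unfolding sum_distrib_left by (intro sum.cong) (auto simp: power2_eq_square)
  also have "\<dots> \<le> (\<pi> j * (q * w v * w j / (1 - \<nu>))) * \<nu>"
  proof (rule mult_left_mono)
    show "q * (\<Sum>k\<in>U. \<pi> k * (w k)\<^sup>2) \<le> \<nu>" by fact
    have "0 \<le> w v" "0 \<le> w j" using w_pos less.prems by (auto intro!: less_imp_le)
    then show "0 \<le> \<pi> j * (q * w v * w j / (1 - \<nu>))"
      using \<pi>01[OF less.prems(3)] q_nonneg assms(6) by auto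
  qed
  \<comment> \<open>The claimed bound is the fixed point \<open>z = z0 + \<nu> * z\<close>, with
    \<open>z0\<close> the contribution of the direct edge.\<close>
  also have "q * w v * w j * \<pi> j + \<pi> j * (q * w v * w j / (1 - \<nu>)) * \<nu> = \<pi> j * (q * w v * w j / (1 - \<nu>))"
    using assms(6) by (simp add: field_simps)
  finally show ?case by simp
qed

end

lemma sum_UN_le:
  fixes f :: "'b \<Rightarrow> real"
  assumes "finite B" "\<And>b. b \<in> B \<Longrightarrow> finite (R b)" "\<And>b x. b \<in> B \<Longrightarrow> x \<in> R b \<Longrightarrow> 0 \<le> f x"
  shows "sum f (\<Union>b\<in>B. R b) \<le> (\<Sum>b\<in>B. sum f (R b))"
  using assms
proof (induction B)
  case (insert b B)
  have "sum f (\<Union>b\<in>insert b B. R b) = sum f (R b) + sum f ((\<Union>b\<in>B. R b) - R b)"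
    using insert by (subst sum.union_disjoint[symmetric]) (auto intro: arg_cong[of _ _ "sum f"])
  also have "sum f ((\<Union>b\<in>B. R b) - R b) \<le> sum f (\<Union>b\<in>B. R b)"
    using insert by (intro sum_mono2) auto
  also have "\<dots> \<le> (\<Sum>b\<in>B. sum f (R b))" using insert by auto
  finally show ?case using insert by simp
qed simp

context rank_one
begin

lemma sum_reach_le:
  assumes "U \<subseteq> V" "v \<in> V - U" "\<And>i. i \<in> V \<Longrightarrow> 0 \<le> c i" "\<And>i. i \<in> V \<Longrightarrow> 0 \<le> \<pi> i \<and> \<pi> i \<le> 1"
    "q * (\<Sum>i\<in>U. \<pi> i * w i ^ 2) \<le> \<nu>" "\<nu> < 1"
  shows "bexp \<pi> U (\<lambda>A. G (insert v A) (\<lambda>F. sum c (reach {v} F)))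
    \<le> c v + q * w v * (\<Sum>j\<in>U. \<pi> j * c j * w j) / (1 - \<nu>)"
proof -
  have finU: "finite U" using assms fin_sub by auto
  let ?g = "\<lambda>j A. of_bool (j \<in> A) * G (insert v A) (\<lambda>F. of_bool (j \<in> reach {v} F))"
  have "G (insert v A) (\<lambda>F. sum c (reach {v} F)) = c v + (\<Sum>j\<in>U. c j * ?g j A)" if A: "A \<subseteq> U" for A
  proof -
    have "sum c (reach {v} F) = c v + (\<Sum>j\<in>U. c j * of_bool (j \<in> A) * of_bool (j \<in> reach {v} F))"
      if F: "F \<subseteq> eds (insert v A)" for F
    proof -
      have R: "reach {v} F \<subseteq> insert v A" using reach_subset[OF F, of "{v}"] by auto
      have "sum c (reach {v} F) = c v + sum c (reach {v} F - {v})"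
        using R finite_subset[OF A finU] reach_self[of "{v}" F]
        by (intro sum.remove) (auto dest: finite_subset)
      also have "sum c (reach {v} F - {v}) = (\<Sum>j\<in>U. c j * of_bool (j \<in> A) * of_bool (j \<in> reach {v} F))"
        using R A finU assms(2) by (intro sum.mono_neutral_cong_left) auto
      finally show ?thesis .
    qed
    then have "G (insert v A) (\<lambda>F. sum c (reach {v} F))
      = G (insert v A) (\<lambda>F. c v + (\<Sum>j\<in>U. c j * of_bool (j \<in> A) * of_bool (j \<in> reach {v} F)))"
      by (intro G_cong) auto
    also have "\<dots> = G (insert v A) (\<lambda>F. c v) + (\<Sum>j\<in>U. c j * ?g j A)"
      by (simp only: gexp_def bexp_add bexp_sum bexp_cmult mult.assoc)
    also have "G (insert v A) (\<lambda>F. c v) = c v" using assms A by (intro G_const) auto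
    finally show ?thesis .
  qed
  then have "bexp \<pi> U (\<lambda>A. G (insert v A) (\<lambda>F. sum c (reach {v} F))) = bexp \<pi> U (\<lambda>A. c v + (\<Sum>j\<in>U. c j * ?g j A))"
    by (intro bexp_cong) auto
  also have "\<dots> = c v + (\<Sum>j\<in>U. c j * bexp \<pi> U (?g j))"
    using finU by (simp only: bexp_add bexp_sum bexp_cmult bexp_const)
  also have "\<dots> \<le> c v + (\<Sum>j\<in>U. c j * (\<pi> j * (q * w v * w j / (1 - \<nu>))))"
    using assms by (intro add_left_mono sum_mono mult_left_mono connect_le) auto
  also have "(\<Sum>j\<in>U. c j * (\<pi> j * (q * w v * w j / (1 - \<nu>)))) = q * w v * (\<Sum>j\<in>U. \<pi> j * c j * w j) / (1 - \<nu>)"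
    by (simp add: sum_distrib_left sum_divide_distrib mult_ac)
  finally show ?thesis .
qed

lemma sum_tilt_wt_le:
  assumes "v \<in> V" "\<And>i. i \<in> V \<Longrightarrow> 0 \<le> \<pi> i \<and> \<pi> i \<le> 1" "q * (\<Sum>i\<in>V. \<pi> i * w i ^ 2) \<le> \<nu>" "\<nu> < 1"
  shows "(\<Sum>S\<in>Pow V. tilt {v} \<pi> S * wt S) \<le> w v / (1 - \<nu>)"
proof -
  have le: "q * (\<Sum>i\<in>V - {v}. \<pi> i * w i ^ 2) \<le> \<nu>"
  proof -
    have "q * (\<Sum>i\<in>V - {v}. \<pi> i * w i ^ 2) \<le> q * (\<Sum>i\<in>V. \<pi> i * w i ^ 2)"
      using q_nonneg assms(2) fin by (intro mult_left_mono sum_mono2) auto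
    then show ?thesis using assms(3) by simp
  qed
  have "(\<Sum>S\<in>Pow V. tilt {v} \<pi> S * wt S) = bexp \<pi> (V - {v}) (\<lambda>A. G ({v} \<union> A) (\<lambda>F. wt (reach {v} F)))"
    using assms(1) by (intro sum_tilt) auto
  also have "\<dots> \<le> w v + q * w v * (\<Sum>j\<in>V - {v}. \<pi> j * w j * w j) / (1 - \<nu>)"
    using sum_reach_le[of "V - {v}" v w \<pi> \<nu>] assms le w_pos by (auto intro: less_imp_le)
  also have "\<dots> = w v + w v * (q * (\<Sum>i\<in>V - {v}. \<pi> i * w i ^ 2)) / (1 - \<nu>)"
    by (simp add: power2_eq_square mult_ac)
  also have "\<dots> \<le> w v + w v * \<nu> / (1 - \<nu>)"
    using le assms(4) w_pos[OF assms(1)] by (intro add_left_mono divide_right_mono mult_left_mono) auto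
  also have "\<dots> = w v / (1 - \<nu>)" using assms(4) by (simp add: field_simps)
  finally show ?thesis .
qed

text \<open>The case of no thinning, \<open>\<pi> = 1\<close>. When summed over vertices, the size
  of the own component gives the sum of squared component sizes, so this is what controls the small
  components.\<close>

lemma susceptibility_le:
  assumes "U \<subseteq> V" "q * (\<Sum>i\<in>U. w i ^ 2) \<le> \<nu>" "\<nu> < 1"
  shows "G U (\<lambda>F. \<Sum>i\<in>U. real (card (reach {i} F))) \<le> real (card U) + q * (wt U)\<^sup>2 / (1 - \<nu>)"
proof -
  have finU: "finite U" using assms fin_sub by auto
  have w0: "0 \<le> w i" if "i \<in> U" for i using w_pos that assms by (auto intro: less_imp_le)
  have "G U (\<lambda>F. \<Sum>i\<in>U. real (card (reach {i} F))) = (\<Sum>i\<in>U. G U (\<lambda>F. real (card (reach {i} F))))"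
    by (simp only: gexp_def bexp_sum)
  also have "\<dots> \<le> (\<Sum>i\<in>U. 1 + q * w i * wt U / (1 - \<nu>))"
  proof (rule sum_mono)
    fix i assume i: "i \<in> U"
    have "q * (\<Sum>j\<in>U - {i}. w j ^ 2) \<le> q * (\<Sum>j\<in>U. w j ^ 2)"
      using q_nonneg finU by (intro mult_left_mono sum_mono2) auto
    then have "bexp (\<lambda>_. 1) (U - {i}) (\<lambda>A. G (insert i A) (\<lambda>F. sum (\<lambda>_. 1) (reach {i} F)))
      \<le> 1 + q * w i * (\<Sum>j\<in>U - {i}. 1 * 1 * w j) / (1 - \<nu>)"
      using assms i by (intro sum_reach_le) auto
    also have "\<dots> \<le> 1 + q * w i * wt U / (1 - \<nu>)"
      using assms(3) q_nonneg w0 i finU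
      by (intro add_left_mono divide_right_mono mult_left_mono) (auto intro!: sum_mono2)
    finally show "G U (\<lambda>F. real (card (reach {i} F))) \<le> 1 + q * w i * wt U / (1 - \<nu>)"
      using finU i by (simp add: bexp_one insert_absorb)
  qed
  also have "\<dots> = real (card U) + q * (wt U)\<^sup>2 / (1 - \<nu>)"
    by (simp add: sum.distrib sum_distrib_left sum_distrib_right sum_divide_distrib power2_eq_square mult_ac)
  finally show ?thesis .
qed

section \<open>Existence of heavy components, and what is left after removing one\<close>

definition big :: "'a \<Rightarrow> real \<Rightarrow> real" where
  "big v K = G V (\<lambda>F. of_bool (K < wt (reach {v} F)))"

lemma sum_tilt_const:
  assumes "B \<subseteq> V"
  shows "(\<Sum>S\<in>Pow V. tilt B \<pi> S) = 1"
proof -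
  have "(\<Sum>S\<in>Pow V. tilt B \<pi> S) = bexp \<pi> (V - B) (\<lambda>A. G (B \<union> A) (\<lambda>F. 1))"
    using sum_tilt[OF assms, of \<pi> "\<lambda>_. 1"] by simp
  also have "\<dots> = bexp \<pi> (V - B) (\<lambda>A. 1)" using assms by (intro bexp_cong G_const) auto
  finally show ?thesis using fin by simp
qed

text \<open>The tilted law is the law of a component in a random induced subgraph.\<close>
lemma sum_tilt_big_le:
  assumes "v \<in> V" "\<And>i. i \<in> V \<Longrightarrow> 0 \<le> \<pi> i \<and> \<pi> i \<le> 1"
  shows "(\<Sum>S\<in>Pow V. tilt {v} \<pi> S * of_bool (K < wt S)) \<le> big v K"
proof -
  have "(\<Sum>S\<in>Pow V. tilt {v} \<pi> S * of_bool (K < wt S))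
    = bexp \<pi> (V - {v}) (\<lambda>A. G ({v} \<union> A) (\<lambda>F. of_bool (K < wt (reach {v} F))))"
    using assms(1) by (intro sum_tilt) auto
  also have "\<dots> \<le> bexp \<pi> (V - {v}) (\<lambda>A. big v K)"
  proof (rule bexp_mono)
    fix A assume A: "A \<subseteq> V - {v}"
    then have AV: "{v} \<union> A \<subseteq> V" using assms(1) by auto
    have "G ({v} \<union> A) (\<lambda>F. of_bool (K < wt (reach {v} F)))
      = G V (\<lambda>F. of_bool (K < wt (reach {v} (F \<inter> eds ({v} \<union> A)))))"
      using AV by (subst G_restrict[OF order_refl]) auto
    also have "\<dots> \<le> big v K" unfolding big_def
    proof (rule G_mono[OF order_refl])
      fix F assume F: "F \<subseteq> eds V"
      have "wt (reach {v} (F \<inter> eds ({v} \<union> A))) \<le> wt (reach {v} F)"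
        using reach_subset[OF F, of "{v}"] assms(1) by (intro wt_mono reach_mono) auto
      then show "of_bool (K < wt (reach {v} (F \<inter> eds ({v} \<union> A)))) \<le> (of_bool (K < wt (reach {v} F)) :: real)"
        by auto
    qed
    finally show "G ({v} \<union> A) (\<lambda>F. of_bool (K < wt (reach {v} F))) \<le> big v K" .
  qed (use assms in auto)
  finally show ?thesis using fin by simp
qed

lemma sum_tilt_big_markov:
  assumes "v \<in> V" "\<And>i. i \<in> V \<Longrightarrow> 0 \<le> \<pi> i \<and> \<pi> i \<le> 1" "q * (\<Sum>i\<in>V. \<pi> i * w i ^ 2) \<le> \<nu>" "\<nu> < 1" "0 < K"
  shows "(\<Sum>S\<in>Pow V. tilt {v} \<pi> S * of_bool (K < wt S)) \<le> w v / (1 - \<nu>) / K"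
proof -
  have "(\<Sum>S\<in>Pow V. tilt {v} \<pi> S * of_bool (K < wt S)) \<le> (\<Sum>S\<in>Pow V. tilt {v} \<pi> S * (wt S / K))"
    using assms wt_nonneg by (intro sum_mono mult_left_mono tilt_nonneg) (auto simp: of_bool_def)
  also have "\<dots> = (\<Sum>S\<in>Pow V. tilt {v} \<pi> S * wt S) / K" by (simp only: sum_divide_distrib[of _ "Pow V"] times_divide_eq_right)
  also have "\<dots> \<le> w v / (1 - \<nu>) / K"
    using assms by (intro divide_right_mono sum_tilt_wt_le) auto
  finally show ?thesis .
qed

lemma law_zero:
  assumes "\<not> B \<subseteq> S"
  shows "law B S = 0"
proof -
  have "law B S = G V (\<lambda>F. 0)"
    unfolding law_def using assms reach_self[of B] by (intro G_cong) auto
  then show ?thesis by simp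
qed

text \<open>Give each vertex the mass \<open>w v / K\<close>; a component heavier than
  \<open>K\<close> then has total mass above 1. Charging by weight instead of counting vertices fits
  bounds on \<open>big v K\<close> that are proportional to \<open>w v\<close>.\<close>

lemma exists_component_le:
  assumes "0 < K" "\<And>S F. F \<subseteq> eds V \<Longrightarrow> S \<subseteq> V \<Longrightarrow> P S F \<Longrightarrow> K < wt S"
  shows "G V (\<lambda>F. of_bool (\<exists>v\<in>V. P (reach {v} F) F)) \<le> (\<Sum>v\<in>V. w v / K * G V (\<lambda>F. of_bool (P (reach {v} F) F)))"
proof -
  have "G V (\<lambda>F. of_bool (\<exists>v\<in>V. P (reach {v} F) F)) \<le> G V (\<lambda>F. \<Sum>v\<in>V. w v / K * of_bool (P (reach {v} F) F))"
  proof (rule G_mono[OF order_refl])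
    fix F assume F: "F \<subseteq> eds V"
    have nn: "0 \<le> w v / K * of_bool (P (reach {v} F) F)" if "v \<in> V" for v
      using assms(1) w_pos[OF that] by auto
    show "of_bool (\<exists>v\<in>V. P (reach {v} F) F) \<le> (\<Sum>v\<in>V. w v / K * of_bool (P (reach {v} F) F))"
    proof (cases "\<exists>v\<in>V. P (reach {v} F) F")
      case True
      then obtain v where v: "v \<in> V" "P (reach {v} F) F" by auto
      let ?S = "reach {v} F"
      have S: "?S \<subseteq> V" using reach_subset[OF F, of "{v}"] v by auto
      have "1 \<le> wt ?S / K" using assms(2)[OF F S v(2)] assms(1) by simp
      also have "\<dots> = (\<Sum>u\<in>?S. w u / K * of_bool (P (reach {u} F) F))"
        unfolding sum_divide_distrib using v by (intro sum.cong) (auto simp: reach_eq)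
      also have "\<dots> \<le> (\<Sum>v\<in>V. w v / K * of_bool (P (reach {v} F) F))"
        using nn S fin by (intro sum_mono2) auto
      finally show ?thesis using True by simp
    qed (simp add: sum_nonneg nn)
  qed
  also have "\<dots> = (\<Sum>v\<in>V. w v / K * G V (\<lambda>F. of_bool (P (reach {v} F) F)))"
    by (simp only: gexp_def bexp_sum bexp_cmult)
  finally show ?thesis .
qed

text \<open>Bounding the tilted mass of heavy sets by \<open>big v K\<close>, and not just by 1,
  keeps a second factor \<open>w v\<close>. The sum over vertices then produces
  \<open>\<theta> * m2 / K\<close>, a bound for the mean number of heavy components, where the
  trivial bound would leave \<open>wt V / K\<close>.\<close>

lemma exists_tilted_component_le:
  assumes "0 < K" "\<And>v. v \<in> V \<Longrightarrow> big v K \<le> \<theta> * w v" "\<And>i. i \<in> V \<Longrightarrow> 0 \<le> \<pi> i \<and> \<pi> i \<le> 1"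
    and "\<And>S. P S \<Longrightarrow> K < wt S" "0 \<le> \<epsilon>"
    and "\<And>v S. S \<subseteq> V \<Longrightarrow> v \<in> S \<Longrightarrow> P S \<Longrightarrow> law {v} S \<le> \<epsilon> * tilt {v} \<pi> S"
  shows "G V (\<lambda>F. of_bool (\<exists>v\<in>V. P (reach {v} F))) \<le> \<epsilon> * (\<theta> * m2 / K)"
proof -
  have *: "G V (\<lambda>F. of_bool (P (reach {v} F))) \<le> \<epsilon> * (\<theta> * w v)" if v: "v \<in> V" for v
  proof -
    have "G V (\<lambda>F. of_bool (P (reach {v} F))) = (\<Sum>S\<in>Pow V. law {v} S * of_bool (P S))"
      using v by (intro sum_law[symmetric]) auto
    also have "\<dots> \<le> (\<Sum>S\<in>Pow V. \<epsilon> * (tilt {v} \<pi> S * of_bool (K < wt S)))"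
    proof (rule sum_mono)
      fix S assume S: "S \<in> Pow V"
      have t0: "0 \<le> tilt {v} \<pi> S" using v assms(3) by (intro tilt_nonneg) auto
      show "law {v} S * of_bool (P S) \<le> \<epsilon> * (tilt {v} \<pi> S * of_bool (K < wt S))"
      proof (cases "P S \<and> v \<in> S")
        case True
        then show ?thesis using assms(4)[of S] assms(6)[of S v] S by auto
      next
        case False
        then have "law {v} S * of_bool (P S) = 0" using law_zero[of "{v}" S] by auto
        moreover have "0 \<le> \<epsilon> * (tilt {v} \<pi> S * of_bool (K < wt S))" using t0 assms(5) by simp
        ultimately show ?thesis by linarith
      qed
    qed
    also have "\<dots> = \<epsilon> * (\<Sum>S\<in>Pow V. tilt {v} \<pi> S * of_bool (K < wt S))" by (simp add: sum_distrib_left)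
    also have "\<dots> \<le> \<epsilon> * (\<theta> * w v)"
      using order_trans[OF sum_tilt_big_le[of v \<pi> K, OF v] assms(2)[OF v]] assms(3,5) by (intro mult_left_mono) auto
    finally show ?thesis .
  qed
  have "G V (\<lambda>F. of_bool (\<exists>v\<in>V. P (reach {v} F))) \<le> (\<Sum>v\<in>V. w v / K * G V (\<lambda>F. of_bool (P (reach {v} F))))"
    by (rule exists_component_le) (use assms in auto)
  also have "\<dots> \<le> (\<Sum>v\<in>V. w v / K * (\<epsilon> * (\<theta> * w v)))"
    using * assms(1) w_pos by (intro sum_mono mult_left_mono) (auto intro: less_imp_le)
  also have "\<dots> = \<epsilon> * (\<theta> * m2 / K)"
    by (simp add: sum_distrib_left sum_divide_distrib power2_eq_square mult_ac)
  finally show ?thesis .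
qed

text \<open>Subcriticality of the rest is a condition on the set \<open>S = reach {v} F\<close>
  alone, so it can be imposed before the rest is revealed. Given \<open>S\<close>, the rest is a
  fresh graph, and Markov's inequality applies to its susceptibility.\<close>

lemma exists_bad_rest_le:
  assumes "0 < K" "\<And>v. v \<in> V \<Longrightarrow> big v K \<le> \<theta> * w v" "\<nu> < 1" "0 < y"
  shows "G V (\<lambda>F. of_bool (\<exists>v\<in>V. K < wt (reach {v} F) \<and> q * (\<Sum>i\<in>V - reach {v} F. w i ^ 2) \<le> \<nu> \<and>
       y < (\<Sum>i\<in>V - reach {v} F. real (card (reach {i} (F \<inter> eds (V - reach {v} F)))))))
    \<le> (\<theta> * m2 / K) * ((real (card V) + q * (wt V)\<^sup>2 / (1 - \<nu>)) / y)"
    (is "G V (\<lambda>F. of_bool (\<exists>v\<in>V. ?P (reach {v} F) F)) \<le> _ * ?r")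
proof -
  have r0: "0 \<le> ?r" using assms q_nonneg by auto
  have *: "G V (\<lambda>F. of_bool (?P (reach {v} F) F)) \<le> (\<theta> * w v) * ?r" if v: "v \<in> V" for v
  proof -
    let ?f = "\<lambda>S F. of_bool (y < (\<Sum>i\<in>V - S. real (card (reach {i} F)))) :: real"
    let ?Q = "\<lambda>S. K < wt S \<and> q * (\<Sum>i\<in>V - S. w i ^ 2) \<le> \<nu>"
    \<comment> \<open>Splitting over the exact reached set makes the event a product, to which
      \<open>markov_law\<close> applies term by term.\<close>
    have "G V (\<lambda>F. of_bool (?P (reach {v} F) F))
      = G V (\<lambda>F. \<Sum>S\<in>Pow V. of_bool (?Q S) * (of_bool (reach {v} F = S) * ?f S (F \<inter> eds (V - S))))"
    proof (rule G_cong)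
      fix F assume F: "F \<subseteq> eds V"
      have R: "reach {v} F \<in> Pow V" using reach_subset[OF F, of "{v}"] v by auto
      have "(\<Sum>S\<in>Pow V. of_bool (?Q S) * (of_bool (reach {v} F = S) * ?f S (F \<inter> eds (V - S))))
        = (\<Sum>S\<in>Pow V. if reach {v} F = S then of_bool (?P S F) else 0)"
        by (intro sum.cong) (auto simp: of_bool_conj)
      then show "of_bool (?P (reach {v} F) F)
        = (\<Sum>S\<in>Pow V. of_bool (?Q S) * (of_bool (reach {v} F = S) * ?f S (F \<inter> eds (V - S))))"
        using R fin by simp
    qed
    also have "\<dots> = (\<Sum>S\<in>Pow V. of_bool (?Q S) * G V (\<lambda>F. of_bool (reach {v} F = S) * ?f S (F \<inter> eds (V - S))))"
      by (simp only: gexp_def bexp_sum bexp_cmult)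
    also have "\<dots> \<le> (\<Sum>S\<in>Pow V. law {v} S * of_bool (K < wt S) * ?r)"
    proof (rule sum_mono)
      fix S assume S: "S \<in> Pow V"
      show "of_bool (?Q S) * G V (\<lambda>F. of_bool (reach {v} F = S) * ?f S (F \<inter> eds (V - S)))
        \<le> law {v} S * of_bool (K < wt S) * ?r"
      proof (cases "?Q S \<and> v \<in> S")
        case True
        have VS: "V - S \<subseteq> V" by auto
        have "G (V - S) (?f S) \<le> G (V - S) (\<lambda>F. 1 / y * (\<Sum>i\<in>V - S. real (card (reach {i} F))))"
          using assms(4) by (intro G_mono[OF VS]) (auto simp: of_bool_def sum_nonneg)
        also have "\<dots> = 1 / y * G (V - S) (\<lambda>F. \<Sum>i\<in>V - S. real (card (reach {i} F)))"
          by (simp only: gexp_def bexp_cmult)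
        also have "\<dots> \<le> 1 / y * (real (card (V - S)) + q * (wt (V - S))\<^sup>2 / (1 - \<nu>))"
          using True assms by (intro mult_left_mono susceptibility_le VS) auto
        also have "\<dots> \<le> 1 / y * (real (card V) + q * (wt V)\<^sup>2 / (1 - \<nu>))"
          using assms q_nonneg wt_nonneg wt_mono fin
          by (intro mult_left_mono add_mono divide_right_mono power_mono) (auto intro: card_mono)
        finally have "G (V - S) (?f S) \<le> ?r" by simp
        then have "law {v} S * G (V - S) (?f S) \<le> law {v} S * ?r"
          by (intro mult_left_mono law_nonneg)
        moreover have "G V (\<lambda>F. of_bool (reach {v} F = S) * ?f S (F \<inter> eds (V - S))) = law {v} S * G (V - S) (?f S)"
          using True S by (intro markov_law) auto
        ultimately show ?thesis using True by simp
      next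
        case False
        have "G V (\<lambda>F. of_bool (reach {v} F = S) * ?f S (F \<inter> eds (V - S))) = G V (\<lambda>F. 0)" if "v \<notin> S"
          using that reach_self[of "{v}"] by (intro G_cong) (auto dest!: subsetD)
        then have "of_bool (?Q S) * G V (\<lambda>F. of_bool (reach {v} F = S) * ?f S (F \<inter> eds (V - S))) = 0"
          using False by auto
        moreover have "0 \<le> law {v} S * of_bool (K < wt S) * ?r"
          by (intro mult_nonneg_nonneg law_nonneg r0) auto
        ultimately show ?thesis by linarith
      qed
    qed
    also have "\<dots> = (\<Sum>S\<in>Pow V. law {v} S * of_bool (K < wt S)) * ?r"
      by (simp only: sum_distrib_right)
    also have "(\<Sum>S\<in>Pow V. law {v} S * of_bool (K < wt S)) = big v K"
      unfolding big_def using v by (intro sum_law) auto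
    also have "big v K * ?r \<le> (\<theta> * w v) * ?r"
      using assms(2)[OF v] r0 by (intro mult_right_mono)
    finally show ?thesis .
  qed
  have "G V (\<lambda>F. of_bool (\<exists>v\<in>V. ?P (reach {v} F) F)) \<le> (\<Sum>v\<in>V. w v / K * G V (\<lambda>F. of_bool (?P (reach {v} F) F)))"
    by (rule exists_component_le) (use assms in auto)
  also have "\<dots> \<le> (\<Sum>v\<in>V. w v / K * ((\<theta> * w v) * ?r))"
    using * assms(1) w_pos by (intro sum_mono mult_left_mono) (auto intro: less_imp_le)
  also have "\<dots> = (\<Sum>v\<in>V. (\<theta> / K * ?r) * (w v)\<^sup>2)" by (intro sum.cong) (auto simp: power2_eq_square)
  also have "\<dots> = (\<theta> * m2 / K) * ?r"
    by (simp only: sum_distrib_left[symmetric]) simp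
  finally show ?thesis .
qed

text \<open>On sets of weight at most \<open>K\<close> the hypothesis on \<open>psi\<close> lets the
  tilt raise probabilities by at most \<open>exp (\<theta> * w v)\<close>. The thinned graph is
  subcritical, so the tilted law gives light sets nearly full mass. Hence light sets had mass at
  least about \<open>exp (- (\<theta> * w v))\<close> under the original law.\<close>

lemma big_le:
  assumes "v \<in> V" "0 < K" "0 \<le> \<theta>"
    and \<nu>: "q * (\<Sum>i\<in>V. exp (- (\<theta> * w i)) * w i ^ 2) \<le> \<nu>" "\<nu> < 1"
    and psi: "\<And>s. 0 \<le> s \<Longrightarrow> s \<le> K \<Longrightarrow> (\<Sum>i\<in>V. psi (\<theta> * w i) (q * s * w i)) \<le> \<theta> * s"
  shows "big v K \<le> \<theta> * w v + w v / (1 - \<nu>) / K"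
proof -
  let ?\<pi> = "\<lambda>i. exp (- (\<theta> * w i))"
  let ?Q = "\<Sum>S\<in>Pow V. tilt {v} ?\<pi> S * of_bool (K < wt S)"
  have w0: "0 \<le> w i" if "i \<in> V" for i using w_pos[OF that] by simp
  have \<pi>: "0 \<le> ?\<pi> i \<and> ?\<pi> i \<le> 1" if "i \<in> V" for i using w0[OF that] assms(3) by simp
  have Q: "?Q \<le> w v / (1 - \<nu>) / K"
    by (rule sum_tilt_big_markov[OF assms(1) \<pi> \<nu> assms(2)])
  have Qn: "0 \<le> ?Q" using assms(1) \<pi> by (intro sum_nonneg mult_nonneg_nonneg tilt_nonneg) auto
  have "(\<Sum>S\<in>Pow V. tilt {v} ?\<pi> S * of_bool (wt S \<le> K)) + ?Q = (\<Sum>S\<in>Pow V. tilt {v} ?\<pi> S)"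
    unfolding sum.distrib[symmetric] by (intro sum.cong) (auto simp: of_bool_def not_le)
  then have 1: "(\<Sum>S\<in>Pow V. tilt {v} ?\<pi> S * of_bool (wt S \<le> K)) = 1 - ?Q"
    using sum_tilt_const[of "{v}" ?\<pi>] assms(1) by simp
  have "(\<Sum>S\<in>Pow V. law {v} S * of_bool (wt S \<le> K)) + (\<Sum>S\<in>Pow V. law {v} S * of_bool (K < wt S))
     = (\<Sum>S\<in>Pow V. law {v} S * 1)"
    unfolding sum.distrib[symmetric] by (intro sum.cong) (auto simp: of_bool_def not_le)
  also have "\<dots> = 1" using assms(1) by (subst sum_law) auto
  also have "(\<Sum>S\<in>Pow V. law {v} S * of_bool (K < wt S)) = big v K"
    unfolding big_def using assms(1) by (intro sum_law) auto
  finally have 2: "big v K = 1 - (\<Sum>S\<in>Pow V. law {v} S * of_bool (wt S \<le> K))" by simp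
  have le: "tilt {v} ?\<pi> S * of_bool (wt S \<le> K) \<le> exp (\<theta> * w v) * (law {v} S * of_bool (wt S \<le> K))"
    if S: "S \<in> Pow V" for S
  proof (cases "v \<in> S \<and> wt S \<le> K")
    case True
    have fS: "finite S" using S fin_sub by auto
    have psi0: "0 \<le> psi (\<theta> * w i) (q * wt S * w i)" if "i \<in> V" for i
      using psi_arg_ge_1[of "\<theta> * w i" "q * wt S * w i"] w0[OF that] q_nonneg wt_nonneg[of S] S assms(3)
      by (simp add: psi_def)
    have "(\<Sum>i\<in>V - S. psi (\<theta> * w i) (q * wt S * w i)) \<le> (\<Sum>i\<in>V. psi (\<theta> * w i) (q * wt S * w i))"
      using fin psi0 by (intro sum_mono2) auto
    also have "\<dots> \<le> \<theta> * wt S" using psi True S wt_nonneg by auto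
    \<comment> \<open>The start \<open>v\<close> is never deleted and so is not charged in the
      exponent; its share \<open>\<theta> * w v\<close> is exactly the surplus that remains.\<close>
    also have "\<theta> * wt S = (\<Sum>i\<in>S - {v}. \<theta> * w i) + \<theta> * w v"
      using True fS by (simp add: sum.remove[of S v] sum_distrib_left[symmetric] algebra_simps)
    finally have "exp ((\<Sum>i\<in>V - S. psi (\<theta> * w i) (q * wt S * w i)) - (\<Sum>i\<in>S - {v}. \<theta> * w i)) \<le> exp (\<theta> * w v)"
      by simp
    then have "tilt {v} ?\<pi> S \<le> law {v} S * exp (\<theta> * w v)"
      using True S w0 assms(3) law_nonneg by (subst tilt_exp) (auto intro!: mult_left_mono)
    then show ?thesis using True by (simp add: mult.commute)
  next
    case False
    have "tilt {v} ?\<pi> S = 0" if "v \<notin> S"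
    proof -
      have "tilt {v} ?\<pi> S = bexp ?\<pi> (V - {v}) (\<lambda>A. 0)"
        unfolding tilt_def
      proof (rule bexp_cong)
        fix A assume "A \<subseteq> V - {v}"
        have "G ({v} \<union> A) (\<lambda>F. of_bool (reach {v} F = S)) = G ({v} \<union> A) (\<lambda>F. 0)"
          using that reach_self[of "{v}"] by (intro G_cong) (auto dest!: subsetD)
        also have "\<dots> = 0" using assms(1) \<open>A \<subseteq> V - {v}\<close> by (intro G_const) auto
        finally show "G ({v} \<union> A) (\<lambda>F. of_bool (reach {v} F = S)) = 0" .
      qed
      then show ?thesis using fin by simp
    qed
    then show ?thesis using False law_nonneg by auto
  qed
  have "1 - ?Q \<le> (\<Sum>S\<in>Pow V. exp (\<theta> * w v) * (law {v} S * of_bool (wt S \<le> K)))"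
    unfolding 1[symmetric] by (rule sum_mono) (rule le)
  also have "\<dots> = exp (\<theta> * w v) * (1 - big v K)" by (simp add: 2 sum_distrib_left)
  finally have "exp (- (\<theta> * w v)) * (1 - ?Q) \<le> 1 - big v K"
    by (simp add: exp_minus field_simps)
  then have "big v K \<le> (1 - exp (- (\<theta> * w v))) + exp (- (\<theta> * w v)) * ?Q" by (simp add: algebra_simps)
  also have "\<dots> \<le> \<theta> * w v + 1 * ?Q"
    using exp_ge_add_one_self[of "- (\<theta> * w v)"] Qn w0[OF assms(1)] assms(3) by (intro add_mono mult_right_mono) auto
  finally show ?thesis using Q by simp
qed

text \<open>If every component is light, there are two cases. Either the set reached from
  \<open>B\<close> is light, which the tilt prices at \<open>exp (- sum a B)\<close>; or the
  components of the vertices of \<open>B\<close> are light but add up to more than \<open>K\<close>,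
  which Markov's inequality prices by their mean total weight. A whole set \<open>B\<close> is
  explored because a single start survives only with small probability.\<close>

lemma no_big_component_le:
  assumes "B \<subseteq> V" "0 < K" "0 \<le> \<theta>" and a: "a = (\<lambda>i. \<theta> * w i * exp (- q * K * w i))"
    and \<nu>: "q * (\<Sum>i\<in>V. exp (- a i) * w i ^ 2) \<le> \<nu>" "\<nu> < 1"
    and psi: "\<And>s. 0 \<le> s \<Longrightarrow> s \<le> K \<Longrightarrow> \<theta> * s \<le> (\<Sum>i\<in>V. psi (a i) (q * s * w i))"
  shows "G V (\<lambda>F. of_bool (\<forall>v\<in>V. wt (reach {v} F) \<le> K)) \<le> exp (- sum a B) + wt B / (1 - \<nu>) / K"
proof -
  have w0: "0 \<le> w i" if "i \<in> V" for i using w_pos[OF that] by simp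
  have a0: "0 \<le> a i" if "i \<in> V" for i using w0[OF that] assms(3) a by simp
  let ?\<pi> = "\<lambda>i. exp (- a i)"
  have \<pi>: "0 \<le> ?\<pi> i \<and> ?\<pi> i \<le> 1" if "i \<in> V" for i using a0[OF that] by simp
  have law_le: "law B' S * of_bool (wt S \<le> K) \<le> exp (- sum a B') * tilt B' ?\<pi> S"
    if "S \<in> Pow V" "B' \<subseteq> V" for B' S
  proof (cases "B' \<subseteq> S \<and> wt S \<le> K")
    case True
    have "law B' S \<le> exp (- sum a B') * tilt B' ?\<pi> S"
    proof (rule law_le_tilt[where d = "\<lambda>i. \<theta> * w i" and t = K])
      have "sum a B' \<le> sum a B' + ((\<Sum>i\<in>V. psi (a i) (q * wt S * w i)) - \<theta> * wt S)"
        using psi[of "wt S"] True that wt_nonneg[of S] by simp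
      then show "sum a B' \<le> (\<Sum>i\<in>V. psi (a i) (q * wt S * w i)) - (\<Sum>i\<in>S. \<theta> * w i) + sum a B'"
        by (simp add: sum_distrib_left)
    qed (use True that w0 assms(3) a in \<open>auto simp: fun_eq_iff\<close>)
    then show ?thesis using True by simp
  next
    case False
    then have "law B' S * of_bool (wt S \<le> K) = 0" using law_zero by auto
    moreover have "0 \<le> exp (- sum a B') * tilt B' ?\<pi> S"
      using \<pi> that(2) by (intro mult_nonneg_nonneg tilt_nonneg) auto
    ultimately show ?thesis by linarith
  qed
  have 1: "G V (\<lambda>F. of_bool (wt (reach B F) \<le> K)) \<le> exp (- sum a B)"
  proof -
    have "G V (\<lambda>F. of_bool (wt (reach B F) \<le> K)) = (\<Sum>S\<in>Pow V. law B S * of_bool (wt S \<le> K))"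
      using assms(1) by (intro sum_law[symmetric])
    also have "\<dots> \<le> (\<Sum>S\<in>Pow V. exp (- sum a B) * tilt B ?\<pi> S)"
      by (intro sum_mono law_le assms(1))
    also have "\<dots> = exp (- sum a B)"
      using sum_tilt_const[OF assms(1)] by (simp flip: sum_distrib_left)
    finally show ?thesis .
  qed
  let ?f = "\<lambda>v F. wt (reach {v} F) * of_bool (wt (reach {v} F) \<le> K)"
  \<comment> \<open>On light sets the original law is dominated by the tilted one, so the weight of
    a light component is bounded in mean as in the subcritical thinned graph, although the graph
    itself may be supercritical.\<close>
  have 2: "G V (?f v) \<le> w v / (1 - \<nu>)" if v: "v \<in> V" for v
  proof -
    have "G V (?f v) = (\<Sum>S\<in>Pow V. law {v} S * (wt S * of_bool (wt S \<le> K)))"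
      using v by (intro sum_law[symmetric]) auto
    also have "\<dots> \<le> (\<Sum>S\<in>Pow V. tilt {v} ?\<pi> S * wt S)"
    proof (rule sum_mono)
      fix S assume S: "S \<in> Pow V"
      have "law {v} S * of_bool (wt S \<le> K) \<le> exp (- sum a {v}) * tilt {v} ?\<pi> S"
        using S v by (intro law_le) auto
      also have "\<dots> \<le> 1 * tilt {v} ?\<pi> S"
        using a0[OF v] v \<pi> by (intro mult_right_mono tilt_nonneg) auto
      finally have "wt S * (law {v} S * of_bool (wt S \<le> K)) \<le> wt S * (1 * tilt {v} ?\<pi> S)"
        using S wt_nonneg by (intro mult_left_mono) auto
      then show "law {v} S * (wt S * of_bool (wt S \<le> K)) \<le> tilt {v} ?\<pi> S * wt S"
        by (simp add: mult_ac)
    qed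
    also have "\<dots> \<le> w v / (1 - \<nu>)" by (rule sum_tilt_wt_le[OF v \<pi> \<nu>])
    finally show ?thesis .
  qed
  have "G V (\<lambda>F. of_bool (\<forall>v\<in>V. wt (reach {v} F) \<le> K))
    \<le> G V (\<lambda>F. of_bool (wt (reach B F) \<le> K) + 1 / K * (\<Sum>v\<in>B. ?f v F))"
  proof (rule G_mono[OF order_refl])
    fix F assume F: "F \<subseteq> eds V"
    have f0: "0 \<le> ?f v F" if "v \<in> B" for v
      using wt_nonneg[of "reach {v} F"] reach_subset[OF F, of "{v}"] that assms(1) by auto
    show "of_bool (\<forall>v\<in>V. wt (reach {v} F) \<le> K) \<le> of_bool (wt (reach B F) \<le> K) + 1 / K * (\<Sum>v\<in>B. ?f v F)"
    proof (cases "(\<forall>v\<in>V. wt (reach {v} F) \<le> K) \<and> K < wt (reach B F)")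
      case True
      have finB: "finite B" using assms(1) fin_sub by auto
      have R: "reach {b} F \<subseteq> V" if "b \<in> B" for b using reach_subset[OF F, of "{b}"] that assms(1) by auto
      \<comment> \<open>Starts in a common component are counted repeatedly, which is harmless for
        an upper bound.\<close>
      have "wt (reach B F) \<le> (\<Sum>b\<in>B. wt (reach {b} F))"
        unfolding reach_UN[of B F] using finB R w0 fin_sub by (intro sum_UN_le) blast+
      also have "\<dots> = (\<Sum>v\<in>B. ?f v F)" using True assms(1) by (intro sum.cong) auto
      finally have "K < (\<Sum>v\<in>B. ?f v F)" using True by simp
      then have "1 \<le> 1 / K * (\<Sum>v\<in>B. ?f v F)" using assms(2) by (simp add: field_simps)
      then show ?thesis by (simp add: add_increasing)
    next
      case False
      have "0 \<le> (\<Sum>v\<in>B. ?f v F)" by (rule sum_nonneg) (rule f0)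
      then have "0 \<le> 1 / K * (\<Sum>v\<in>B. ?f v F)" using assms(2) by simp
      then show ?thesis using False by (auto simp: of_bool_def not_less)
    qed
  qed
  also have "\<dots> = G V (\<lambda>F. of_bool (wt (reach B F) \<le> K)) + 1 / K * (\<Sum>v\<in>B. G V (?f v))"
    by (simp only: gexp_def bexp_add bexp_cmult bexp_sum)
  also have "\<dots> \<le> exp (- sum a B) + 1 / K * (\<Sum>v\<in>B. w v / (1 - \<nu>))"
    using 1 2 assms(1,2) by (intro add_mono mult_left_mono sum_mono) auto
  also have "1 / K * (\<Sum>v\<in>B. w v / (1 - \<nu>)) = wt B / (1 - \<nu>) / K"
    by (simp add: sum_divide_distrib)
  finally show ?thesis .
qed

end

section \<open>The tilting exponent\<close>

lemma exp_minus_le_quadratic: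
  fixes a :: real
  assumes "0 \<le> a"
  shows "exp (- a) \<le> 1 - a + a\<^sup>2 / 2"
proof -
  have e: "1 + a + a\<^sup>2 / 2 \<le> exp a" by (rule exp_lower_Taylor_quadratic) (rule assms)
  have pos: "0 \<le> 1 - a + a\<^sup>2 / 2"
    using sum_power2_ge_zero[of "1 - a" 1] by (simp add: power2_eq_square algebra_simps)
  have "(1 - a + a\<^sup>2 / 2) * (1 + a + a\<^sup>2 / 2) = 1 + (a\<^sup>2)\<^sup>2 / 4"
    by (simp add: power2_eq_square field_simps)
  then have "1 \<le> (1 - a + a\<^sup>2 / 2) * (1 + a + a\<^sup>2 / 2)" by simp
  also have "\<dots> \<le> (1 - a + a\<^sup>2 / 2) * exp a" by (intro mult_left_mono e pos)
  finally show ?thesis by (simp add: exp_minus field_simps)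
qed

lemma exp_minus_ge_cubic:
  fixes a :: real
  shows "1 - a + a\<^sup>2 / 2 - a ^ 3 / 6 \<le> exp (- a)"
proof -
  obtain t where "exp (- a) = (\<Sum>m<4. (- a) ^ m / fact m) + exp t / fact 4 * (- a) ^ 4"
    using Maclaurin_exp_le[of "- a" 4] by blast
  moreover have "0 \<le> exp t / fact 4 * (- a) ^ 4" by simp
  ultimately show ?thesis by (simp add: numeral_eq_Suc fact_numeral)
qed

text \<open>Convexity of \<open>exp\<close> on the segment from 0 to \<open>b\<close> gives
  \<open>psi a b \<ge> (1 - exp (- a)) * b\<close>. No upper bound on \<open>a\<close> or
  \<open>b\<close> is needed, so this also covers the heaviest vertices.\<close>

lemma psi_ge:
  assumes "0 \<le> a" "0 \<le> b"
  shows "(a - a\<^sup>2 / 2) * b \<le> psi a b"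
proof -
  define x where "x = 1 - exp (- a)"
  have x: "0 \<le> x" "x \<le> 1" "a - a\<^sup>2 / 2 \<le> x" using assms exp_minus_le_quadratic[of a] by (auto simp: x_def)
  have "exp ((1 - x) *\<^sub>R 0 + x *\<^sub>R b) \<le> (1 - x) * exp 0 + x * exp b"
    using x by (intro convex_onD[OF exp_convex]) auto
  then have "exp (x * b) \<le> 1 + x * (exp b - 1)" by (simp add: algebra_simps)
  then have "x * b \<le> psi a b"
    unfolding psi_def x_def[symmetric] by (metis exp_gt_zero ln_exp ln_le_cancel_iff order_less_le_trans)
  moreover have "(a - a\<^sup>2 / 2) * b \<le> x * b" using x assms by (intro mult_right_mono)
  ultimately show ?thesis by linarith
qed

text \<open>Keeping \<open>b^2 / 2\<close> in the expansion of \<open>exp b\<close> yields the gain.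
  Bounding \<open>ln (1 + y)\<close> below by \<open>y - y^2\<close> with
  \<open>y \<le> 2 * a * b\<close> loses \<open>4 * a^2 * b^2\<close>, that is
  \<open>8 * a^2\<close> inside the last bracket; the constant 9 covers this and the term from
  \<open>a - a^2 / 2\<close>.\<close>

lemma psi_ge_second_order:
  assumes "0 \<le> a" "a \<le> 1" "0 \<le> b" "b \<le> 1 / 2"
  shows "(a - a\<^sup>2 / 2) * b + (b\<^sup>2 / 2) * (a - 9 * a\<^sup>2) \<le> psi a b"
proof -
  define x where "x = 1 - exp (- a)"
  define y where "y = x * (exp b - 1)"
  have x: "0 \<le> x" "x \<le> a" "a - a\<^sup>2 / 2 \<le> x"
    using assms exp_minus_le_quadratic[of a] exp_ge_add_one_self[of "- a"] by (auto simp: x_def)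
  have eb: "b + b\<^sup>2 / 2 \<le> exp b - 1" using exp_lower_Taylor_quadratic[of b] assms by simp
  have "exp b \<le> 1 + b + b\<^sup>2" by (rule exp_bound) (use assms in auto)
  moreover have "b * b \<le> b * 1" using assms by (intro mult_left_mono) auto
  ultimately have eb2: "exp b - 1 \<le> 2 * b" by (simp add: power2_eq_square)
  have y: "0 \<le> y" "y \<le> a * (2 * b)"
    unfolding y_def using x eb2 assms by (auto intro!: mult_mono mult_nonneg_nonneg)
  have "a * (2 * b) \<le> 1 * 1" using assms by (intro mult_mono) auto
  then have y1: "y \<le> 1" using y by simp
  have "y\<^sup>2 \<le> (a * (2 * b))\<^sup>2" using y by (intro power_mono)
  moreover have "(a - a\<^sup>2 / 2) * (b + b\<^sup>2 / 2) \<le> y"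
  proof -
    have "(a - a\<^sup>2 / 2) * (b + b\<^sup>2 / 2) \<le> x * (b + b\<^sup>2 / 2)"
      using x assms by (intro mult_right_mono) auto
    also have "\<dots> \<le> y" unfolding y_def using eb x by (intro mult_left_mono)
    finally show ?thesis .
  qed
  moreover have "y - y\<^sup>2 \<le> ln (1 + y)" by (rule ln_one_plus_pos_lower_bound) (use y y1 in auto)
  moreover have "(a - a\<^sup>2 / 2) * (b + b\<^sup>2 / 2) - (a * (2 * b))\<^sup>2
     = (a - a\<^sup>2 / 2) * b + (b\<^sup>2 / 2) * (a - 9 * a\<^sup>2) + (b\<^sup>2 / 2) * (a\<^sup>2 / 2)"
    by (simp add: power2_eq_square field_simps)
  moreover have "0 \<le> (b\<^sup>2 / 2) * (a\<^sup>2 / 2)" by simp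
  moreover have "psi a b = ln (1 + y)" by (simp add: psi_def y_def x_def)
  ultimately show ?thesis by linarith
qed

text \<open>The alternative in the hypothesis takes care of heavy vertices: if \<open>b > 1\<close>
  then \<open>1 \<le> a\<close>, and the trivial bound \<open>psi a b \<le> b\<close> is already
  below \<open>a * b\<close>. In \<open>sum_psi_le\<close> the alternative holds because there
  \<open>b \<le> a\<close>.\<close>

lemma psi_le:
  assumes "0 \<le> a" "0 \<le> b" "b \<le> 1 \<or> 1 \<le> a"
  shows "psi a b \<le> a * b + a * b\<^sup>2"
proof (cases "b \<le> 1")
  case True
  have "psi a b \<le> (1 - exp (- a)) * (exp b - 1)" by (rule psi_le_arg) fact+
  also have "\<dots> \<le> a * (b + b\<^sup>2)"
    using exp_ge_add_one_self[of "- a"] exp_bound[of b] True assms by (intro mult_mono) auto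
  finally show ?thesis by (simp add: algebra_simps)
next
  case False
  have "1 + (1 - exp (- a)) * (exp b - 1) \<le> exp b"
    using mult_right_mono[of "1 - exp (- a)" 1 "exp b - 1"] assms(2) by simp
  then have "psi a b \<le> ln (exp b)"
    unfolding psi_def using psi_arg_ge_1[OF assms(1,2)] by (subst ln_le_cancel_iff) auto
  also have "\<dots> \<le> a * b" using mult_right_mono[of 1 a b] False assms by simp
  also have "\<dots> \<le> a * b + a * b\<^sup>2" using assms by simp
  finally show ?thesis .
qed

lemma psi_le_second_order:
  assumes "0 \<le> a" "a \<le> 1" "0 \<le> b" "b \<le> 1"
  shows "psi a b \<le> a * b + a * b\<^sup>2 - a\<^sup>2 / 2 * (1 - a) * b"
proof -
  have c: "a ^ 3 / 6 \<le> a\<^sup>2 / 2 * a" using assms by (simp add: power2_eq_square power3_eq_cube)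
  have le0: "0 \<le> a\<^sup>2 / 2 * (1 - a)" using assms by simp
  have "psi a b \<le> (1 - exp (- a)) * (exp b - 1)" by (rule psi_le_arg) fact+
  also have "\<dots> \<le> (a - a\<^sup>2 / 2 * (1 - a)) * (b + b\<^sup>2)"
  proof (rule mult_mono)
    show "1 - exp (- a) \<le> a - a\<^sup>2 / 2 * (1 - a)"
    proof -
      have "a\<^sup>2 / 2 * (1 - a) = a\<^sup>2 / 2 - a\<^sup>2 / 2 * a" by (simp add: field_simps)
      then show ?thesis using exp_minus_ge_cubic[of a] c by linarith
    qed
    have "a\<^sup>2 / 2 * (1 - a) \<le> a * 1" 
      using assms mult_left_mono[of "a * (1 - a)" 2 a] mult_mono[of a 1 "1 - a" 1] by (simp add: power2_eq_square)
    then show "0 \<le> a - a\<^sup>2 / 2 * (1 - a)" by simp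
  qed (use exp_bound[of b] assms in auto)
  also have "\<dots> = a * b + a * b\<^sup>2 - a\<^sup>2 / 2 * (1 - a) * b - a\<^sup>2 / 2 * (1 - a) * b\<^sup>2"
    by (simp add: field_simps)
  also have "\<dots> \<le> a * b + a * b\<^sup>2 - a\<^sup>2 / 2 * (1 - a) * b" using le0 by simp
  finally show ?thesis .
qed

context rank_one
begin

lemma sum_psi_ge:
  assumes "\<And>i. i \<in> V \<Longrightarrow> 0 \<le> d i" and a: "a = (\<lambda>i. d i * exp (- q * t * w i))" and "0 \<le> s" "0 \<le> t"
  shows "q * s * ((\<Sum>i\<in>V. d i * w i) - q * t * (\<Sum>i\<in>V. d i * w i ^ 2) - (\<Sum>i\<in>V. d i ^ 2 * w i) / 2)
    \<le> (\<Sum>i\<in>V. psi (a i) (q * s * w i))"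
proof -
  have "q * s * ((\<Sum>i\<in>V. d i * w i) - q * t * (\<Sum>i\<in>V. d i * w i ^ 2) - (\<Sum>i\<in>V. d i ^ 2 * w i) / 2)
    = (\<Sum>i\<in>V. (d i * (1 - q * t * w i) - d i ^ 2 / 2) * (q * s * w i))"
    by (simp add: sum_distrib_left sum_divide_distrib sum_subtractf[symmetric] power2_eq_square algebra_simps)
  also have "\<dots> \<le> (\<Sum>i\<in>V. psi (a i) (q * s * w i))"
  proof (rule sum_mono)
    fix i assume i: "i \<in> V"
    have b: "0 \<le> q * s * w i" "0 \<le> q * t * w i" using q_nonneg assms(3,4) w_pos[OF i] by auto
    have d: "0 \<le> d i" by (rule assms(1)[OF i])
    have a0: "0 \<le> a i" using d a by simp
    have ad: "a i \<le> d i" using d b(2) by (simp add: a mult_left_le)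
    have "d i * (1 - q * t * w i) \<le> a i"
      unfolding a using exp_ge_add_one_self[of "- q * t * w i"] d by (intro mult_left_mono) auto
    moreover have "a i ^ 2 \<le> d i ^ 2" using a0 ad by (intro power_mono)
    ultimately have "(d i * (1 - q * t * w i) - d i ^ 2 / 2) * (q * s * w i) \<le> (a i - a i ^ 2 / 2) * (q * s * w i)"
      using b by (intro mult_right_mono) auto
    also have "\<dots> \<le> psi (a i) (q * s * w i)" by (rule psi_ge) fact+
    finally show "(d i * (1 - q * t * w i) - d i ^ 2 / 2) * (q * s * w i) \<le> psi (a i) (q * s * w i)" .
  qed
  finally show ?thesis .
qed

text \<open>The gain \<open>q * s / 2\<close> compensates half of the loss \<open>q * t\<close> when
  \<open>s\<close> is close to \<open>t\<close>. Without it the exponent would stay positive only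
  for weights below \<open>T / 2\<close>.\<close>

lemma sum_psi_ge_second_order:
  assumes "0 \<le> \<theta>" and a: "a = (\<lambda>i. \<theta> * w i * exp (- q * t * w i))" and "0 \<le> s" "s \<le> t"
    and \<kappa>: "q * t * L + 9 * \<theta> * L \<le> \<kappa>" "\<kappa> \<le> 1 / 2" "0 \<le> L"
  shows "\<theta> * s * (q * m2 - (q * t + \<theta> / 2) * (q * m3)
      + q * s / 2 * (1 - \<kappa>) * (q * m3_upto L))
    \<le> (\<Sum>i\<in>V. psi (a i) (q * s * w i))"
proof -
  have t0: "0 \<le> t" using assms by simp
  let ?x = "\<lambda>i. (\<theta> * w i * (1 - q * t * w i) - (\<theta> * w i) ^ 2 / 2) * (q * s * w i)"
  let ?y = "\<lambda>i. (q * s * w i)\<^sup>2 / 2 * (\<theta> * w i * (1 - \<kappa>))"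
  have "\<theta> * s * (q * m2 - (q * t + \<theta> / 2) * (q * m3)
      + q * s / 2 * (1 - \<kappa>) * (q * m3_upto L))
    = (\<Sum>i\<in>V. ?x i) + (\<Sum>i\<in>{i\<in>V. w i \<le> L}. ?y i)"
  proof -
    have "(\<Sum>i\<in>V. ?x i) = (\<Sum>i\<in>V. \<theta> * s * q * w i ^ 2 - \<theta> * s * (q * t + \<theta> / 2) * q * w i ^ 3)"
      by (intro sum.cong) (auto simp: power2_eq_square power3_eq_cube algebra_simps)
    then have 1: "(\<Sum>i\<in>V. ?x i) = \<theta> * s * q * m2 - \<theta> * s * (q * t + \<theta> / 2) * q * m3"
      by (simp only: sum_subtractf sum_distrib_left)
    have "(\<Sum>i\<in>{i\<in>V. w i \<le> L}. ?y i) = (\<Sum>i\<in>{i\<in>V. w i \<le> L}. \<theta> * s * (q * s / 2) * (1 - \<kappa>) * q * w i ^ 3)"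
      by (intro sum.cong) (auto simp: power2_eq_square power3_eq_cube algebra_simps)
    then have 2: "(\<Sum>i\<in>{i\<in>V. w i \<le> L}. ?y i) = \<theta> * s * (q * s / 2) * (1 - \<kappa>) * q * m3_upto L"
      by (simp only: sum_distrib_left)
    show ?thesis unfolding 1 2 by (simp add: algebra_simps)
  qed
  also have "(\<Sum>i\<in>{i\<in>V. w i \<le> L}. ?y i) = (\<Sum>i\<in>V. if w i \<le> L then ?y i else 0)"
    using fin by (rule sum.inter_filter)
  also have "(\<Sum>i\<in>V. ?x i) + \<dots> \<le> (\<Sum>i\<in>V. psi (a i) (q * s * w i))"
    unfolding sum.distrib[symmetric]
  proof (rule sum_mono)
    fix i assume i: "i \<in> V"
    have wi: "0 \<le> w i" using w_pos[OF i] by simp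
    have b: "0 \<le> q * s * w i" "0 \<le> q * t * w i" using q_nonneg assms(3) t0 wi by auto
    have a0: "0 \<le> a i" using wi a assms(1) by simp
    have ad: "a i \<le> \<theta> * w i" using wi assms(1) b(2) by (simp add: a mult_left_le)
    have age: "\<theta> * w i * (1 - q * t * w i) \<le> a i"
      unfolding a using exp_ge_add_one_self[of "- q * t * w i"] wi assms(1) by (intro mult_left_mono) auto
    have a2: "a i ^ 2 \<le> (\<theta> * w i) ^ 2" using a0 ad by (intro power_mono)
    have x: "?x i \<le> (a i - a i ^ 2 / 2) * (q * s * w i)"
      using b age a2 by (intro mult_right_mono) auto
    show "?x i + (if w i \<le> L then ?y i else 0) \<le> psi (a i) (q * s * w i)"
    proof (cases "w i \<le> L")
      case True
      have wL: "q * t * w i \<le> q * t * L" "\<theta> * w i \<le> \<theta> * L"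
        using True q_nonneg t0 assms(1) by (auto intro!: mult_left_mono)
      have st: "q * s * w i \<le> q * t * w i" using assms(4) q_nonneg wi by (intro mult_right_mono mult_left_mono)
      have qtL: "0 \<le> q * t * L" "0 \<le> \<theta> * L" using q_nonneg t0 assms by auto
      have "\<theta> * w i * (1 - \<kappa>) \<le> \<theta> * w i * (1 - q * t * w i - 9 * (\<theta> * w i))"
        using wL \<kappa> assms(1) wi by (intro mult_left_mono) auto
      also have "\<dots> \<le> a i - 9 * a i ^ 2" using age a2 by (simp add: power2_eq_square algebra_simps)
      finally have "?y i \<le> (q * s * w i)\<^sup>2 / 2 * (a i - 9 * a i ^ 2)" by (intro mult_left_mono) auto
      moreover have "(a i - (a i)\<^sup>2 / 2) * (q * s * w i) + (q * s * w i)\<^sup>2 / 2 * (a i - 9 * (a i)\<^sup>2) \<le> psi (a i) (q * s * w i)"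
        by (rule psi_ge_second_order) (use a0 ad b wL st \<kappa> qtL in auto)
      ultimately show ?thesis using x True by simp
    next
      case False
      have "(a i - (a i)\<^sup>2 / 2) * (q * s * w i) \<le> psi (a i) (q * s * w i)" by (rule psi_ge) fact+
      then show ?thesis using x False by simp
    qed
  qed
  finally show ?thesis .
qed

text \<open>The decisive negative term comes from \<open>1 - exp (- a)\<close> being about
  \<open>a - a^2 / 2\<close>. For \<open>s\<close> small against \<open>T\<close> the bracket drops
  below 1 once \<open>\<theta> / 2 * D\<close> exceeds the excess of \<open>q * m2\<close> over 1,
  hence for \<open>\<theta>\<close> slightly above \<open>2 * x\<close>.\<close>

lemma sum_psi_le:
  assumes "0 \<le> \<theta>" "0 \<le> s" "q * s \<le> \<theta>" "0 \<le> L" "\<theta> * L \<le> \<kappa>" "\<kappa> \<le> 1"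
  shows "(\<Sum>i\<in>V. psi (\<theta> * w i) (q * s * w i))
    \<le> \<theta> * s * (q * m2 + q * s * (q * m3)
        - \<theta> / 2 * (1 - \<kappa>) * (q * m3_upto L))"
proof -
  let ?x = "\<lambda>i. \<theta> * w i * (q * s * w i) + \<theta> * w i * (q * s * w i)\<^sup>2"
  let ?y = "\<lambda>i. (\<theta> * w i)\<^sup>2 / 2 * (1 - \<kappa>) * (q * s * w i)"
  have "(\<Sum>i\<in>V. psi (\<theta> * w i) (q * s * w i)) \<le> (\<Sum>i\<in>V. ?x i - (if w i \<le> L then ?y i else 0))"
  proof (rule sum_mono)
    fix i assume i: "i \<in> V"
    have wi: "0 \<le> w i" using w_pos[OF i] by simp
    have b: "0 \<le> q * s * w i" "0 \<le> \<theta> * w i" using q_nonneg assms wi by auto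
    have ba: "q * s * w i \<le> \<theta> * w i" using assms wi by (intro mult_right_mono)
    show "psi (\<theta> * w i) (q * s * w i) \<le> ?x i - (if w i \<le> L then ?y i else 0)"
    proof (cases "w i \<le> L")
      case True
      have aL: "\<theta> * w i \<le> \<theta> * L" using True assms by (intro mult_left_mono)
      have "psi (\<theta> * w i) (q * s * w i) \<le> ?x i - (\<theta> * w i)\<^sup>2 / 2 * (1 - \<theta> * w i) * (q * s * w i)"
        by (rule psi_le_second_order) (use b ba aL assms in auto)
      moreover have "?y i \<le> (\<theta> * w i)\<^sup>2 / 2 * (1 - \<theta> * w i) * (q * s * w i)"
        using b aL assms by (intro mult_right_mono mult_left_mono) auto
      ultimately show ?thesis using True by simp
    next
      case False
      have "psi (\<theta> * w i) (q * s * w i) \<le> ?x i"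
        by (rule psi_le) (use b ba in auto)
      then show ?thesis using False by simp
    qed
  qed
  also have "\<dots> = (\<Sum>i\<in>V. ?x i) - (\<Sum>i\<in>{i\<in>V. w i \<le> L}. ?y i)"
    by (simp only: sum_subtractf sum.inter_filter[OF fin])
  also have "(\<Sum>i\<in>V. ?x i) = (\<Sum>i\<in>V. \<theta> * s * q * w i ^ 2 + \<theta> * s * (q * s) * q * w i ^ 3)"
    by (intro sum.cong) (auto simp: power2_eq_square power3_eq_cube algebra_simps)
  also have "(\<Sum>i\<in>{i\<in>V. w i \<le> L}. ?y i) = (\<Sum>i\<in>{i\<in>V. w i \<le> L}. \<theta> * s * (\<theta> / 2) * (1 - \<kappa>) * q * w i ^ 3)"
    by (intro sum.cong) (auto simp: power2_eq_square power3_eq_cube algebra_simps)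
  finally show ?thesis
    unfolding sum.distrib sum_distrib_left[symmetric] by (simp add: algebra_simps)
qed

text \<open>Thinning lowers the mean offspring \<open>q * m2\<close> by about
  \<open>\<theta> * D\<close>, so the thinned graph is subcritical as soon as
  \<open>\<theta>\<close> is clearly above \<open>x\<close>, only half of the value
  \<open>2 * x\<close> that matters for the exponent.\<close>

lemma thinned_second_moment_le:
  assumes "0 \<le> \<theta>" "0 \<le> t" and a: "a = (\<lambda>i. \<theta> * w i * exp (- q * t * w i))"
    and "q * t * L + \<theta> * L \<le> \<kappa>" "0 \<le> L"
  shows "q * (\<Sum>i\<in>V. exp (- a i) * w i ^ 2)
    \<le> q * m2 - \<theta> * (1 - \<kappa>) * (q * m3_upto L)"
proof -
  have "(\<Sum>i\<in>V. exp (- a i) * w i ^ 2) \<le> (\<Sum>i\<in>V. w i ^ 2 - (if w i \<le> L then \<theta> * (1 - \<kappa>) * w i ^ 3 else 0))"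
  proof (rule sum_mono)
    fix i assume i: "i \<in> V"
    have wi: "0 \<le> w i" using w_pos[OF i] by simp
    have b: "0 \<le> q * t * w i" using q_nonneg assms(2) wi by auto
    have a0: "0 \<le> a i" using wi a assms(1) by simp
    show "exp (- a i) * w i ^ 2 \<le> w i ^ 2 - (if w i \<le> L then \<theta> * (1 - \<kappa>) * w i ^ 3 else 0)"
    proof (cases "w i \<le> L")
      case True
      have wL: "q * t * w i \<le> q * t * L" "\<theta> * w i \<le> \<theta> * L"
        using True q_nonneg assms by (auto intro!: mult_left_mono)
      have ad: "a i \<le> \<theta> * w i" using wi assms(1) b by (simp add: a mult_left_le)
      have "\<theta> * w i * (1 - q * t * w i) \<le> a i"
        unfolding a using exp_ge_add_one_self[of "- q * t * w i"] wi assms(1) by (intro mult_left_mono) auto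
      moreover have "a i ^ 2 \<le> (\<theta> * w i) ^ 2" using a0 ad by (intro power_mono)
      ultimately have "\<theta> * w i * (1 - q * t * w i) - (\<theta> * w i)\<^sup>2 \<le> 1 - exp (- a i)"
        using exp_minus_le_quadratic[OF a0] zero_le_power2[of "\<theta> * w i"] by linarith
      moreover have "\<theta> * w i * (1 - \<kappa>) \<le> \<theta> * w i * (1 - q * t * w i - \<theta> * w i)"
        using wL assms wi by (intro mult_left_mono) auto
      ultimately have "\<theta> * w i * (1 - \<kappa>) \<le> 1 - exp (- a i)"
        by (simp add: power2_eq_square algebra_simps)
      then have "(\<theta> * w i * (1 - \<kappa>)) * w i ^ 2 \<le> (1 - exp (- a i)) * w i ^ 2" by (intro mult_right_mono) auto
      then show ?thesis using True by (simp add: power2_eq_square power3_eq_cube algebra_simps)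
    next
      case False
      then show ?thesis using a0 mult_right_mono[of "exp (- a i)" 1 "w i ^ 2"] by simp
    qed
  qed
  then have "q * (\<Sum>i\<in>V. exp (- a i) * w i ^ 2)
     \<le> q * (\<Sum>i\<in>V. w i ^ 2 - (if w i \<le> L then \<theta> * (1 - \<kappa>) * w i ^ 3 else 0))"
    using q_nonneg by (rule mult_left_mono)
  also have "\<dots> = q * m2 - \<theta> * (1 - \<kappa>) * (q * m3_upto L)"
    using fin by (simp add: sum_subtractf sum.inter_filter[symmetric] sum_distrib_left[symmetric] algebra_simps)
  finally show ?thesis .
qed

end

section \<open>Barely supercritical graphs\<close>

lemma exists_subset_sum:
  fixes w :: "'b \<Rightarrow> real"
  assumes "finite X" "\<And>i. i \<in> X \<Longrightarrow> 0 \<le> w i \<and> w i \<le> L" "h \<le> sum w X" "0 \<le> h" "0 \<le> L"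
  shows "\<exists>B\<subseteq>X. h \<le> sum w B \<and> sum w B \<le> h + L"
  using assms
proof (induction X)
  case empty
  then show ?case by auto
next
  case (insert i X)
  show ?case
  proof (cases "h \<le> sum w X")
    case True
    then show ?thesis using insert by (meson insertI2 subset_insertI2)
  next
    case False
    then have "sum w (insert i X) \<le> h + L" using insert.hyps insert.prems(1)[of i] by simp
    then show ?thesis using insert.prems by blast
  qed
qed

text \<open>\<open>\<delta>\<close> is the accuracy and \<open>x * D\<close> the excess of the mean
  offspring over 1. \<open>\<Gamma>\<close> is a lower bound for the scale
  \<open>x^2 * (x * D) / q\<close> of the exponents; it plays the role of a large constant, while
  the scale itself is of order \<open>f(n)^3\<close>. The last assumption makes one vertex of weight
  \<open>L\<close> negligible against the set explored in \<open>none_big_le\<close>.\<close>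

locale near_critical = rank_one V w q for V :: "'a set" and w q +
  fixes \<delta> L x D \<Gamma> :: real
  assumes \<delta>: "0 < \<delta>" "\<delta> \<le> 1 / 50" and L: "1 \<le> L" and x: "0 < x" and D: "0 < D" and q_pos: "0 < q"
    and first: "1 \<le> q * wt V" "q * wt V \<le> 1 + \<delta>"
    and second: "q * m2 = 1 + x * D"
    and third: "q * m3 = D"
    and third_trunc: "(1 - \<delta>) * D \<le> q * m3_upto L"
    and xL: "x * L \<le> \<delta>\<^sup>2 / 100" and xD: "x * D \<le> \<delta>"
    and \<Gamma>: "1 / \<delta>\<^sup>2 \<le> \<Gamma>" "\<Gamma> \<le> x\<^sup>2 * (x * D) / q"
    and Lq: "8 * L * q \<le> \<delta>\<^sup>2 * x * (x * D)"
begin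

definition K :: real where "K = \<delta> * x / q"
definition T :: real where "T = 2 * x / q"
text \<open>A common bound for four exponential estimates, whose exponents are at least
  \<open>1/2\<close>, \<open>1/8\<close>, \<open>1\<close> and \<open>3/32\<close> times
  \<open>\<delta> ^ 3 * \<Gamma>\<close>; the constant \<open>1/16\<close> is below all of
  them.\<close>

definition p :: real where "p = exp (- (\<delta> ^ 3 * \<Gamma> / 16))"

lemma q_K: "q * K = \<delta> * x" and q_T: "q * T = 2 * x"
  using q_pos by (simp_all add: K_def T_def)

lemma K_pos: "0 < K" and T_pos: "0 < T"
  using \<delta> x q_pos by (simp_all add: K_def T_def)

lemma xD_pos: "0 < x * D" using x D by simp

lemma \<Gamma>_pos: "0 < \<Gamma>"
  using \<Gamma>(1) \<delta> by (smt (verit) divide_pos_pos zero_less_power)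

lemma x_le: "x \<le> \<delta>\<^sup>2 / 100"
proof -
  have "x * 1 \<le> x * L" using L x by (intro mult_left_mono) auto
  then show ?thesis using xL by simp
qed

lemma \<delta>_sq: "\<delta>\<^sup>2 \<le> \<delta> / 50"
  using \<delta> mult_left_mono[of \<delta> "1 / 50" \<delta>] by (simp add: power2_eq_square)

lemma xL_pos: "0 \<le> x * L" using x L by simp

lemma xL_small: "x * L \<le> \<delta> / 5000"
  using xL \<delta>_sq by simp

text \<open>Fixes the \<open>4 * \<delta>\<close> in \<open>big_K_le\<close>: it pays for two
  factors \<open>1 - \<delta>\<close>, from the expansion and from the truncation at
  \<open>L\<close>, and for the weights up to \<open>K\<close>, which add
  \<open>\<delta>\<close>.\<close>

lemma cube_ineq: "1 + \<delta> \<le> (1 + 4 * \<delta>) * (1 - \<delta>)\<^sup>2"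
proof -
  have "(1 + 4 * \<delta>) * (1 - \<delta>)\<^sup>2 = 1 + 2 * \<delta> - 7 * \<delta>\<^sup>2 + 4 * (\<delta> * \<delta>\<^sup>2)"
    by (simp add: power2_eq_square algebra_simps)
  moreover have "0 \<le> \<delta> * \<delta>\<^sup>2" using \<delta> by simp
  ultimately show ?thesis using \<delta>_sq \<delta> by linarith
qed

text \<open>\<open>2 * x\<close> is the positive root of the survival equation to second order.
  Taking \<open>\<theta>\<close> a factor \<open>1 + 4 * \<delta>\<close> larger turns the expansion
  errors into the inequality that \<open>big_le\<close> asks for and makes the thinned graph
  subcritical by \<open>x * D\<close>; the remaining \<open>\<delta>\<close> absorbs its Markov
  term.\<close>

lemma big_K_le:
  assumes v: "v \<in> V"
  shows "big v K \<le> (2 * x * (1 + 5 * \<delta>)) * w v"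
proof -
  define \<theta> where "\<theta> = 2 * x * (1 + 4 * \<delta>)"
  have \<theta>0: "0 \<le> \<theta>" using x \<delta> by (simp add: \<theta>_def)
  have \<theta>L: "\<theta> * L \<le> \<delta>"
  proof -
    have "\<theta> * L = 2 * (1 + 4 * \<delta>) * (x * L)" by (simp add: \<theta>_def)
    also have "\<dots> \<le> 4 * (x * L)" using \<delta> xL_pos by (intro mult_right_mono) auto
    finally show ?thesis using xL_small \<delta> by linarith
  qed
  have main: "x * D * (1 + \<delta>) \<le> \<theta> / 2 * (1 - \<delta>) * (q * m3_upto L)"
  proof -
    have "x * D * (1 + \<delta>) \<le> x * D * ((1 + 4 * \<delta>) * (1 - \<delta>)\<^sup>2)"
      using cube_ineq xD_pos by (intro mult_left_mono) auto
    also have "\<dots> = \<theta> / 2 * (1 - \<delta>) * ((1 - \<delta>) * D)"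
      by (simp add: \<theta>_def power2_eq_square algebra_simps)
    also have "\<dots> \<le> \<theta> / 2 * (1 - \<delta>) * (q * m3_upto L)"
      using \<theta>0 \<delta> by (intro mult_left_mono third_trunc) auto
    finally show ?thesis .
  qed
  have "big v K \<le> \<theta> * w v + w v / (1 - (1 - x * D)) / K"
  proof (rule big_le[OF v K_pos \<theta>0])
    have "q * (\<Sum>i\<in>V. exp (- (\<theta> * w i)) * w i ^ 2)
      \<le> q * m2 - \<theta> * (1 - \<delta>) * (q * m3_upto L)"
      using \<theta>0 \<theta>L L by (intro thinned_second_moment_le[where t = 0]) auto
    also have "\<dots> \<le> 1 - x * D"
    proof -
      have "x * D * 1 \<le> x * D * (1 + \<delta>)" using xD_pos \<delta> by (intro mult_left_mono) auto
      then show ?thesis using main second by (simp add: algebra_simps)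
    qed
    finally show "q * (\<Sum>i\<in>V. exp (- (\<theta> * w i)) * w i ^ 2) \<le> 1 - x * D" .
  next
    fix s assume s: "0 \<le> s" "s \<le> K"
    have qs: "q * s \<le> \<delta> * x" using mult_left_mono[OF s(2) q_nonneg] q_K by simp
    have "\<delta> * x \<le> \<theta>" unfolding \<theta>_def using x \<delta> by (simp add: algebra_simps add_increasing)
    then have "(\<Sum>i\<in>V. psi (\<theta> * w i) (q * s * w i))
      \<le> \<theta> * s * (q * m2 + q * s * (q * m3)
        - \<theta> / 2 * (1 - \<delta>) * (q * m3_upto L))"
      using \<theta>0 s qs \<theta>L L \<delta> by (intro sum_psi_le) auto
    also have "\<dots> \<le> \<theta> * s * 1"
    proof (rule mult_left_mono)
      have "q * s * D \<le> \<delta> * x * D" using qs D by (intro mult_right_mono) auto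
      then show "q * m2 + q * s * (q * m3)
        - \<theta> / 2 * (1 - \<delta>) * (q * m3_upto L) \<le> 1"
        using main second third by (simp add: algebra_simps)
    qed (use \<theta>0 s in auto)
    finally show "(\<Sum>i\<in>V. psi (\<theta> * w i) (q * s * w i)) \<le> \<theta> * s" by simp
  qed (use xD_pos in auto)
  also have "w v / (1 - (1 - x * D)) / K \<le> 2 * x * \<delta> * w v"
  proof -
    \<comment> \<open>Here \<open>1 / \<delta>^2 \<le> \<Gamma>\<close> enters: it makes the Markov
      term small against \<open>x * w v\<close>.\<close>
    have "1 / \<delta>\<^sup>2 \<le> x\<^sup>2 * (x * D) / q" using \<Gamma> by simp
    then have "q \<le> \<delta>\<^sup>2 * (x\<^sup>2 * (x * D))" using \<delta> q_pos by (simp add: field_simps)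
    moreover have "0 \<le> \<delta>\<^sup>2 * (x\<^sup>2 * (x * D))" using xD_pos by simp
    ultimately have "q \<le> 2 * (\<delta>\<^sup>2 * (x\<^sup>2 * (x * D)))" by linarith
    then have "1 / (x * D) / K \<le> 2 * x * \<delta>"
      using x D \<delta> q_pos by (simp add: K_def field_simps power2_eq_square)
    then have "w v * (1 / (x * D) / K) \<le> w v * (2 * x * \<delta>)"
      using w_pos[OF v] by (intro mult_left_mono) auto
    then show ?thesis by (simp add: mult_ac)
  qed
  finally show ?thesis by (simp add: \<theta>_def algebra_simps)
qed

section \<open>Exponentially unlikely families of heavy components\<close>

lemma expected_number_le: "(2 * x * (1 + 5 * \<delta>)) * m2 / K \<le> 4 / \<delta>"
proof -
  have "(2 * x * (1 + 5 * \<delta>)) * m2 / K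
     = 2 / \<delta> * ((1 + 5 * \<delta>) * (q * m2))"
    using x \<delta> q_pos by (simp add: K_def)
  also have "\<dots> = 2 / \<delta> * ((1 + 5 * \<delta>) * (1 + x * D))" by (simp only: second)
  also have "\<dots> \<le> 2 / \<delta> * ((11 / 10) * (51 / 50))"
    using \<delta> xD xD_pos by (intro mult_left_mono mult_mono) auto
  also have "\<dots> \<le> 4 / \<delta>" using \<delta> by (simp add: field_simps)
  finally show ?thesis .
qed

text \<open>The common frame for three tilts that differ only in \<open>d\<close>: whenever the
  exponent is at least \<open>\<delta> ^ 3 * \<Gamma> / 16\<close> on the family, the price is
  \<open>p\<close> times the bound \<open>4 / \<delta>\<close> on the mean number of heavy
  components.\<close>

lemma exists_family_le:
  assumes "\<And>i. i \<in> V \<Longrightarrow> 0 \<le> d i" and a: "a = (\<lambda>i. d i * exp (- q * t * w i))"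
    and P: "\<And>S. P S \<Longrightarrow> K < wt S \<and> wt S \<le> t"
    and g: "\<And>S. S \<subseteq> V \<Longrightarrow> P S \<Longrightarrow> g \<le> (\<Sum>i\<in>V. psi (a i) (q * wt S * w i)) - sum d S"
    and "\<delta> ^ 3 * \<Gamma> / 16 \<le> g"
  shows "G V (\<lambda>F. of_bool (\<exists>v\<in>V. P (reach {v} F))) \<le> p * (4 / \<delta>)"
proof -
  have a0: "0 \<le> a i" if "i \<in> V" for i using assms(1)[OF that] a by simp
  have "G V (\<lambda>F. of_bool (\<exists>v\<in>V. P (reach {v} F)))
    \<le> exp (- g) * ((2 * x * (1 + 5 * \<delta>)) * m2 / K)"
  proof (rule exists_tilted_component_le[OF K_pos big_K_le])
    fix v S assume S: "S \<subseteq> V" "v \<in> S" "P S"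
    show "law {v} S \<le> exp (- g) * tilt {v} (\<lambda>i. exp (- a i)) S"
    proof (rule law_le_tilt[where d = d and t = t])
      show "g \<le> (\<Sum>i\<in>V. psi (a i) (q * wt S * w i)) - sum d S + sum a {v}"
        using g[OF S(1,3)] a0 S by force
    qed (use S assms(1) P a in auto)
  qed (use a0 P in auto)
  also have "\<dots> \<le> exp (- g) * (4 / \<delta>)" by (intro mult_left_mono expected_number_le) auto
  also have "\<dots> \<le> p * (4 / \<delta>)" unfolding p_def using assms(5) \<delta> by (intro mult_right_mono) auto
  finally show ?thesis .
qed

text \<open>The deletion rates depend on the cap \<open>t\<close>, not on the unknown weight
  \<open>s\<close>, and the gain \<open>q * s / 2\<close> balances half of the loss
  \<open>q * t\<close> only if \<open>s\<close> is close to \<open>t\<close>. Hence a window of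
  ratio \<open>1 - \<delta>\<close>. A value \<open>\<theta>\<close> of order
  \<open>\<delta> * x\<close> keeps the own loss \<open>\<theta> / 2 * D\<close> small.\<close>

lemma window_le:
  assumes "t \<le> (1 - 4 * \<delta>) * T"
  shows "G V (\<lambda>F. of_bool (\<exists>v\<in>V. K < wt (reach {v} F) \<and> (1 - \<delta>) * t < wt (reach {v} F) \<and> wt (reach {v} F) \<le> t))
    \<le> p * (4 / \<delta>)"
proof -
  define \<theta> where "\<theta> = \<delta> * x"
  have \<theta>0: "0 \<le> \<theta>" using x \<delta> by (simp add: \<theta>_def)
  define a where "a = (\<lambda>i. \<theta> * w i * exp (- q * t * w i))"
  let ?P = "\<lambda>S. K < wt S \<and> (1 - \<delta>) * t < wt S \<and> wt S \<le> t"
  have qt: "q * t \<le> 2 * x * (1 - 4 * \<delta>)"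
  proof -
    have "q * t \<le> q * ((1 - 4 * \<delta>) * T)" by (rule mult_left_mono[OF assms q_nonneg])
    also have "\<dots> = (q * T) * (1 - 4 * \<delta>)" by (simp add: mult_ac)
    finally show ?thesis unfolding q_T .
  qed
  show ?thesis
  proof (rule exists_family_le[where P = ?P and d = "\<lambda>i. \<theta> * w i" and a = a and t = t and g = "\<delta> ^ 3 * \<Gamma> / 2"])
    fix S assume SV: "S \<subseteq> V" and S: "?P S"
    let ?s = "wt S" and ?W = "q * m3_upto L"
    have s0: "0 < ?s" using S K_pos by linarith
    have t0: "0 < t" using S s0 by linarith
    have qt0: "0 \<le> q * t" using t0 q_nonneg by simp
    have \<kappa>: "q * t * L + 9 * \<theta> * L \<le> \<delta>"
    proof -
      have "2 * x * (1 - 4 * \<delta>) \<le> 2 * x * 1" using x \<delta> by (intro mult_left_mono) auto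
      then have "q * t \<le> 2 * x * 1" using qt by linarith
      then have "q * t * L \<le> 2 * x * L" using L by (intro mult_right_mono) auto
      moreover have "9 * \<theta> * L \<le> 1 * (x * L)" unfolding \<theta>_def
        using \<delta> xL_pos mult_right_mono[of "9 * \<delta>" 1 "x * L"] by (simp add: mult_ac)
      ultimately show ?thesis using xL_small \<delta> by linarith
    qed
    have A: "\<theta> * ?s * (q * m2 - (q * t + \<theta> / 2) * (q * m3) + q * ?s / 2 * (1 - \<delta>) * ?W)
      \<le> (\<Sum>i\<in>V. psi (a i) (q * ?s * w i))"
      using \<theta>0 s0 S \<kappa> L \<delta> by (intro sum_psi_ge_second_order[OF _ a_def]) auto
    \<comment> \<open>Up to errors the bracket is \<open>1 + x * D - q * t * D / 2\<close>. The
      margin \<open>1 - 4 * \<delta>\<close> in \<open>t\<close> covers the error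
      \<open>3 * \<delta>\<close> and leaves \<open>\<delta> * (x * D)\<close>, half of which is
      spent on \<open>\<theta>\<close>.\<close>
    have B: "1 + \<delta> * (x * D) / 2 \<le> q * m2 - (q * t + \<theta> / 2) * (q * m3) + q * ?s / 2 * (1 - \<delta>) * ?W"
    proof -
      have "q * ((1 - \<delta>) * t) \<le> q * ?s" using S q_nonneg by (intro mult_left_mono) auto
      then have "q * ((1 - \<delta>) * t) / 2 * (1 - \<delta>) \<le> q * ?s / 2 * (1 - \<delta>)"
        using \<delta> by (intro mult_right_mono divide_right_mono) auto
      then have "q * ((1 - \<delta>) * t) / 2 * (1 - \<delta>) * ((1 - \<delta>) * D) \<le> q * ?s / 2 * (1 - \<delta>) * ?W"
        by (rule mult_mono[OF _ third_trunc]) (use q_nonneg s0 \<delta> D in auto)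
      moreover have "q * ((1 - \<delta>) * t) / 2 * (1 - \<delta>) * ((1 - \<delta>) * D) = q * t * D * ((1 - \<delta>) ^ 3 / 2)"
        by (simp add: power3_eq_cube algebra_simps)
      moreover have "q * t * D * ((1 - 3 * \<delta>) / 2) \<le> q * t * D * ((1 - \<delta>) ^ 3 / 2)"
      proof (rule mult_left_mono)
        have "(1 - \<delta>) ^ 3 = 1 - 3 * \<delta> + \<delta>\<^sup>2 * (3 - \<delta>)" by (simp add: power2_eq_square power3_eq_cube algebra_simps)
        moreover have "0 \<le> \<delta>\<^sup>2 * (3 - \<delta>)" using \<delta> by simp
        ultimately show "(1 - 3 * \<delta>) / 2 \<le> (1 - \<delta>) ^ 3 / 2" by simp
      qed (use qt0 D in auto)
      moreover have "q * t * D * ((1 + 3 * \<delta>) / 2) \<le> x * D * (1 - \<delta>)"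
      proof -
        have "q * t * (D * ((1 + 3 * \<delta>) / 2)) \<le> 2 * x * (1 - 4 * \<delta>) * (D * ((1 + 3 * \<delta>) / 2))"
          using qt D \<delta> by (intro mult_right_mono) auto
        also have "\<dots> = x * D * (1 - \<delta> - 12 * \<delta>\<^sup>2)" by (simp add: power2_eq_square field_simps)
        also have "\<dots> \<le> x * D * (1 - \<delta>)" using xD_pos by (intro mult_left_mono) auto
        finally show ?thesis by (simp add: mult.assoc)
      qed
      moreover have "q * t * D * ((1 + 3 * \<delta>) / 2) = q * t * D - q * t * D * ((1 - 3 * \<delta>) / 2)"
        by (simp add: field_simps)
      moreover have "(q * t + \<theta> / 2) * (q * m3) = q * t * D + \<delta> * (x * D) / 2"
        unfolding third by (simp add: \<theta>_def field_simps)
      moreover have "x * D * (1 - \<delta>) = x * D - \<delta> * (x * D)" by (simp add: algebra_simps)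
      ultimately show ?thesis using second by linarith
    qed
    have "\<theta> * ?s * (1 + \<delta> * (x * D) / 2) \<le> (\<Sum>i\<in>V. psi (a i) (q * ?s * w i))"
      by (rule order_trans[OF mult_left_mono[OF B] A]) (use \<theta>0 s0 in auto)
    moreover have "\<delta> ^ 3 * \<Gamma> / 2 \<le> \<theta> * ?s * (\<delta> * (x * D) / 2)"
    proof -
      have "\<delta> ^ 3 * \<Gamma> / 2 \<le> \<delta> ^ 3 * (x\<^sup>2 * (x * D) / q) / 2"
        using \<Gamma>(2) \<delta> by (intro divide_right_mono mult_left_mono) auto
      also have "\<dots> = \<theta> * K * (\<delta> * (x * D) / 2)"
        by (simp add: \<theta>_def K_def power2_eq_square power3_eq_cube)
      also have "\<dots> \<le> \<theta> * ?s * (\<delta> * (x * D) / 2)"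
        using S \<theta>0 xD_pos \<delta> by (intro mult_right_mono mult_left_mono) auto
      finally show ?thesis .
    qed
    moreover have "\<theta> * ?s * (1 + \<delta> * (x * D) / 2) = \<theta> * ?s + \<theta> * ?s * (\<delta> * (x * D) / 2)"
      by (simp only: distrib_left mult_1_right)
    moreover have "(\<Sum>i\<in>S. \<theta> * w i) = \<theta> * ?s" by (simp only: sum_distrib_left)
    ultimately show "\<delta> ^ 3 * \<Gamma> / 2 \<le> (\<Sum>i\<in>V. psi (a i) (q * ?s * w i)) - (\<Sum>i\<in>S. \<theta> * w i)"
      by linarith
  next
    show "\<delta> ^ 3 * \<Gamma> / 16 \<le> \<delta> ^ 3 * \<Gamma> / 2" using \<delta> \<Gamma>_pos by simp
  qed (use \<theta>0 w_pos in \<open>auto simp: a_def less_imp_le\<close>)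
qed

text \<open>Constant \<open>d\<close> means deletion at a nearly uniform rate. The exponent is then
  about \<open>\<phi> * (wt S * (q * wt V) - card S)\<close>, and \<open>q * wt V\<close> is at
  least 1. The cap \<open>T / \<delta>\<close> keeps \<open>q * t = 2 * x / \<delta>\<close> small,
  so that the rates hardly depend on the weight.\<close>

lemma few_vertices_le:
  "G V (\<lambda>F. of_bool (\<exists>v\<in>V. K < wt (reach {v} F) \<and> wt (reach {v} F) \<le> T / \<delta> \<and>
      real (card (reach {v} F)) < (1 - \<delta>) * wt (reach {v} F))) \<le> p * (4 / \<delta>)"
proof -
  define \<phi> where "\<phi> = \<delta> / 2"
  have \<phi>0: "0 < \<phi>" using \<delta> by (simp add: \<phi>_def)
  define t where "t = T / \<delta>"
  define a where "a = (\<lambda>i. \<phi> * exp (- q * t * w i))"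
  let ?P = "\<lambda>S. K < wt S \<and> wt S \<le> t \<and> real (card S) < (1 - \<delta>) * wt S"
  have qt: "q * t = 2 * x / \<delta>" using q_T by (simp add: t_def)
  have "G V (\<lambda>F. of_bool (\<exists>v\<in>V. ?P (reach {v} F))) \<le> p * (4 / \<delta>)"
  proof (rule exists_family_le[where P = ?P and d = "\<lambda>i. \<phi>" and a = a and t = t and g = "\<delta> ^ 3 * \<Gamma> / 8"])
    fix S assume SV: "S \<subseteq> V" and S: "?P S"
    let ?s = "wt S"
    have s0: "0 < ?s" using S K_pos by linarith
    have t0: "0 \<le> t" using S s0 by linarith
    have "q * ?s * ((\<Sum>i\<in>V. \<phi> * w i) - q * t * (\<Sum>i\<in>V. \<phi> * w i ^ 2) - (\<Sum>i\<in>V. \<phi> ^ 2 * w i) / 2)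
      \<le> (\<Sum>i\<in>V. psi (a i) (q * ?s * w i))"
      using \<phi>0 s0 t0 by (intro sum_psi_ge[OF _ a_def]) auto
    also have "q * ?s * ((\<Sum>i\<in>V. \<phi> * w i) - q * t * (\<Sum>i\<in>V. \<phi> * w i ^ 2) - (\<Sum>i\<in>V. \<phi> ^ 2 * w i) / 2)
      = \<phi> * ?s * (q * wt V - q * t * (q * m2) - \<phi> / 2 * (q * wt V))"
      by (simp add: sum_distrib_left[symmetric] power2_eq_square algebra_simps)
    finally have 1: "\<phi> * ?s * (q * wt V - q * t * (q * m2) - \<phi> / 2 * (q * wt V))
      \<le> (\<Sum>i\<in>V. psi (a i) (q * ?s * w i))" .
    have B: "1 - \<delta> + \<delta> / 4 \<le> q * wt V - q * t * (q * m2) - \<phi> / 2 * (q * wt V)"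
    proof -
      have "2 * x / \<delta> \<le> \<delta> / 50" using x_le \<delta> by (simp add: field_simps power2_eq_square)
      then have "q * t * (q * m2) \<le> \<delta> / 50 * 2"
        unfolding qt second using xD \<delta> x D by (intro mult_mono) auto
      moreover have "\<phi> / 2 * (q * wt V) \<le> \<delta> / 4 * (51 / 50)"
        using first \<delta> by (intro mult_mono) (auto simp: \<phi>_def)
      ultimately show ?thesis using first \<delta> by linarith
    qed
    have "\<phi> * ?s * (1 - \<delta> + \<delta> / 4) \<le> (\<Sum>i\<in>V. psi (a i) (q * ?s * w i))"
      by (rule order_trans[OF mult_left_mono[OF B] 1]) (use \<phi>0 s0 in auto)
    moreover have "\<phi> * real (card S) \<le> \<phi> * ?s * (1 - \<delta>)"
      using S \<phi>0 by (simp add: mult_ac)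
    moreover have "\<delta> ^ 3 * \<Gamma> / 8 \<le> \<phi> * ?s * (\<delta> / 4)"
    proof -
      have "x * (x * D) \<le> 1 * 1" using x_le \<delta>_sq \<delta> xD x D by (intro mult_mono) auto
      then have "x\<^sup>2 * (x * D) \<le> x" using x mult_left_mono[of "x * (x * D)" 1 x] by (simp add: power2_eq_square mult_ac)
      then have "\<Gamma> \<le> x / q" using \<Gamma>(2) q_pos by (meson divide_right_mono less_imp_le order_trans)
      then have "\<delta> ^ 3 * \<Gamma> / 8 \<le> \<delta> ^ 3 * (x / q) / 8"
        using \<delta> by (intro divide_right_mono mult_left_mono) auto
      also have "\<dots> = \<phi> * K * (\<delta> / 4)"
        using q_pos by (simp add: \<phi>_def K_def power3_eq_cube field_simps)
      also have "\<dots> \<le> \<phi> * ?s * (\<delta> / 4)"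
        using S \<phi>0 \<delta> by (intro mult_right_mono mult_left_mono) auto
      finally show ?thesis .
    qed
    moreover have "\<phi> * ?s * (1 - \<delta> + \<delta> / 4) = \<phi> * ?s * (1 - \<delta>) + \<phi> * ?s * (\<delta> / 4)"
      by (simp only: distrib_left)
    moreover have "(\<Sum>i\<in>S. \<phi>) = \<phi> * real (card S)" by simp
    ultimately show "\<delta> ^ 3 * \<Gamma> / 8 \<le> (\<Sum>i\<in>V. psi (a i) (q * ?s * w i)) - (\<Sum>i\<in>S. \<phi>)"
      by linarith
  next
    show "\<delta> ^ 3 * \<Gamma> / 16 \<le> \<delta> ^ 3 * \<Gamma> / 8" using \<delta> \<Gamma>_pos by simp
  qed (use \<phi>0 in \<open>auto simp: a_def\<close>)
  then show ?thesis by (simp add: t_def)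
qed

text \<open>With \<open>d\<close> proportional to the squared weight the exponent compares the
  second moment of \<open>S\<close> with \<open>wt S * D\<close>. This is needed because removing
  \<open>S\<close> must lower \<open>q * m2\<close> below 1, which the weight of \<open>S\<close>
  alone does not ensure.\<close>

lemma small_second_moment_le:
  "G V (\<lambda>F. of_bool (\<exists>v\<in>V. K < wt (reach {v} F) \<and> wt (reach {v} F) \<le> T / \<delta> \<and>
      (\<Sum>i\<in>{i \<in> reach {v} F. w i \<le> L}. w i ^ 2) < (1 - 3 * \<delta>) * D * wt (reach {v} F))) \<le> p * (4 / \<delta>)"
proof -
  \<comment> \<open>The normalisation by \<open>L^2\<close> keeps \<open>d\<close> at most
    \<open>\<delta>\<close>, so the quadratic loss is a fraction \<open>\<delta>\<close> of the
    linear term.\<close>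
  define \<phi> where "\<phi> = \<delta> / L\<^sup>2"
  have L0: "0 < L" using L by simp
  have \<phi>0: "0 < \<phi>" using \<delta> L0 by (simp add: \<phi>_def)
  define t where "t = T / \<delta>"
  define d where "d = (\<lambda>i. if w i \<le> L then \<phi> * w i ^ 2 else 0)"
  define a where "a = (\<lambda>i. d i * exp (- q * t * w i))"
  let ?P = "\<lambda>S. K < wt S \<and> wt S \<le> t \<and> (\<Sum>i\<in>{i \<in> S. w i \<le> L}. w i ^ 2) < (1 - 3 * \<delta>) * D * wt S"
  have qt: "q * t = 2 * x / \<delta>" using q_T by (simp add: t_def)
  have d0: "0 \<le> d i" for i using \<phi>0 by (simp add: d_def)
  have "G V (\<lambda>F. of_bool (\<exists>v\<in>V. ?P (reach {v} F))) \<le> p * (4 / \<delta>)"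
  proof (rule exists_family_le[where P = ?P and d = d and a = a and t = t and g = "\<delta> ^ 3 * \<Gamma>"])
    fix S assume SV: "S \<subseteq> V" and S: "?P S"
    let ?s = "wt S" and ?W = "\<Sum>i\<in>{i\<in>V. w i \<le> L}. w i ^ 3" and ?W3 = "\<Sum>i\<in>V. w i ^ 3"
    have fS: "finite S" using SV fin_sub by auto
    have s0: "0 < ?s" using S K_pos by linarith
    have t0: "0 \<le> t" using S s0 by linarith
    have 1: "q * ?s * ((\<Sum>i\<in>V. d i * w i) - q * t * (\<Sum>i\<in>V. d i * w i ^ 2) - (\<Sum>i\<in>V. d i ^ 2 * w i) / 2)
      \<le> (\<Sum>i\<in>V. psi (a i) (q * ?s * w i))"
      using d0 s0 t0 by (intro sum_psi_ge[OF _ a_def]) auto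
    have dw: "(\<Sum>i\<in>V. d i * w i) = \<phi> * ?W"
      unfolding sum_distrib_left sum.inter_filter[OF fin]
      by (intro sum.cong) (auto simp: d_def power2_eq_square power3_eq_cube)
    have dw2: "(\<Sum>i\<in>V. d i * w i ^ 2) \<le> \<phi> * L * ?W3"
      unfolding sum_distrib_left
    proof (rule sum_mono)
      fix i assume i: "i \<in> V"
      have "\<phi> * (w i ^ 3 * w i) \<le> \<phi> * (w i ^ 3 * L)" if "w i \<le> L"
        using that \<phi>0 w_pos[OF i] by (intro mult_left_mono) auto
      then show "d i * w i ^ 2 \<le> \<phi> * L * w i ^ 3"
        using w_pos[OF i] \<phi>0 L0 by (auto simp: d_def power2_eq_square power3_eq_cube mult_ac)
    qed
    have d2w: "(\<Sum>i\<in>V. d i ^ 2 * w i) \<le> \<phi> * \<delta> * ?W3"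
      unfolding sum_distrib_left
    proof (rule sum_mono)
      fix i assume i: "i \<in> V"
      have w0: "0 < w i" by (rule w_pos[OF i])
      show "d i ^ 2 * w i \<le> \<phi> * \<delta> * w i ^ 3"
      proof (cases "w i \<le> L")
        case True
        have "w i ^ 2 \<le> L ^ 2" using True w0 by (intro power_mono) auto
        then have "\<phi> * w i ^ 2 \<le> \<delta>" using \<delta> L0 by (simp add: \<phi>_def field_simps)
        then have "\<phi> * w i ^ 3 * (\<phi> * w i ^ 2) \<le> \<phi> * w i ^ 3 * \<delta>"
          using \<phi>0 w0 by (intro mult_left_mono) auto
        then show ?thesis using True by (simp add: d_def power2_eq_square power3_eq_cube mult_ac)
      qed (use w0 \<phi>0 \<delta> in \<open>simp add: d_def\<close>)
    qed
    have "\<phi> * (D * (1 - 3 * \<delta>) + D * \<delta>)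
      \<le> q * ((\<Sum>i\<in>V. d i * w i) - q * t * (\<Sum>i\<in>V. d i * w i ^ 2) - (\<Sum>i\<in>V. d i ^ 2 * w i) / 2)"
    proof -
      have "q * t * (\<Sum>i\<in>V. d i * w i ^ 2) \<le> q * t * (\<phi> * L * ?W3)"
        using q_nonneg t0 dw2 by (intro mult_left_mono) auto
      then have "q * (\<phi> * ?W - q * t * (\<phi> * L * ?W3) - \<phi> * \<delta> * ?W3 / 2)
        \<le> q * ((\<Sum>i\<in>V. d i * w i) - q * t * (\<Sum>i\<in>V. d i * w i ^ 2) - (\<Sum>i\<in>V. d i ^ 2 * w i) / 2)"
        using q_nonneg dw d2w by (intro mult_left_mono) auto
      moreover have "q * (\<phi> * ?W - q * t * (\<phi> * L * ?W3) - \<phi> * \<delta> * ?W3 / 2)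
        = \<phi> * (q * ?W - q * t * L * (q * ?W3) - \<delta> * (q * ?W3) / 2)" by (simp add: algebra_simps)
      moreover have "\<phi> * (D * (1 - 3 * \<delta>) + D * \<delta>) \<le> \<phi> * (q * ?W - q * t * L * (q * ?W3) - \<delta> * (q * ?W3) / 2)"
      proof (rule mult_left_mono)
        have "q * t * L = 2 * (x * L) / \<delta>" by (simp add: qt)
        also have "\<dots> \<le> 2 * (\<delta>\<^sup>2 / 100) / \<delta>" using xL \<delta> by (intro divide_right_mono mult_left_mono) auto
        also have "\<dots> \<le> \<delta> / 2" using \<delta> by (simp add: power2_eq_square)
        finally have "q * t * L * D \<le> \<delta> / 2 * D" using D by (intro mult_right_mono) auto
        then show "D * (1 - 3 * \<delta>) + D * \<delta> \<le> q * ?W - q * t * L * (q * ?W3) - \<delta> * (q * ?W3) / 2"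
          unfolding third using third_trunc by (simp add: algebra_simps)
      qed (use \<phi>0 in auto)
      ultimately show ?thesis by linarith
    qed
    then have "?s * (\<phi> * (D * (1 - 3 * \<delta>) + D * \<delta>)) \<le> ?s * (q * ((\<Sum>i\<in>V. d i * w i) - q * t * (\<Sum>i\<in>V. d i * w i ^ 2) - (\<Sum>i\<in>V. d i ^ 2 * w i) / 2))"
      using s0 by (intro mult_left_mono) auto
    then have 2: "?s * (\<phi> * (D * (1 - 3 * \<delta>) + D * \<delta>)) \<le> (\<Sum>i\<in>V. psi (a i) (q * ?s * w i))"
      using 1 by (simp add: mult_ac)
    have "sum d S = \<phi> * (\<Sum>i\<in>{i \<in> S. w i \<le> L}. w i ^ 2)"
      unfolding sum_distrib_left sum.inter_filter[OF fS] by (intro sum.cong) (auto simp: d_def)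
    also have "\<dots> \<le> \<phi> * ((1 - 3 * \<delta>) * D * ?s)" using S \<phi>0 by (intro mult_left_mono) auto
    finally have 3: "sum d S \<le> \<phi> * ((1 - 3 * \<delta>) * D * ?s)" .
    have "\<delta> ^ 3 * \<Gamma> \<le> \<phi> * ?s * (D * \<delta>)"
    proof -
      have "x * L \<le> 1" using xL_small \<delta> by simp
      then have "(x * L)\<^sup>2 \<le> 1\<^sup>2" using xL_pos by (intro power_mono) auto
      then have "x\<^sup>2 \<le> 1 / L\<^sup>2" using L0 by (simp add: power_mult_distrib field_simps)
      then have "x\<^sup>2 * (x * D) / q \<le> 1 / L\<^sup>2 * (x * D) / q"
        using xD_pos q_pos by (intro divide_right_mono mult_right_mono) auto
      then have "\<delta> ^ 3 * \<Gamma> \<le> \<delta> ^ 3 * (1 / L\<^sup>2 * (x * D) / q)"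
        using \<delta> \<Gamma>(2) by (intro mult_left_mono) auto
      also have "\<dots> = \<phi> * K * (D * \<delta>)"
        using q_pos L0 by (simp add: \<phi>_def K_def power3_eq_cube field_simps)
      also have "\<dots> \<le> \<phi> * ?s * (D * \<delta>)" using S \<phi>0 \<delta> D by (intro mult_right_mono mult_left_mono) auto
      finally show ?thesis .
    qed
    moreover have "?s * (\<phi> * (D * (1 - 3 * \<delta>) + D * \<delta>)) = \<phi> * ((1 - 3 * \<delta>) * D * ?s) + \<phi> * ?s * (D * \<delta>)"
      by (simp add: algebra_simps)
    ultimately show "\<delta> ^ 3 * \<Gamma> \<le> (\<Sum>i\<in>V. psi (a i) (q * ?s * w i)) - sum d S"
      using 2 3 by linarith
  next
    show "\<delta> ^ 3 * \<Gamma> / 16 \<le> \<delta> ^ 3 * \<Gamma>" using \<delta> \<Gamma>_pos by simp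
  qed (use d0 in \<open>auto simp: a_def\<close>)
  then show ?thesis by (simp add: t_def)
qed

text \<open>The set \<open>B\<close> has to be heavy enough for \<open>sum a B\<close> to be of the
  order of the scale bounded by \<open>\<Gamma>\<close>, and light enough that its subcritical
  components rarely add up to \<open>K\<close>.\<close>

lemma none_big_le: "G V (\<lambda>F. of_bool (\<forall>v\<in>V. wt (reach {v} F) \<le> K)) \<le> p + \<delta>"
proof -
  \<comment> \<open>Strictly between \<open>x\<close>, above which the thinned graph is subcritical,
    and \<open>2 * x\<close>, below which the exponent still dominates
    \<open>\<theta> * s\<close>.\<close>
  define \<theta> where "\<theta> = 3 / 2 * x"
  have \<theta>0: "0 \<le> \<theta>" using x by (simp add: \<theta>_def)
  define a where "a = (\<lambda>i. \<theta> * w i * exp (- q * K * w i))"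
  let ?X = "{i\<in>V. w i \<le> L}"
  \<comment> \<open>Chosen so that \<open>2 * h = \<delta> * K * (x * D / 4)\<close>, which makes
    the Markov term at most \<open>\<delta>\<close>, while \<open>\<theta> / 2 * h\<close> is
    \<open>3 / 32 * \<delta>^2\<close> times the scale bounded by \<open>\<Gamma>\<close>.\<close>
  define h where "h = \<delta>\<^sup>2 * x * (x * D) / (8 * q)"
  have L0: "0 < L" using L by simp
  have h0: "0 \<le> h" using xD_pos x q_pos by (simp add: h_def)
  have hL: "L \<le> h" using Lq q_pos by (simp add: h_def field_simps)
  have hX: "h \<le> wt ?X"
  proof -
    have "x * L \<le> 1" using xL_small \<delta> by simp
    then have "(x * L)\<^sup>2 \<le> 1\<^sup>2" using xL_pos by (intro power_mono) auto
    then have xL2: "x\<^sup>2 * L\<^sup>2 \<le> 1" by (simp add: power_mult_distrib)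
    have "\<delta>\<^sup>2 / 8 * (x\<^sup>2 * L\<^sup>2) \<le> 1 / 2 * 1"
      using xL2 \<delta>_sq \<delta> by (intro mult_mono) auto
    then have "\<delta>\<^sup>2 / 8 * (x\<^sup>2 * L\<^sup>2) \<le> 1 - \<delta>" using \<delta>(2) by linarith
    then have "\<delta>\<^sup>2 / 8 * (x\<^sup>2 * L\<^sup>2) * D \<le> (1 - \<delta>) * D"
      using D by (intro mult_right_mono) auto
    also have "\<dots> \<le> q * (\<Sum>i\<in>?X. w i ^ 3)" by (rule third_trunc)
    also have "\<dots> \<le> q * (\<Sum>i\<in>?X. w i * L\<^sup>2)"
    proof (intro mult_left_mono sum_mono q_nonneg)
      fix i assume i: "i \<in> ?X"
      then have "w i * w i ^ 2 \<le> w i * L ^ 2" using w_pos[of i] by (intro mult_left_mono power_mono) auto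
      then show "w i ^ 3 \<le> w i * L\<^sup>2" by (simp add: power2_eq_square power3_eq_cube)
    qed
    also have "\<dots> = q * wt ?X * L\<^sup>2" by (simp add: sum_distrib_right)
    finally have "\<delta>\<^sup>2 / 8 * x\<^sup>2 * D \<le> q * wt ?X" using L0 by (simp add: field_simps)
    then show ?thesis using q_pos by (simp add: h_def field_simps power2_eq_square)
  qed
  obtain B where B: "B \<subseteq> ?X" "h \<le> wt B" "wt B \<le> h + L"
  proof -
    have "finite ?X" "0 \<le> L" using fin L0 by auto
    moreover have "0 \<le> w i \<and> w i \<le> L" if "i \<in> ?X" for i using w_pos[of i] that by auto
    ultimately show ?thesis using exists_subset_sum[of ?X w L h, OF _ _ hX h0] that by blast
  qed
  have qKL: "q * K * L + \<theta> * L \<le> \<delta>"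
  proof -
    have "q * K * L \<le> 1 * (x * L)" unfolding q_K using \<delta> xL_pos mult_right_mono[of \<delta> 1 "x * L"] by (simp add: mult_ac)
    then show ?thesis using xL_small \<delta> by (simp add: \<theta>_def)
  qed
  have "G V (\<lambda>F. of_bool (\<forall>v\<in>V. wt (reach {v} F) \<le> K)) \<le> exp (- sum a B) + wt B / (1 - (1 - x * D / 4)) / K"
  proof (rule no_big_component_le[OF _ K_pos \<theta>0 a_def])
    show "B \<subseteq> V" using B by auto
    have "q * (\<Sum>i\<in>V. exp (- a i) * w i ^ 2)
      \<le> q * m2 - \<theta> * (1 - \<delta>) * (q * (\<Sum>i\<in>?X. w i ^ 3))"
      using \<theta>0 K_pos L0 qKL by (intro thinned_second_moment_le[OF _ _ a_def]) auto
    also have "\<dots> \<le> 1 - x * D / 4"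
    proof -
      have "\<theta> * (1 - \<delta>) * ((1 - \<delta>) * D) \<le> \<theta> * (1 - \<delta>) * (q * (\<Sum>i\<in>?X. w i ^ 3))"
        using third_trunc \<theta>0 \<delta> by (intro mult_left_mono) auto
      moreover have "\<theta> * (1 - \<delta>) * ((1 - \<delta>) * D) = 3 / 2 * (1 - \<delta>)\<^sup>2 * (x * D)"
        by (simp add: \<theta>_def power2_eq_square)
      moreover have "5 / 4 * (x * D) \<le> 3 / 2 * (1 - \<delta>)\<^sup>2 * (x * D)"
      proof (rule mult_right_mono)
        have "(49 / 50)\<^sup>2 \<le> (1 - \<delta>)\<^sup>2" using \<delta> by (intro power_mono) auto
        then show "5 / 4 \<le> 3 / 2 * (1 - \<delta>)\<^sup>2" by (simp add: power2_eq_square)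
      qed (use xD_pos in auto)
      ultimately show ?thesis using second by linarith
    qed
    finally show "q * (\<Sum>i\<in>V. exp (- a i) * w i ^ 2) \<le> 1 - x * D / 4" .
    show "1 - x * D / 4 < 1" using xD_pos by simp
    fix s assume s: "0 \<le> s" "s \<le> K"
    have "q * s * ((\<Sum>i\<in>V. \<theta> * w i * w i) - q * K * (\<Sum>i\<in>V. \<theta> * w i * w i ^ 2) - (\<Sum>i\<in>V. (\<theta> * w i) ^ 2 * w i) / 2)
      \<le> (\<Sum>i\<in>V. psi (a i) (q * s * w i))"
      using \<theta>0 w_pos s K_pos by (intro sum_psi_ge[OF _ a_def]) (auto simp: less_imp_le)
    also have "q * s * ((\<Sum>i\<in>V. \<theta> * w i * w i) - q * K * (\<Sum>i\<in>V. \<theta> * w i * w i ^ 2) - (\<Sum>i\<in>V. (\<theta> * w i) ^ 2 * w i) / 2)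
      = \<theta> * s * (q * m2 - (q * K + \<theta> / 2) * (q * m3))"
    proof -
      have "(\<Sum>i\<in>V. \<theta> * w i * w i) = \<theta> * m2"
        unfolding sum_distrib_left by (intro sum.cong) (auto simp: power2_eq_square)
      moreover have "(\<Sum>i\<in>V. \<theta> * w i * w i ^ 2) = \<theta> * m3"
        unfolding sum_distrib_left by (intro sum.cong) (auto simp: power2_eq_square power3_eq_cube)
      moreover have "(\<Sum>i\<in>V. (\<theta> * w i) ^ 2 * w i) = \<theta> * \<theta> * m3"
        unfolding sum_distrib_left by (intro sum.cong) (auto simp: power2_eq_square power3_eq_cube)
      ultimately have "q * s * ((\<Sum>i\<in>V. \<theta> * w i * w i) - q * K * (\<Sum>i\<in>V. \<theta> * w i * w i ^ 2) - (\<Sum>i\<in>V. (\<theta> * w i) ^ 2 * w i) / 2)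
        = q * s * (\<theta> * m2 - q * K * (\<theta> * m3) - \<theta> * \<theta> * m3 / 2)"
        by (simp only:)
      also have "\<dots> = \<theta> * s * (q * m2 - (q * K + \<theta> / 2) * (q * m3))"
        by (simp add: algebra_simps)
      finally show ?thesis .
    qed
    also have "q * m2 - (q * K + \<theta> / 2) * (q * m3) = 1 + (1 / 4 - \<delta>) * (x * D)"
      unfolding second third q_K by (simp add: \<theta>_def field_simps)
    finally have "\<theta> * s * (1 + (1 / 4 - \<delta>) * (x * D)) \<le> (\<Sum>i\<in>V. psi (a i) (q * s * w i))" .
    moreover have "\<theta> * s * 1 \<le> \<theta> * s * (1 + (1 / 4 - \<delta>) * (x * D))"
      using \<theta>0 s \<delta> xD_pos by (intro mult_left_mono) auto
    ultimately show "\<theta> * s \<le> (\<Sum>i\<in>V. psi (a i) (q * s * w i))" by linarith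
  qed
  moreover have "exp (- sum a B) \<le> p"
  proof -
    have "(\<Sum>i\<in>B. \<theta> * w i * (1 / 2)) \<le> sum a B"
    proof (rule sum_mono)
      fix i assume "i \<in> B"
      then have "i \<in> ?X" using B(1) by blast
      then have i: "0 \<le> w i" "w i \<le> L" using w_pos[of i] by auto
      have "q * K * w i \<le> q * K * L" using i q_nonneg K_pos by (intro mult_left_mono) auto
      moreover have "0 \<le> \<theta> * L" using \<theta>0 L0 by simp
      ultimately have "1 / 2 \<le> 1 - q * K * w i" using qKL \<delta> by linarith
      also have "\<dots> \<le> exp (- q * K * w i)" using exp_ge_add_one_self[of "- q * K * w i"] by simp
      finally show "\<theta> * w i * (1 / 2) \<le> a i" unfolding a_def using \<theta>0 i by (intro mult_left_mono) auto
    qed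
    also have "(\<Sum>i\<in>B. \<theta> * w i * (1 / 2)) = \<theta> / 2 * wt B" by (simp add: sum_distrib_left)
    finally have "\<theta> / 2 * h \<le> sum a B" using mult_left_mono[OF B(2), of "\<theta> / 2"] \<theta>0 by linarith
    moreover define Z where "Z = \<delta>\<^sup>2 * (x\<^sup>2 * (x * D) / q)"
    moreover have "\<theta> / 2 * h = 3 / 32 * Z"
      by (simp add: \<theta>_def h_def Z_def power2_eq_square)
    moreover have "\<delta> ^ 3 * \<Gamma> / 16 \<le> 3 / 32 * Z"
    proof -
      have "\<delta> ^ 3 * \<Gamma> \<le> \<delta>\<^sup>2 * \<Gamma>" using \<delta> \<Gamma>_pos by (intro mult_right_mono power_decreasing) auto
      also have "\<dots> \<le> \<delta>\<^sup>2 * (x\<^sup>2 * (x * D) / q)" using \<Gamma>(2) by (intro mult_left_mono) auto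
      finally have "\<delta> ^ 3 * \<Gamma> \<le> Z" unfolding Z_def .
      moreover have "0 \<le> \<delta> ^ 3 * \<Gamma>" using \<delta> \<Gamma>_pos by simp
      ultimately show ?thesis by linarith
    qed
    ultimately have "\<delta> ^ 3 * \<Gamma> / 16 \<le> sum a B" by linarith
    then show ?thesis by (simp add: p_def)
  qed
  moreover have "wt B / (1 - (1 - x * D / 4)) / K \<le> \<delta>"
  proof -
    have "wt B \<le> 2 * h" using B(3) hL by linarith
    also have "\<dots> = \<delta> * K * (x * D / 4)" using q_pos by (simp add: h_def K_def power2_eq_square field_simps)
    finally have "wt B \<le> \<delta> * (x * D / 4 * K)" by (simp add: mult_ac)
    then have "wt B / (x * D / 4 * K) \<le> \<delta>" using K_pos xD_pos by (subst pos_divide_le_eq) auto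
    then show ?thesis by (simp add: divide_divide_eq_left)
  qed
  ultimately show ?thesis by linarith
qed

end

section \<open>From the separate estimates to one giant component and a subcritical rest\<close>

lemma geometric_cover:
  fixes r A s :: real
  assumes "0 < r" "r < 1" "0 < A" "r ^ m * A < s" "s \<le> A"
  shows "\<exists>j<m. r * (r ^ j * A) < s \<and> s \<le> r ^ j * A"
  using assms(4)
proof (induction m)
  case (Suc m)
  show ?case
  proof (cases "r ^ m * A < s")
    case True
    then show ?thesis using Suc.IH less_SucI by blast
  next
    case False
    then show ?thesis using Suc.prems by (intro exI[of _ m]) (simp add: mult_ac)
  qed
qed (use assms(5) in simp)

lemma one_le_sum_of_bool:
  assumes "A1 \<or> A2 \<or> A3 \<or> A4 \<or> A5 \<or> A6"
  shows "(1::real) \<le> of_bool A1 + (of_bool A2 + (of_bool A3 + (of_bool A4 + (of_bool A5 + of_bool A6))))"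
  using assms by (auto simp: of_bool_def)

text \<open>Each vertex outside contributes the size of its own component, so the last sum is the
  sum of the squared sizes of all other components.\<close>

definition giant :: "'a set \<Rightarrow> real \<Rightarrow> real \<Rightarrow> real \<Rightarrow> 'a set set \<Rightarrow> bool" where
  "giant V lo up y F \<longleftrightarrow> (\<exists>v\<in>V. lo \<le> real (card (reach {v} F)) \<and> real (card (reach {v} F)) \<le> up \<and>
     (\<Sum>i\<in>V - reach {v} F. real (card (reach {i} F))) \<le> y)"

lemma giant_mono: "giant V lo up y F \<Longrightarrow> lo' \<le> lo \<Longrightarrow> up \<le> up' \<Longrightarrow> giant V lo' up' y F"
  unfolding giant_def by (meson order_trans)

context rank_one
begin

text \<open>No edge leaves a component, so the components of the graph on the rest, to which the
  Markov property applies, are components of the whole graph.\<close>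

lemma reach_rest:
  assumes "F \<subseteq> eds V" "v \<in> V" "i \<in> V - reach {v} F"
  shows "reach {i} (F \<inter> eds (V - reach {v} F)) = reach {i} F"
proof
  let ?S = "reach {v} F"
  have sub: "reach {i} (F \<inter> eds (V - ?S)) \<subseteq> V - ?S"
    by (rule reach_subset) (use assms(3) in auto)
  show "reach {i} F \<subseteq> reach {i} (F \<inter> eds (V - ?S))"
  proof (rule reach_closed)
    fix a b assume ab: "{a, b} \<in> F" and a: "a \<in> reach {i} (F \<inter> eds (V - ?S))"
    have aS: "a \<notin> ?S" using a sub by auto
    have "b \<notin> ?S"
      using aS reach_step[of b "{v}" F a] ab by (auto simp: insert_commute)
    then have "{a, b} \<in> eds (V - ?S)"
      using ab assms(1) aS subsetD[OF assms(1) ab] by (auto simp: pair_in_eds)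
    then show "b \<in> reach {i} (F \<inter> eds (V - ?S))" using ab by (intro reach_step[OF a]) auto
  qed (rule reach_self)
qed (rule reach_mono; auto)

lemma reach_in_Pow: "F \<subseteq> eds V \<Longrightarrow> v \<in> V \<Longrightarrow> reach {v} F \<subseteq> V"
  by (rule reach_subset) auto

end

context near_critical
begin

text \<open>A first moment suffices here: the mean number \<open>4 / \<delta>\<close> above
  \<open>K\<close> scales down by \<open>K * \<delta> / T = \<delta>^2 / 2\<close>. This supplies
  the cap \<open>T / \<delta>\<close> that the two tilts for vertices and second moments
  require.\<close>

lemma heavy_le: "G V (\<lambda>F. of_bool (\<exists>v\<in>V. T / \<delta> < wt (reach {v} F))) \<le> 2 * \<delta>"
proof -
  have TK: "K \<le> T / \<delta>"
  proof -
    have "\<delta> * \<delta> \<le> 1 * 2" using \<delta> by (intro mult_mono) auto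
    then have "\<delta> * \<delta> * (x / q) \<le> 2 * (x / q)" using x q_pos by (intro mult_right_mono) auto
    moreover have "K * \<delta> = \<delta> * \<delta> * (x / q)" "T = 2 * (x / q)" by (simp_all add: K_def T_def)
    ultimately have "K * \<delta> \<le> T" by linarith
    then show ?thesis using \<delta> by (simp add: pos_le_divide_eq)
  qed
  have Td: "0 < T / \<delta>" using T_pos \<delta> by simp
  have "G V (\<lambda>F. of_bool (\<exists>v\<in>V. T / \<delta> < wt (reach {v} F)))
    \<le> (\<Sum>v\<in>V. w v / (T / \<delta>) * G V (\<lambda>F. of_bool (T / \<delta> < wt (reach {v} F))))"
    by (rule exists_component_le[OF Td]) auto
  also have "\<dots> \<le> (\<Sum>v\<in>V. w v / (T / \<delta>) * ((2 * x * (1 + 5 * \<delta>)) * w v))"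
  proof (intro sum_mono mult_left_mono)
    fix v assume v: "v \<in> V"
    have "G V (\<lambda>F. of_bool (T / \<delta> < wt (reach {v} F))) \<le> big v K"
      unfolding big_def using TK by (intro G_mono) auto
    also note big_K_le[OF v]
    finally show "G V (\<lambda>F. of_bool (T / \<delta> < wt (reach {v} F))) \<le> (2 * x * (1 + 5 * \<delta>)) * w v" .
    show "0 \<le> w v / (T / \<delta>)" using w_pos[OF v] Td by (intro divide_nonneg_nonneg less_imp_le)
  qed
  also have "\<dots> = ((2 * x * (1 + 5 * \<delta>)) * m2 / K) * (K * \<delta> / T)"
  proof -
    have "(\<Sum>v\<in>V. w v / (T / \<delta>) * ((2 * x * (1 + 5 * \<delta>)) * w v))
      = (\<Sum>v\<in>V. ((2 * x * (1 + 5 * \<delta>)) * \<delta> / T) * w v ^ 2)"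
      by (intro sum.cong) (auto simp: power2_eq_square)
    also have "\<dots> = ((2 * x * (1 + 5 * \<delta>)) * \<delta> / T) * m2"
      by (simp only: sum_distrib_left)
    finally show ?thesis using K_pos by simp
  qed
  also have "\<dots> \<le> 4 / \<delta> * (K * \<delta> / T)"
    using K_pos T_pos \<delta> by (intro mult_right_mono expected_number_le) auto
  also have "\<dots> = 2 * \<delta>" using \<delta> x q_pos by (simp add: K_def T_def)
  finally show ?thesis .
qed

text \<open>The mean number of heavy components times Markov's bound for the susceptibility of a
  rest that is subcritical by \<open>x * D / 2\<close>.\<close>

definition rest_bound :: "real \<Rightarrow> real" where
  "rest_bound y = 4 / \<delta> * ((real (card V) + q * (wt V)\<^sup>2 / (x * D / 2)) / y)"

lemma rest_le:
  assumes "0 < y"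
  shows "G V (\<lambda>F. of_bool (\<exists>v\<in>V. K < wt (reach {v} F) \<and> q * (\<Sum>i\<in>V - reach {v} F. w i ^ 2) \<le> 1 - x * D / 2 \<and>
       y < (\<Sum>i\<in>V - reach {v} F. real (card (reach {i} (F \<inter> eds (V - reach {v} F))))))) \<le> rest_bound y"
proof -
  have "G V (\<lambda>F. of_bool (\<exists>v\<in>V. K < wt (reach {v} F) \<and> q * (\<Sum>i\<in>V - reach {v} F. w i ^ 2) \<le> 1 - x * D / 2 \<and>
       y < (\<Sum>i\<in>V - reach {v} F. real (card (reach {i} (F \<inter> eds (V - reach {v} F)))))))
    \<le> ((2 * x * (1 + 5 * \<delta>)) * m2 / K)
       * ((real (card V) + q * (wt V)\<^sup>2 / (1 - (1 - x * D / 2))) / y)"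
    using K_pos big_K_le xD_pos assms by (intro exists_bad_rest_le) auto
  also have "\<dots> \<le> rest_bound y"
    unfolding rest_bound_def using expected_number_le q_nonneg xD_pos assms \<delta>
    by (intro mult_mono) auto
  finally show ?thesis .
qed

definition good :: "real \<Rightarrow> 'a set set \<Rightarrow> bool" where
  "good y F \<longleftrightarrow> (\<exists>v\<in>V. K < wt (reach {v} F) \<and> (1 - 5 * \<delta>) * T \<le> real (card (reach {v} F)) \<and>
     (\<Sum>i\<in>V - reach {v} F. real (card (reach {i} F))) \<le> y)"

text \<open>Once the intermediate weights are excluded, any component above \<open>K\<close> must
  exceed \<open>(1 - 4 * \<delta>) * T\<close>. The number \<open>m + 3\<close> accounts for
  \<open>m\<close> windows, the two composition estimates and the probability that no component is
  heavy.\<close>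

lemma not_good_le:
  assumes "0 < y" "(1 - \<delta>) ^ m \<le> \<delta> / 4" "p * (4 / \<delta>) * real (m + 3) \<le> \<delta>"
  shows "G V (\<lambda>F. of_bool (\<not> good y F)) \<le> 5 * \<delta> + rest_bound y"
proof -
  define t where "t j = (1 - \<delta>) ^ j * ((1 - 4 * \<delta>) * T)" for j :: nat
  let ?s = "\<lambda>v F. wt (reach {v} F)"
  let ?E1 = "\<lambda>F. \<forall>v\<in>V. ?s v F \<le> K"
  let ?E2 = "\<lambda>j F. \<exists>v\<in>V. K < ?s v F \<and> (1 - \<delta>) * t j < ?s v F \<and> ?s v F \<le> t j"
  let ?E3 = "\<lambda>F. \<exists>v\<in>V. T / \<delta> < ?s v F"
  let ?E4 = "\<lambda>F. \<exists>v\<in>V. K < ?s v F \<and> ?s v F \<le> T / \<delta> \<and> real (card (reach {v} F)) < (1 - \<delta>) * ?s v F"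
  let ?E5 = "\<lambda>F. \<exists>v\<in>V. K < ?s v F \<and> ?s v F \<le> T / \<delta> \<and>
      (\<Sum>i\<in>{i \<in> reach {v} F. w i \<le> L}. w i ^ 2) < (1 - 3 * \<delta>) * D * ?s v F"
  let ?E6 = "\<lambda>F. \<exists>v\<in>V. K < ?s v F \<and> q * (\<Sum>i\<in>V - reach {v} F. w i ^ 2) \<le> 1 - x * D / 2 \<and>
       y < (\<Sum>i\<in>V - reach {v} F. real (card (reach {i} (F \<inter> eds (V - reach {v} F)))))"
  have pw: "?E1 F \<or> (\<exists>j<m. ?E2 j F) \<or> ?E3 F \<or> ?E4 F \<or> ?E5 F \<or> ?E6 F"
    if F: "F \<subseteq> eds V" and bad: "\<not> good y F" for F
  proof (rule ccontr)
    assume neg: "\<not> ?thesis"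
    then obtain v where v: "v \<in> V" "K < ?s v F" by (auto simp: not_le)
    let ?S = "reach {v} F"
    have SV: "?S \<subseteq> V" using F v(1) by (rule reach_in_Pow)
    have fS: "finite ?S" "finite V" using SV fin_sub by auto
    have s3: "?s v F \<le> T / \<delta>" using neg v by (auto simp: not_less)
    have s2: "(1 - 4 * \<delta>) * T < ?s v F"
    proof (rule ccontr)
      assume n: "\<not> (1 - 4 * \<delta>) * T < ?s v F"
      \<comment> \<open>Since \<open>K = \<delta> / 2 * T\<close>, \<open>m\<close> windows of ratio
        \<open>1 - \<delta>\<close> lead from \<open>(1 - 4 * \<delta>) * T\<close> to below
        \<open>K\<close>.\<close>
      have "(1 - \<delta>) ^ m * ((1 - 4 * \<delta>) * T) \<le> \<delta> / 4 * (1 * T)"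
        using assms(2) \<delta> T_pos by (intro mult_mono) auto
      also have "\<dots> \<le> K" using \<delta> x q_pos by (simp add: K_def T_def divide_left_mono)
      finally have "(1 - \<delta>) ^ m * ((1 - 4 * \<delta>) * T) < ?s v F" using v by simp
      then have "\<exists>j<m. (1 - \<delta>) * ((1 - \<delta>) ^ j * ((1 - 4 * \<delta>) * T)) < ?s v F \<and> ?s v F \<le> (1 - \<delta>) ^ j * ((1 - 4 * \<delta>) * T)"
        using \<delta> T_pos n by (intro geometric_cover) auto
      then show False using neg v unfolding t_def by blast
    qed
    have s4: "(1 - \<delta>) * ?s v F \<le> real (card ?S)" using neg v s3 by (auto simp: not_less)
    have s5: "(1 - 3 * \<delta>) * D * ?s v F \<le> (\<Sum>i\<in>{i \<in> ?S. w i \<le> L}. w i ^ 2)" using neg v s3 by (auto simp: not_less)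
    have "(1 - 5 * \<delta>) * T \<le> (1 - \<delta>) * ((1 - 4 * \<delta>) * T)"
    proof -
      have "(1 - \<delta>) * ((1 - 4 * \<delta>) * T) = (1 - 5 * \<delta>) * T + 4 * \<delta>\<^sup>2 * T" by (simp add: power2_eq_square algebra_simps)
      then show ?thesis using T_pos by simp
    qed
    also have "\<dots> \<le> (1 - \<delta>) * ?s v F" using s2 \<delta> by (intro mult_left_mono) auto
    finally have g1: "(1 - 5 * \<delta>) * T \<le> real (card ?S)" using s4 by simp
    \<comment> \<open>The component takes away about \<open>2 * x * D\<close> from
      \<open>q * m2\<close>, twice the excess over 1: the rest is as subcritical as the graph was
      supercritical. The margins in \<open>\<delta>\<close> reduce the 2 to
      \<open>3 / 2\<close>.\<close>
    have "q * (\<Sum>i\<in>V - ?S. w i ^ 2) \<le> 1 - x * D / 2"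
    proof -
      have "x * D * (3 / 2) \<le> x * D * (2 * (1 - 3 * \<delta>) * (1 - 4 * \<delta>))"
      proof (rule mult_left_mono)
        have "2 * (1 - 3 * \<delta>) * (1 - 4 * \<delta>) = 2 - 14 * \<delta> + 24 * \<delta>\<^sup>2" by (simp add: power2_eq_square algebra_simps)
        moreover have "0 \<le> \<delta>\<^sup>2" by simp
        ultimately show "3 / 2 \<le> 2 * (1 - 3 * \<delta>) * (1 - 4 * \<delta>)" using \<delta> by linarith
      qed (use xD_pos in auto)
      also have "\<dots> = (1 - 3 * \<delta>) * D * ((1 - 4 * \<delta>) * (q * T))" unfolding q_T by (simp add: algebra_simps)
      also have "\<dots> = (1 - 3 * \<delta>) * D * (q * ((1 - 4 * \<delta>) * T))" by simp
      also have "\<dots> \<le> (1 - 3 * \<delta>) * D * (q * ?s v F)"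
        using s2 \<delta> D q_nonneg by (intro mult_left_mono) auto
      also have "\<dots> = q * ((1 - 3 * \<delta>) * D * ?s v F)" by simp
      also have "\<dots> \<le> q * (\<Sum>i\<in>{i \<in> ?S. w i \<le> L}. w i ^ 2)" by (intro mult_left_mono s5 q_nonneg)
      also have "\<dots> \<le> q * (\<Sum>i\<in>?S. w i ^ 2)"
        using fS q_nonneg by (intro mult_left_mono sum_mono2) auto
      finally have "x * D * (3 / 2) \<le> q * (\<Sum>i\<in>?S. w i ^ 2)" .
      moreover have "(\<Sum>i\<in>V - ?S. w i ^ 2) = m2 - (\<Sum>i\<in>?S. w i ^ 2)"
        using fS SV by (intro sum_diff) auto
      ultimately show ?thesis using second by (simp add: right_diff_distrib)
    qed
    then have "(\<Sum>i\<in>V - ?S. real (card (reach {i} (F \<inter> eds (V - ?S))))) \<le> y"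
      using neg v by (auto simp: not_less)
    then have "(\<Sum>i\<in>V - ?S. real (card (reach {i} F))) \<le> y"
      using reach_rest[OF F v(1)] by simp
    then show False using bad g1 v unfolding good_def by blast
  qed
  have "G V (\<lambda>F. of_bool (\<not> good y F))
    \<le> G V (\<lambda>F. of_bool (?E1 F) + ((\<Sum>j<m. of_bool (?E2 j F)) + (of_bool (?E3 F) + (of_bool (?E4 F) + (of_bool (?E5 F) + of_bool (?E6 F))))))"
  proof (rule G_mono[OF order_refl])
    fix F assume F: "F \<subseteq> eds V"
    have E2: "of_bool (\<exists>j<m. ?E2 j F) \<le> (\<Sum>j<m. of_bool (?E2 j F) :: real)"
    proof (cases "\<exists>j<m. ?E2 j F")
      case True
      then obtain j where j: "j < m" "?E2 j F" by blast
      have "(\<Sum>j\<in>{j}. of_bool (?E2 j F) :: real) \<le> (\<Sum>j<m. of_bool (?E2 j F))"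
        using j(1) by (intro sum_mono2) auto
      moreover have "(\<Sum>j\<in>{j}. of_bool (?E2 j F) :: real) = 1" using j(2) by simp
      ultimately show ?thesis using True by simp
    next
      case False
      have "0 \<le> (\<Sum>j<m. of_bool (?E2 j F) :: real)" by (rule sum_nonneg) simp
      then show ?thesis using False by (simp only: of_bool_eq)
    qed
    show "of_bool (\<not> good y F) \<le> of_bool (?E1 F) + ((\<Sum>j<m. of_bool (?E2 j F)) + (of_bool (?E3 F) + (of_bool (?E4 F) + (of_bool (?E5 F) + (of_bool (?E6 F) :: real)))))"
    proof (cases "good y F")
      case True
      then show ?thesis by (simp add: sum_nonneg)
    next
      case False
      have "(1::real) \<le> of_bool (?E1 F) + (of_bool (\<exists>j<m. ?E2 j F) + (of_bool (?E3 F) + (of_bool (?E4 F) + (of_bool (?E5 F) + of_bool (?E6 F)))))"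
        by (rule one_le_sum_of_bool[OF pw[OF F False]])
      then show ?thesis using E2 False by simp
    qed
  qed
  also have "\<dots> = G V (\<lambda>F. of_bool (?E1 F)) + ((\<Sum>j<m. G V (\<lambda>F. of_bool (?E2 j F))) + (G V (\<lambda>F. of_bool (?E3 F))
      + (G V (\<lambda>F. of_bool (?E4 F)) + (G V (\<lambda>F. of_bool (?E5 F)) + G V (\<lambda>F. of_bool (?E6 F))))))"
    by (simp only: gexp_def bexp_add bexp_sum)
  also have "\<dots> \<le> (p + \<delta>) + ((\<Sum>j<m. p * (4 / \<delta>)) + (2 * \<delta> + (p * (4 / \<delta>) + (p * (4 / \<delta>) + rest_bound y))))"
  proof (intro add_mono none_big_le heavy_le few_vertices_le small_second_moment_le rest_le assms(1) sum_mono window_le)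
    fix j
    have "(1 - \<delta>) ^ j * ((1 - 4 * \<delta>) * T) \<le> 1 * ((1 - 4 * \<delta>) * T)"
      using \<delta> T_pos by (intro mult_right_mono power_le_one) auto
    then show "t j \<le> (1 - 4 * \<delta>) * T" by (simp add: t_def)
  qed
  also have "\<dots> = p + p * (4 / \<delta>) * real (m + 2) + 3 * \<delta> + rest_bound y"
    by (simp add: algebra_simps add_divide_distrib)
  also have "\<dots> \<le> p * (4 / \<delta>) * real (m + 3) + 3 * \<delta> + rest_bound y"
  proof -
    have "p * 1 \<le> p * (4 / \<delta>)" using \<delta> by (intro mult_left_mono) (auto simp: p_def field_simps)
    moreover have "p * (4 / \<delta>) * real (m + 3) = p * (4 / \<delta>) * real (m + 2) + p * (4 / \<delta>)"
      by (simp add: algebra_simps add_divide_distrib)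
    ultimately show ?thesis by simp
  qed
  also have "\<dots> \<le> 5 * \<delta> + rest_bound y" using assms(3) \<delta> by linarith
  finally show ?thesis .
qed

text \<open>The number of vertices in heavy components has mean at most about \<open>T\<close>, and it is at least
  about \<open>T\<close> with high probability; so it cannot exceed \<open>T\<close> by much.\<close>
lemma not_giant_le:
  assumes "0 < y" "(1 - \<delta>) ^ m \<le> \<delta> / 4" "p * (4 / \<delta>) * real (m + 3) \<le> \<delta>" "0 < \<rho>"
  shows "G V (\<lambda>F. of_bool (\<not> giant V ((1 - 5 * \<delta>) * T) ((1 + \<rho>) * T) y F))
    \<le> 5 * \<delta> + rest_bound y + (17 * \<delta> + rest_bound y) / \<rho>"
proof -
  let ?N = "\<lambda>F. \<Sum>v\<in>V. of_bool (K < wt (reach {v} F)) :: real"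
  let ?b = "5 * \<delta> + rest_bound y"
  let ?g = "\<lambda>F. of_bool (\<not> good y F) :: real"
  have EN: "G V ?N \<le> (1 + 7 * \<delta>) * T"
  proof -
    have "G V ?N = (\<Sum>v\<in>V. big v K)" by (simp only: big_def gexp_def bexp_sum)
    also have "\<dots> \<le> (\<Sum>v\<in>V. (2 * x * (1 + 5 * \<delta>)) * w v)" by (intro sum_mono big_K_le)
    also have "\<dots> = (2 * x * (1 + 5 * \<delta>)) * wt V" by (simp only: sum_distrib_left)
    also have "\<dots> = (1 + 5 * \<delta>) * (q * wt V) * T" using q_pos by (simp add: T_def)
    also have "\<dots> \<le> (1 + 5 * \<delta>) * (1 + \<delta>) * T"
      using first \<delta> T_pos by (intro mult_right_mono mult_left_mono) auto
    also have "\<dots> \<le> (1 + 7 * \<delta>) * T"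
    proof (rule mult_right_mono)
      have "(1 + 5 * \<delta>) * (1 + \<delta>) = 1 + 6 * \<delta> + 5 * \<delta>\<^sup>2" by (simp add: power2_eq_square algebra_simps)
      then show "(1 + 5 * \<delta>) * (1 + \<delta>) \<le> 1 + 7 * \<delta>" using \<delta>_sq \<delta> by linarith
    qed (use T_pos in auto)
    finally show ?thesis .
  qed
  have ng: "G V ?g \<le> ?b" by (rule not_good_le) fact+
  have \<rho>T: "0 < \<rho> * T" using assms(4) T_pos by simp
  \<comment> \<open>Adding the lower bound back when \<open>good\<close> fails makes the bracket
    nonnegative in all cases, so Markov's inequality applies to it. Its mean is at most
    \<open>12 * \<delta> * T\<close> plus \<open>T\<close> times the probability of failure.\<close>
  have pw: "of_bool (\<not> giant V ((1 - 5 * \<delta>) * T) ((1 + \<rho>) * T) y F) \<le> ?g F + (1 / (\<rho> * T)) * ((?N F - (1 - 5 * \<delta>) * T) + ((1 - 5 * \<delta>) * T) * ?g F)"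
    if F: "F \<subseteq> eds V" for F
  proof (cases "good y F")
    case False
    have "0 \<le> ?N F" by (simp add: sum_nonneg)
    then have "0 \<le> (1 / (\<rho> * T)) * ((?N F - (1 - 5 * \<delta>) * T) + ((1 - 5 * \<delta>) * T) * 1)"
      using \<rho>T by (intro mult_nonneg_nonneg) auto
    moreover have g1: "?g F = 1" using False by simp
    moreover have "of_bool (\<not> giant V ((1 - 5 * \<delta>) * T) ((1 + \<rho>) * T) y F) \<le> (1 :: real)" by simp
    ultimately show ?thesis unfolding g1 by linarith
  next
    case True
    then obtain v where v: "v \<in> V" "K < wt (reach {v} F)" "(1 - 5 * \<delta>) * T \<le> real (card (reach {v} F))"
      "(\<Sum>i\<in>V - reach {v} F. real (card (reach {i} F))) \<le> y" unfolding good_def by blast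
    let ?S = "reach {v} F"
    have SV: "?S \<subseteq> V" using F v(1) by (rule reach_in_Pow)
    have "real (card ?S) = (\<Sum>u\<in>?S. of_bool (K < wt (reach {u} F)))"
      using v(2) by (simp add: reach_eq cong: sum.cong)
    also have "\<dots> \<le> ?N F" using SV fin by (intro sum_mono2) auto
    finally have SN: "real (card ?S) \<le> ?N F" .
    have g0: "?g F = 0" using True by simp
    show ?thesis
    proof (cases "giant V ((1 - 5 * \<delta>) * T) ((1 + \<rho>) * T) y F")
      case True
      have "0 \<le> (1 / (\<rho> * T)) * (?N F - (1 - 5 * \<delta>) * T)"
        using SN v(3) \<rho>T by (intro mult_nonneg_nonneg) auto
      then show ?thesis using True g0 by simp
    next
      case False
      then have "(1 + \<rho>) * T < real (card ?S)" using v unfolding giant_def by (auto simp: not_le)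
      then have "\<rho> * T + T < ?N F" using SN by (simp add: algebra_simps)
      moreover have "(1 - 5 * \<delta>) * T \<le> 1 * T" using \<delta> T_pos by (intro mult_right_mono) auto
      ultimately have "\<rho> * T \<le> ?N F - (1 - 5 * \<delta>) * T" by simp
      then have "1 \<le> (1 / (\<rho> * T)) * (?N F - (1 - 5 * \<delta>) * T)" using \<rho>T by (simp add: field_simps)
      then show ?thesis using g0 False by simp
    qed
  qed
  have "G V (\<lambda>F. of_bool (\<not> giant V ((1 - 5 * \<delta>) * T) ((1 + \<rho>) * T) y F))
    \<le> G V (\<lambda>F. ?g F + (1 / (\<rho> * T)) * ((?N F - (1 - 5 * \<delta>) * T) + ((1 - 5 * \<delta>) * T) * ?g F))"
    by (rule G_mono[OF order_refl pw])
  also have "\<dots> = G V ?g + (1 / (\<rho> * T)) * ((G V ?N - G V (\<lambda>F. (1 - 5 * \<delta>) * T)) + ((1 - 5 * \<delta>) * T) * G V ?g)"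
    by (simp only: gexp_def bexp_add bexp_cmult bexp_diff)
  also have "G V (\<lambda>F. (1 - 5 * \<delta>) * T) = (1 - 5 * \<delta>) * T" by simp
  also have "G V ?g + (1 / (\<rho> * T)) * ((G V ?N - (1 - 5 * \<delta>) * T) + ((1 - 5 * \<delta>) * T) * G V ?g)
    \<le> ?b + (1 / (\<rho> * T)) * (((1 + 7 * \<delta>) * T - (1 - 5 * \<delta>) * T) + (1 * T) * ?b)"
  proof (intro add_mono mult_left_mono ng diff_mono EN order_refl)
    have g0: "0 \<le> G V ?g" by (rule G_nonneg) auto
    show "(1 - 5 * \<delta>) * T * G V ?g \<le> 1 * T * ?b"
      using ng g0 \<delta> T_pos by (intro mult_mono) auto
  qed (use \<rho>T \<delta> in auto)
  also have "\<dots> = ?b + (17 * \<delta> + rest_bound y) / \<rho>"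
    using T_pos assms(4) by (simp add: field_simps)
  finally show ?thesis .
qed

end

section \<open>Component sizes and truncated moments\<close>

lemma possible_edges_eq_eds: "possible_edges n = eds {1..n}"
  by (simp add: possible_edges_def eds_def)

lemma components_eq_image: "components n F = (\<lambda>v. reach {v} F) ` {1..n}"
  by (auto simp: components_def quotient_def reach_def)

lemma component_size_zero: "length (component_sizes n F) \<le> k \<Longrightarrow> component_size n F k = 0"
  by (simp add: component_size_def)

text \<open>The index 0 is always summed, even for a graph without components, because the limit
  sequence makes the summand at 0 nonzero there; hence \<open>Suc\<close>, and hence
  \<open>g i 0 = 0\<close> only for \<open>0 < i\<close>.\<close>

lemma suminf_eq_sum_component_size:
  fixes g :: "nat \<Rightarrow> nat \<Rightarrow> real"
  assumes "\<And>i. 0 < i \<Longrightarrow> g i 0 = 0"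
  shows "summable (\<lambda>i. g i (component_size n F i))"
    and "(\<Sum>i. g i (component_size n F i))
      = (\<Sum>i<Suc (length (component_sizes n F)). g i (component_size n F i))"
proof -
  have *: "g i (component_size n F i) = 0" if "i \<notin> {..<Suc (length (component_sizes n F))}" for i
    using that assms[of i] component_size_zero[of n F i] by simp
  show "summable (\<lambda>i. g i (component_size n F i))"
    by (rule summable_finite[of "{..<Suc (length (component_sizes n F))}"]) (use * in auto)
  show "(\<Sum>i. g i (component_size n F i)) = (\<Sum>i<Suc (length (component_sizes n F)). g i (component_size n F i))"
    by (rule suminf_finite) (use * in auto)
qed

lemma insort_snoc:
  assumes "\<And>x. x \<in> set xs \<Longrightarrow> x < m"
  shows "insort m xs = xs @ [m]"
  using assms
proof (induction xs)
  case (Cons a xs)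
  have "\<not> m \<le> a" using Cons.prems[of a] by simp
  then show ?case using Cons by simp
qed simp

text \<open>Strict maximality puts \<open>card C\<close> at the end of the ascending list, hence
  first after reversal.\<close>

lemma component_sizes_Cons:
  assumes "C \<in> components n F" "\<And>C'. C' \<in> components n F \<Longrightarrow> C' \<noteq> C \<Longrightarrow> card C' < card C"
  obtains xs where "component_sizes n F = card C # xs"
    and "mset xs = image_mset card (mset_set (components n F - {C}))"
proof -
  have fin: "finite (components n F)" by (simp add: components_eq_image)
  let ?M = "image_mset card (mset_set (components n F - {C}))"
  have "mset_set (components n F) = add_mset C (mset_set (components n F - {C}))"
    using fin assms(1) by (simp add: mset_set.remove)
  then have "component_sizes n F = rev (insort (card C) (sorted_list_of_multiset ?M))"
    by (simp add: component_sizes_def)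
  also have "insort (card C) (sorted_list_of_multiset ?M) = sorted_list_of_multiset ?M @ [card C]"
    using fin assms(2) by (intro insort_snoc) auto
  finally have "component_sizes n F = card C # rev (sorted_list_of_multiset ?M)" by simp
  then show ?thesis by (rule that) simp
qed

lemma sum_other_components:
  assumes "F \<subseteq> eds {1..n}" "v \<in> {1..n}"
  shows "(\<Sum>C\<in>components n F - {reach {v} F}. real (card C) ^ 2)
    = (\<Sum>i\<in>{1..n} - reach {v} F. real (card (reach {i} F)))"
proof -
  let ?V = "{1..n}"
  let ?X = "components n F - {reach {v} F}"
  have sub: "C \<subseteq> ?V" if C: "C \<in> components n F" for C
  proof -
    obtain u where "u \<in> {1..n}" "C = reach {u} F" using C unfolding components_eq_image by blast
    then show ?thesis using reach_subset[OF assms(1), of "{u}"] by simp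
  qed
  have eq: "reach {i} F = C" if "C \<in> components n F" "i \<in> C" for C i
    using that reach_eq unfolding components_eq_image by fastforce
  have un: "(\<Union>C\<in>?X. C) = ?V - reach {v} F"
  proof (intro equalityI subsetI)
    fix i assume "i \<in> (\<Union>C\<in>?X. C)"
    then obtain C where C: "C \<in> components n F" "C \<noteq> reach {v} F" "i \<in> C" by auto
    then show "i \<in> ?V - reach {v} F" using sub[of C] eq[of C i] reach_eq[of i v F] by auto
  next
    fix i assume i: "i \<in> ?V - reach {v} F"
    have "i \<in> reach {i} F" using reach_self[of "{i}" F] by auto
    then have "reach {i} F \<in> ?X" using i by (auto simp: components_eq_image)
    then show "i \<in> (\<Union>C\<in>?X. C)" using \<open>i \<in> reach {i} F\<close> by blast
  qed
  have "(\<Sum>i\<in>?V - reach {v} F. real (card (reach {i} F))) = (\<Sum>C\<in>?X. \<Sum>i\<in>C. real (card (reach {i} F)))"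
    unfolding un[symmetric]
  proof (rule sum.UNION_disjoint)
    show "finite ?X" by (simp add: components_eq_image)
    show "\<forall>C\<in>?X. finite C" using sub finite_subset[of _ ?V] by auto
    show "\<forall>C\<in>?X. \<forall>C'\<in>?X. C \<noteq> C' \<longrightarrow> C \<inter> C' = {}"
      using eq by (metis DiffD1 disjoint_iff)
  qed
  also have "\<dots> = (\<Sum>C\<in>?X. real (card C) ^ 2)"
  proof (rule sum.cong[OF refl])
    fix C assume C: "C \<in> ?X"
    have "(\<Sum>i\<in>C. real (card (reach {i} F))) = (\<Sum>i\<in>C. real (card C))"
      by (rule sum.cong[OF refl]) (use C eq[of C] in auto)
    then show "(\<Sum>i\<in>C. real (card (reach {i} F))) = real (card C) ^ 2"
      by (simp add: power2_eq_square)
  qed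
  finally show ?thesis by simp
qed

lemma lp_norm_le:
  assumes "(\<Sum>i. \<bar>x i\<bar> powr p) \<le> \<epsilon> powr p" "summable (\<lambda>i. \<bar>x i\<bar> powr p)" "0 < p" "0 \<le> \<epsilon>"
  shows "lp_norm p x \<le> \<epsilon>"
proof -
  have "lp_norm p x \<le> (\<epsilon> powr p) powr (1 / p)"
    unfolding lp_norm_def using assms by (intro powr_mono2 suminf_nonneg) auto
  also have "\<dots> = \<epsilon>" using assms by (simp add: powr_powr)
  finally show ?thesis .
qed

text \<open>The squares of the other sizes sum to at most \<open>\<tau> * s^2 \<le> s^2\<close>, so
  each of them is at most \<open>s\<close>. This singles out the component of \<open>v\<close> as
  the largest, and it makes the ratios at most 1, whose \<open>p\<close>-th powers are then below
  their squares.\<close>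

lemma lp_norm_component_sizes_le:
  assumes F: "F \<subseteq> eds {1..n}" and v: "v \<in> {1..n}"
    and rest: "(\<Sum>i\<in>{1..n} - reach {v} F. real (card (reach {i} F))) \<le> \<tau> * s\<^sup>2"
    and \<tau>: "\<tau> \<le> 1" "\<tau> \<le> \<epsilon> powr p / 2" and s: "0 < s" "s < real (card (reach {v} F))"
    and close: "\<bar>real (card (reach {v} F)) / a - c\<bar> \<le> \<epsilon> / 2" and p: "2 \<le> p" and \<epsilon>: "0 < \<epsilon>"
  shows "lp_norm p (\<lambda>i. (if i = 0 then real (component_size n F 0) / a
      else real (component_size n F i) / s) - (if i = 0 then c else 0)) \<le> \<epsilon>"
proof -
  let ?C = "reach {v} F"
  have fin: "finite (components n F)" by (simp add: components_eq_image)
  have CC: "?C \<in> components n F" using v by (simp add: components_eq_image)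
  have sq: "(\<Sum>C\<in>components n F - {?C}. real (card C) ^ 2) \<le> \<tau> * s\<^sup>2"
    using rest sum_other_components[OF F v] by simp
  have le_s: "real (card C') \<le> s" if "C' \<in> components n F" "C' \<noteq> ?C" for C'
  proof -
    have "(\<Sum>C\<in>{C'}. real (card C) ^ 2) \<le> (\<Sum>C\<in>components n F - {?C}. real (card C) ^ 2)"
      using that fin by (intro sum_mono2) auto
    also have "\<dots> \<le> 1 * s\<^sup>2" using sq mult_right_mono[OF \<tau>(1) zero_le_power2[of s]] by linarith
    finally show ?thesis using s(1) by (intro power2_le_imp_le[of "real (card C')" s]) auto
  qed
  have small: "card C' < card ?C" if "C' \<in> components n F" "C' \<noteq> ?C" for C'
    using le_s[OF that] s(2) by linarith
  obtain xs where xs: "component_sizes n F = card ?C # xs"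
    and mxs: "mset xs = image_mset card (mset_set (components n F - {?C}))"
    by (rule component_sizes_Cons[OF CC small])
  have "(\<Sum>k<length xs. real (xs ! k) ^ 2) = (\<Sum>x\<in>#mset xs. real x ^ 2)"
    by (subst mset_map[symmetric], subst sum_mset_sum_list) (simp add: sum_list_sum_nth atLeast0LessThan)
  also have "\<dots> = (\<Sum>C\<in>components n F - {?C}. real (card C) ^ 2)"
    unfolding mxs by (simp add: sum_unfold_sum_mset image_mset.compositionality comp_def)
  finally have sumxs: "(\<Sum>k<length xs. real (xs ! k) ^ 2) \<le> \<tau> * s\<^sup>2" using sq by simp
  have xs_le: "real (xs ! k) \<le> s" if "k < length xs" for k
  proof -
    have "xs ! k \<in> set_mset (mset xs)" using that by simp
    then obtain C' where "C' \<in> components n F - {?C}" "xs ! k = card C'"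
      unfolding mxs using fin by auto
    then show ?thesis using le_s by auto
  qed
  let ?z = "\<lambda>i. (if i = 0 then real (component_size n F 0) / a
      else real (component_size n F i) / s) - (if i = 0 then c else 0)"
  define g where "g i k = (if i = 0 then \<bar>real k / a - c\<bar> powr p else (real k / s) powr p)" for i k :: nat
  have gS: "g (Suc i) k = (real k / s) powr p" and g_zero: "g 0 k = \<bar>real k / a - c\<bar> powr p" for i k
    by (simp_all add: g_def)
  have cs: "component_size n F 0 = card ?C" "component_size n F (Suc (length xs)) = 0"
    "i < length xs \<Longrightarrow> component_size n F (Suc i) = xs ! i" for i
    by (simp_all add: component_size_def xs)
  have zg: "(\<lambda>i. \<bar>?z i\<bar> powr p) = (\<lambda>i. g i (component_size n F i))"
    using s(1) by (intro ext) (simp add: g_def)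
  have g0: "g i 0 = 0" if "0 < i" for i using that by (simp add: g_def)
  note sums = suminf_eq_sum_component_size[of g n F, OF g0]
  show ?thesis
  proof (rule lp_norm_le)
    show "summable (\<lambda>i. \<bar>?z i\<bar> powr p)" by (subst zg) (rule sums(1))
    have "(\<Sum>i. \<bar>?z i\<bar> powr p) = (\<Sum>i. g i (component_size n F i))" by (simp only: zg)
    also have "\<dots> = (\<Sum>i<Suc (length (component_sizes n F)). g i (component_size n F i))" by (rule sums(2))
    also have "\<dots> = g 0 (component_size n F 0) + (\<Sum>i<length (component_sizes n F). g (Suc i) (component_size n F (Suc i)))"
      by (rule sum.lessThan_Suc_shift)
    also have "g 0 (component_size n F 0) \<le> (\<epsilon> / 2) powr p"
      unfolding cs g_zero using close p by (intro powr_mono2) auto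
    \<comment> \<open>From \<open>p \<ge> 2\<close>; together with
      \<open>\<tau> \<le> \<epsilon> powr p / 2\<close> the total stays below
      \<open>\<epsilon> powr p\<close>.\<close>
    also have "(\<epsilon> / 2) powr p \<le> \<epsilon> powr p / 4"
    proof -
      have "(2::real) powr 2 \<le> 2 powr p" using p by (intro powr_mono) auto
      then have "\<epsilon> powr p / 2 powr p \<le> \<epsilon> powr p / 4" by (intro divide_left_mono) auto
      then show ?thesis using \<epsilon> by (simp add: powr_divide)
    qed
    \<comment> \<open>Coordinate \<open>k + 1\<close> carries \<open>xs ! k\<close>. The full list
      has one entry more than \<open>xs\<close>, so the last term of the shifted sum is the default
      0.\<close>
    also have "(\<Sum>i<length (component_sizes n F). g (Suc i) (component_size n F (Suc i)))
      = (\<Sum>k<Suc (length xs). (real (component_size n F (Suc k)) / s) powr p)"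
      by (simp only: xs list.size gS add_Suc_right add_0_right)
    also have "\<dots> = (\<Sum>k<length xs. (real (xs ! k) / s) powr p)"
      by (simp add: cs)
    also have "\<dots> \<le> (\<Sum>k<length xs. real (xs ! k) ^ 2 / s\<^sup>2)"
    proof (rule sum_mono)
      fix k assume k: "k \<in> {..<length xs}"
      have r: "0 \<le> real (xs ! k) / s" "real (xs ! k) / s \<le> 1" using xs_le[of k] k s by auto
      show "(real (xs ! k) / s) powr p \<le> real (xs ! k) ^ 2 / s\<^sup>2"
      proof (cases "real (xs ! k) / s = 0")
        case False
        then have "(real (xs ! k) / s) powr p \<le> (real (xs ! k) / s) powr 2"
          using r p by (intro powr_mono') auto
        also have "\<dots> = (real (xs ! k) / s) ^ 2" using r False by (subst powr_numeral) auto
        finally show ?thesis by (simp add: power_divide)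
      qed auto
    qed
    also have "\<dots> = (\<Sum>k<length xs. real (xs ! k) ^ 2) / s\<^sup>2" by (simp add: sum_divide_distrib)
    also have "\<dots> \<le> \<tau>" using sumxs s by (simp add: pos_divide_le_eq)
    finally show "(\<Sum>i. \<bar>?z i\<bar> powr p) \<le> \<epsilon> powr p" using \<tau>(2) powr_ge_zero[of \<epsilon> p] by linarith
  qed (use p \<epsilon> in auto)
qed

text \<open>A bounded continuous minorant of the third power truncated at \<open>L\<close>, exact on
  nonnegative arguments up to \<open>L / 2\<close>. Weak convergence tests only continuous
  functions, so the sharp truncation would not do.\<close>

definition cubic_cutoff :: "real \<Rightarrow> real \<Rightarrow> real" where
  "cubic_cutoff L x = (max 0 (min x (L - x))) ^ 3"

lemma cubic_cutoff_le:
  assumes "0 \<le> x"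
  shows "cubic_cutoff L x \<le> (if x \<le> L then x ^ 3 else 0)"
  using assms unfolding cubic_cutoff_def by (auto intro!: power_mono)

lemma cubic_cutoff_nonneg: "0 \<le> cubic_cutoff L x"
  by (simp add: cubic_cutoff_def)

lemma cubic_cutoff_bounded:
  assumes "0 \<le> L"
  shows "norm (cubic_cutoff L x) \<le> L ^ 3"
proof -
  have "(max 0 (min x (L - x))) ^ 3 \<le> L ^ 3" using assms by (intro power_mono) auto
  then show ?thesis using cubic_cutoff_nonneg[of L x] by (simp add: cubic_cutoff_def)
qed

lemma isCont_cubic_cutoff: "isCont (cubic_cutoff L) x"
  unfolding cubic_cutoff_def by (intro continuous_intros)

lemma tendsto_integral_cubic_cutoff:
  assumes "W \<in> borel_measurable M" "AE x in M. 0 < W x" "integrable M (\<lambda>x. W x ^ 3)"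
  shows "(\<lambda>k. \<integral>x. cubic_cutoff (real k) (W x) \<partial>M) \<longlonglongrightarrow> (\<integral>x. W x ^ 3 \<partial>M)"
proof (rule integral_dominated_convergence[where w = "\<lambda>x. W x ^ 3"])
  have [measurable]: "cubic_cutoff L \<in> borel_measurable borel" for L
    by (intro borel_measurable_continuous_onI continuous_at_imp_continuous_on) (auto intro: isCont_cubic_cutoff)
  have [measurable]: "W \<in> borel_measurable M" by fact
  show "(\<lambda>x. W x ^ 3) \<in> borel_measurable M" "(\<lambda>x. cubic_cutoff (real k) (W x)) \<in> borel_measurable M" for k
    by measurable
  show "AE x in M. (\<lambda>k. cubic_cutoff (real k) (W x)) \<longlonglongrightarrow> W x ^ 3"
    using assms(2)
  proof eventually_elim
    case (elim x)
    have "\<forall>\<^sub>F k in sequentially. cubic_cutoff (real k) (W x) = W x ^ 3"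
      using eventually_ge_at_top[of "nat \<lceil>2 * W x\<rceil>"]
    proof eventually_elim
      case (elim k)
      then have "2 * W x \<le> real k" by linarith
      then show ?case using \<open>0 < W x\<close> by (simp add: cubic_cutoff_def)
    qed
    then show ?case by (rule tendsto_eventually)
  qed
  show "AE x in M. norm (cubic_cutoff (real k) (W x)) \<le> W x ^ 3" for k
    using assms(2)
  proof eventually_elim
    case (elim x)
    then show ?case using cubic_cutoff_le[of "W x" "real k"] cubic_cutoff_nonneg[of "real k" "W x"]
      by (auto split: if_splits)
  qed
qed fact

text \<open>By dominated convergence a cutoff captures more than \<open>\<kappa>\<close> of the
  limiting third moment, and weak convergence transfers this to the empirical weights with the same
  cutoff for all large \<open>n\<close>.\<close>

lemma truncated_third_moment:
  assumes "prob_space M" "W \<in> borel_measurable M" "AE x in M. 0 < W x" "integrable M (\<lambda>x. W x ^ 3)"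
    and "weak_conv_m (\<lambda>n. distr (measure_pmf (pmf_of_set {1..n})) borel (w n)) (distr M borel W)"
    and "\<And>n i. i \<in> {1..n} \<Longrightarrow> 0 < w n i" "\<kappa> < (\<integral>x. W x ^ 3 \<partial>M)"
  shows "\<exists>L\<ge>1. \<forall>\<^sub>F n in sequentially. \<kappa> * real n \<le> (\<Sum>i\<in>{i\<in>{1..n}. w n i \<le> L}. w n i ^ 3)"
proof -
  interpret prob_space M by fact
  have "\<forall>\<^sub>F k in sequentially. \<kappa> < (\<integral>x. cubic_cutoff (real k) (W x) \<partial>M) \<and> 1 \<le> k"
    using order_tendstoD(1)[OF tendsto_integral_cubic_cutoff[OF assms(2-4)] assms(7)] eventually_ge_at_top[of 1]
    by eventually_elim auto
  then obtain k where k: "\<kappa> < (\<integral>x. cubic_cutoff (real k) (W x) \<partial>M)" "1 \<le> k"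
    using eventually_happens'[OF sequentially_bot] by blast
  let ?\<phi> = "cubic_cutoff (real k)"
  have [measurable]: "?\<phi> \<in> borel_measurable borel"
    by (intro borel_measurable_continuous_onI continuous_at_imp_continuous_on) (auto intro: isCont_cubic_cutoff)
  have "(\<lambda>n. integral\<^sup>L (distr (measure_pmf (pmf_of_set {1..n})) borel (w n)) ?\<phi>)
      \<longlonglongrightarrow> integral\<^sup>L (distr M borel W) ?\<phi>"
  proof (rule weak_conv_imp_integral_bdd_continuous_conv)
    \<comment> \<open>This is required for every \<open>n\<close>; at \<open>n = 0\<close> the
      uniform \<open>pmf\<close> on the empty set is unspecified but still a
      \<open>pmf\<close>.\<close>
    show "real_distribution (distr (measure_pmf (pmf_of_set {1..n})) borel (w n))" for n
      by (intro prob_space.real_distribution_distr prob_space_measure_pmf) simp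
    show "real_distribution (distr M borel W)" using assms(2) by simp
    show "norm (?\<phi> x) \<le> real k ^ 3" for x by (rule cubic_cutoff_bounded) simp
    show "isCont ?\<phi> x" for x by (rule isCont_cubic_cutoff)
  qed (rule assms(5))
  also have "integral\<^sup>L (distr M borel W) ?\<phi> = (\<integral>x. ?\<phi> (W x) \<partial>M)"
    using assms(2) by (intro integral_distr) auto
  finally have "\<forall>\<^sub>F n in sequentially. \<kappa> < integral\<^sup>L (distr (measure_pmf (pmf_of_set {1..n})) borel (w n)) ?\<phi>"
    using k(1) by (rule order_tendstoD(1))
  then have "\<forall>\<^sub>F n in sequentially. \<kappa> * real n \<le> (\<Sum>i\<in>{i\<in>{1..n}. w n i \<le> real k}. w n i ^ 3)"
    using eventually_ge_at_top[of 1]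
  proof eventually_elim
    case (elim n)
    have "integral\<^sup>L (distr (measure_pmf (pmf_of_set {1..n})) borel (w n)) ?\<phi>
       = integral\<^sup>L (measure_pmf (pmf_of_set {1..n})) (\<lambda>i. ?\<phi> (w n i))"
      by (intro integral_distr) auto
    also have "\<dots> = (\<Sum>i\<in>{1..n}. ?\<phi> (w n i)) / real n"
      using elim(2) by (simp add: integral_pmf_of_set)
    finally have "\<kappa> * real n \<le> (\<Sum>i\<in>{1..n}. ?\<phi> (w n i))"
      using elim by (simp add: pos_less_divide_eq)
    also have "\<dots> \<le> (\<Sum>i\<in>{1..n}. if w n i \<le> real k then w n i ^ 3 else 0)"
      by (intro sum_mono cubic_cutoff_le less_imp_le[OF assms(6)])
    also have "\<dots> = (\<Sum>i\<in>{i\<in>{1..n}. w n i \<le> real k}. w n i ^ 3)"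
      by (rule sum.inter_filter[symmetric]) simp
    finally show ?case .
  qed
  then show ?thesis using k(2) by (intro exI[of _ "real k"]) auto
qed

section \<open>Asymptotics\<close>

text \<open>\<open>r n\<close> stands for the cube root of the total weight. In terms of
  \<open>u = f / r\<close> the excess \<open>x * D\<close> is asymptotic to \<open>u\<close>,
  \<open>D\<close> tends to \<open>C\<close>, and so \<open>T\<close> is asymptotic to
  \<open>2 * f * r^2 / C\<close>.\<close>

lemma eventually_giant:
  fixes w :: "nat \<Rightarrow> nat \<Rightarrow> real" and f r :: "nat \<Rightarrow> real"
  defines "q \<equiv> \<lambda>n. (r n + f n) / r n ^ 4"
  assumes w_pos: "\<And>n i. i \<in> {1..n} \<Longrightarrow> 0 < w n i"
    and r_top: "filterlim r at_top sequentially" and f_top: "filterlim f at_top sequentially"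
    and fr: "(\<lambda>n. f n / r n) \<longlonglongrightarrow> 0"
    and first: "\<forall>\<^sub>F n in sequentially. (\<Sum>i=1..n. w n i) = r n ^ 3"
    and second: "(\<lambda>n. ((\<Sum>i=1..n. w n i ^ 2) - r n ^ 3) / r n ^ 2) \<longlonglongrightarrow> 0"
    and third: "(\<lambda>n. (\<Sum>i=1..n. w n i ^ 3) / r n ^ 3) \<longlonglongrightarrow> C" and "0 < C"
    and n_r: "(\<lambda>n. real n / r n ^ 3) \<longlonglongrightarrow> \<gamma>" and "0 < \<gamma>"
    and trunc: "\<And>\<kappa>. \<kappa> < C / \<gamma> \<Longrightarrow>
       \<exists>L\<ge>1. \<forall>\<^sub>F n in sequentially. \<kappa> * real n \<le> (\<Sum>i\<in>{i\<in>{1..n}. w n i \<le> L}. w n i ^ 3)"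
    and pos: "0 < \<rho>" "\<rho> \<le> 1" "0 < \<tau>" "0 < \<zeta>"
  shows "\<forall>\<^sub>F n in sequentially. gexp (w n) (q n) {1..n} (\<lambda>F. of_bool (\<not> giant {1..n} ((1 - \<rho>) / C * (2 * f n * r n ^ 2)) ((1 + \<rho>) / C * (2 * f n * r n ^ 2)) (\<tau> * r n ^ 4) F)) < \<zeta>"
proof -
  \<comment> \<open>Strictly below \<open>\<rho>\<close>, since \<open>T\<close> agrees with its
    limit only asymptotically.\<close>
  define \<rho>' where "\<rho>' = \<rho> / 2"
  have \<rho>': "0 < \<rho>'" "\<rho>' \<le> 1" "\<rho>' < \<rho>" using pos by (auto simp: \<rho>'_def)
  \<comment> \<open>\<open>\<rho> / 10\<close> makes \<open>5 * \<delta>\<close> at most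
    \<open>\<rho> / 2\<close>, and the last entry bounds
    \<open>5 * \<delta> + 17 * \<delta> / \<rho>'\<close> by \<open>22 * \<delta> / \<rho>'\<close>,
    hence by \<open>\<zeta> / 4\<close>.\<close>
  define \<delta> where "\<delta> = min (1 / 50) (min (\<rho> / 10) (\<zeta> * \<rho>' / 88))"
  have \<delta>: "0 < \<delta>" "\<delta> \<le> 1 / 50" "\<delta> \<le> \<rho> / 10" "\<delta> \<le> \<zeta> * \<rho>' / 88"
    using pos \<rho>' by (auto simp: \<delta>_def)
  obtain m where m: "(1 - \<delta>) ^ m < \<delta> / 4"
    using real_arch_pow_inv[of "\<delta> / 4" "1 - \<delta>"] \<delta> by auto
  define A where "A = \<delta> / (4 / \<delta> * real (m + 3))"
  have A: "0 < A" using \<delta> by (simp add: A_def)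
  \<comment> \<open>Fixed before \<open>n\<close>: the first entry is a requirement of the locale,
    the second brings the exponential factor below \<open>A\<close>, so that all
    \<open>m + 3\<close> contributions together stay below \<open>\<delta>\<close>.\<close>
  define \<Gamma> where "\<Gamma> = max (1 / \<delta>\<^sup>2) (16 / \<delta> ^ 3 * (- ln A))"
  have exp\<Gamma>: "exp (- (\<delta> ^ 3 * \<Gamma> / 16)) * (4 / \<delta>) * real (m + 3) \<le> \<delta>"
  proof -
    have "\<delta> ^ 3 / 16 * (16 / \<delta> ^ 3 * (- ln A)) \<le> \<delta> ^ 3 / 16 * \<Gamma>"
      unfolding \<Gamma>_def using \<delta> by (intro mult_left_mono) auto
    moreover have "\<delta> ^ 3 / 16 * (16 / \<delta> ^ 3 * (- ln A)) = - ln A" using \<delta> by simp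
    moreover have "\<delta> ^ 3 * \<Gamma> / 16 = \<delta> ^ 3 / 16 * \<Gamma>" by simp
    ultimately have "- (\<delta> ^ 3 * \<Gamma> / 16) \<le> ln A" by linarith
    then have "exp (- (\<delta> ^ 3 * \<Gamma> / 16)) \<le> exp (ln A)" by (subst exp_le_cancel_iff)
    then have "exp (- (\<delta> ^ 3 * \<Gamma> / 16)) \<le> A" using A by simp
    then have "exp (- (\<delta> ^ 3 * \<Gamma> / 16)) * (4 / \<delta> * real (m + 3)) \<le> A * (4 / \<delta> * real (m + 3))"
      using \<delta> by (intro mult_right_mono) auto
    also have "\<dots> = \<delta>" using \<delta> by (simp add: A_def)
    finally show ?thesis by (simp add: mult.assoc)
  qed
  \<comment> \<open>The factor lies strictly between \<open>1 - \<delta>\<close> and 1, leaving room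
    for the convergence of \<open>n / r^3\<close>, \<open>u\<close> and \<open>D\<close>.\<close>
  define \<kappa> where "\<kappa> = (1 - \<delta> / 2) * (C / \<gamma>)"
  have "\<kappa> < 1 * (C / \<gamma>)" unfolding \<kappa>_def
    using \<delta> \<open>0 < C\<close> \<open>0 < \<gamma>\<close> by (intro mult_strict_right_mono) auto
  then have "\<kappa> < C / \<gamma>" by simp
  then obtain L where L: "1 \<le> L"
    and ev_trunc: "\<forall>\<^sub>F n in sequentially. \<kappa> * real n \<le> (\<Sum>i\<in>{i\<in>{1..n}. w n i \<le> L}. w n i ^ 3)"
    using trunc by blast

  define S2 where "S2 n = (\<Sum>i=1..n. w n i ^ 2)" for n
  define S3 where "S3 n = (\<Sum>i=1..n. w n i ^ 3)" for n
  define u where "u n = f n / r n" for n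
  define b where "b n = (S2 n - r n ^ 3) / r n ^ 2" for n
  \<comment> \<open>The relative correction in \<open>q * S2 - 1 = \<eta> * u\<close>. The error
    \<open>b\<close> of the second moment enters divided by \<open>f\<close>.\<close>
  define \<eta> where "\<eta> n = 1 + (1 + u n) * (b n / f n)" for n
  define D where "D n = q n * S3 n" for n
  define x where "x n = (q n * S2 n - 1) / D n" for n
  have ev_r: "\<forall>\<^sub>F n in sequentially. 1 \<le> r n" and ev_f: "\<forall>\<^sub>F n in sequentially. 1 \<le> f n"
    using r_top f_top by (auto simp: filterlim_at_top)
  have u: "u \<longlonglongrightarrow> 0" using fr unfolding u_def[abs_def] .
  have inv_f: "(\<lambda>n. 1 / f n) \<longlonglongrightarrow> 0" and inv_r: "(\<lambda>n. 1 / r n) \<longlonglongrightarrow> 0"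
    using tendsto_inverse_0_at_top[OF f_top] tendsto_inverse_0_at_top[OF r_top] by (simp_all add: divide_inverse)
  have \<eta>: "\<eta> \<longlonglongrightarrow> 1"
  proof -
    have "(\<lambda>n. 1 + (1 + u n) * (b n * (1 / f n))) \<longlonglongrightarrow> 1 + (1 + 0) * (0 * 0)"
      using second unfolding S2_def[symmetric] b_def[symmetric] by (intro tendsto_intros u inv_f)
    then show ?thesis by (simp add: \<eta>_def[abs_def])
  qed
  have q_eq: "\<forall>\<^sub>F n in sequentially. q n = (1 + u n) / r n ^ 3"
    using ev_r by eventually_elim (simp add: q_def u_def field_simps power3_eq_cube power4_eq_xxxx)
  have D: "D \<longlonglongrightarrow> C"
  proof -
    have "(\<lambda>n. (1 + u n) * (S3 n / r n ^ 3)) \<longlonglongrightarrow> (1 + 0) * C"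
      by (intro tendsto_intros u third[folded S3_def])
    moreover have "\<forall>\<^sub>F n in sequentially. (1 + u n) * (S3 n / r n ^ 3) = D n"
      using q_eq by eventually_elim (simp add: D_def)
    ultimately show ?thesis using Lim_transform_eventually by fastforce
  qed
  have ev_D: "\<forall>\<^sub>F n in sequentially. 0 < D n" using order_tendstoD(1)[OF D \<open>0 < C\<close>] .
  have xD: "\<forall>\<^sub>F n in sequentially. x n * D n = \<eta> n * u n"
    using q_eq ev_D ev_r ev_f
  proof eventually_elim
    case (elim n)
    have W2: "S2 n = r n ^ 3 + b n * r n ^ 2" using elim by (simp add: b_def)
    have "x n * D n = (1 + u n) / r n ^ 3 * (r n ^ 3 + b n * r n ^ 2) - 1"
      using elim by (simp add: x_def W2)
    also have "\<dots> = \<eta> n * u n"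
      using elim by (simp add: \<eta>_def u_def field_simps power2_eq_square power3_eq_cube)
    finally show ?case .
  qed
  have e0: "(\<lambda>n. \<eta> n * u n) \<longlonglongrightarrow> 0" using tendsto_mult[OF \<eta> u] by simp
  have x_eq: "\<forall>\<^sub>F n in sequentially. x n = \<eta> n * u n / D n"
    using xD ev_D by eventually_elim (simp add: field_simps)
  have x0: "x \<longlonglongrightarrow> 0"
  proof -
    have "(\<lambda>n. \<eta> n * u n / D n) \<longlonglongrightarrow> 0 / C" using \<open>0 < C\<close> by (intro tendsto_divide e0 D) auto
    then have "(\<lambda>n. \<eta> n * u n / D n) \<longlonglongrightarrow> 0" by simp
    moreover have "\<forall>\<^sub>F n in sequentially. \<eta> n * u n / D n = x n" using x_eq by eventually_elim simp
    ultimately show ?thesis using Lim_transform_eventually by blast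
  qed
  have ev_\<eta>: "\<forall>\<^sub>F n in sequentially. 1 / 2 < \<eta> n" using order_tendstoD(1)[OF \<eta>, of "1 / 2"] by simp
  have ev_u: "\<forall>\<^sub>F n in sequentially. u n < \<delta>" using order_tendstoD(2)[OF u \<delta>(1)] .
  have T_eq: "\<forall>\<^sub>F n in sequentially. 2 * x n / q n = \<eta> n / (D n * (1 + u n)) * (2 * f n * r n ^ 2)"
    using q_eq x_eq ev_D ev_r ev_f
  proof eventually_elim
    case (elim n)
    have "0 < u n" using elim by (simp add: u_def)
    then have nz: "1 + u n \<noteq> 0" "r n \<noteq> 0" "D n \<noteq> 0" using elim by auto
    have "2 * x n / q n = 2 * (\<eta> n * u n / D n) / ((1 + u n) / r n ^ 3)" by (simp only: elim(1,2))
    also have "\<dots> = \<eta> n / (D n * (1 + u n)) * (2 * u n * r n ^ 3)"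
      using nz by (simp add: divide_simps)
    also have "2 * u n * r n ^ 3 = 2 * f n * r n ^ 2"
      using elim by (simp add: u_def power2_eq_square power3_eq_cube)
    finally show ?case .
  qed
  have h: "(\<lambda>n. \<eta> n / (D n * (1 + u n))) \<longlonglongrightarrow> 1 / C"
  proof -
    have "(\<lambda>n. \<eta> n / (D n * (1 + u n))) \<longlonglongrightarrow> 1 / (C * (1 + 0))"
      using \<open>0 < C\<close> by (intro tendsto_intros \<eta> D u) auto
    then show ?thesis by simp
  qed
  have ev_up: "\<forall>\<^sub>F n in sequentially. (1 + \<rho>') * (\<eta> n / (D n * (1 + u n))) < (1 + \<rho>) / C"
    using \<open>0 < C\<close> \<rho>' by (intro order_tendstoD(2)[OF tendsto_mult[OF tendsto_const h]]) (simp add: divide_strict_right_mono)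
  have ev_low: "\<forall>\<^sub>F n in sequentially. (1 - \<rho>) / C < (1 - 5 * \<delta>) * (\<eta> n / (D n * (1 + u n)))"
    using \<open>0 < C\<close> \<delta> pos by (intro order_tendstoD(1)[OF tendsto_mult[OF tendsto_const h]]) (simp add: divide_strict_right_mono)
  have q_inv: "\<forall>\<^sub>F n in sequentially. 0 < q n"
    using ev_r ev_f by eventually_elim (simp add: q_def)
  have ev_trunc': "\<forall>\<^sub>F n in sequentially. (1 - \<delta>) * D n \<le> q n * (\<Sum>i\<in>{i\<in>{1..n}. w n i \<le> L}. w n i ^ 3)"
  proof -
    have "(\<lambda>n. (1 + u n) * \<kappa> * (real n / r n ^ 3) - (1 - \<delta>) * D n) \<longlonglongrightarrow> (1 + 0) * \<kappa> * \<gamma> - (1 - \<delta>) * C"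
      by (intro tendsto_intros u n_r D)
    moreover have "0 < (1 + 0) * \<kappa> * \<gamma> - (1 - \<delta>) * C"
    proof -
      have "(1 + 0) * \<kappa> * \<gamma> - (1 - \<delta>) * C = \<delta> / 2 * C"
        using \<open>0 < \<gamma>\<close> by (simp add: \<kappa>_def field_simps)
      moreover have "0 < \<delta> / 2 * C" using \<delta> \<open>0 < C\<close> by simp
      ultimately show ?thesis by linarith
    qed
    ultimately have "\<forall>\<^sub>F n in sequentially. 0 < (1 + u n) * \<kappa> * (real n / r n ^ 3) - (1 - \<delta>) * D n"
      by (rule order_tendstoD(1))
    then show ?thesis using ev_trunc q_eq q_inv
    proof eventually_elim
      case (elim n)
      have "(1 - \<delta>) * D n \<le> q n * (\<kappa> * real n)" using elim(1,3) by (simp add: mult_ac)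
      also have "\<dots> \<le> q n * (\<Sum>i\<in>{i\<in>{1..n}. w n i \<le> L}. w n i ^ 3)"
        using elim by (intro mult_left_mono) auto
      finally show ?case .
    qed
  qed
  \<comment> \<open>The scale is asymptotic to \<open>f^3 / C^2\<close>; the divergence of
    \<open>f\<close> lifts it above any fixed \<open>\<Gamma>\<close>.\<close>
  have ev_\<Gamma>: "\<forall>\<^sub>F n in sequentially. \<Gamma> \<le> (x n)\<^sup>2 * (x n * D n) / q n"
  proof -
    have A: "(\<lambda>n. \<eta> n ^ 3 / ((1 + u n) * D n ^ 2)) \<longlonglongrightarrow> 1 ^ 3 / ((1 + 0) * C ^ 2)"
      using \<open>0 < C\<close> by (intro tendsto_intros \<eta> u D) auto
    have B: "filterlim (\<lambda>n. f n ^ 3) at_top sequentially"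
      by (rule filterlim_pow_at_top[OF _ f_top]) simp
    have "filterlim (\<lambda>n. \<eta> n ^ 3 / ((1 + u n) * D n ^ 2) * f n ^ 3) at_top sequentially"
      by (rule filterlim_tendsto_pos_mult_at_top[OF A _ B]) (use \<open>0 < C\<close> in auto)
    then have "\<forall>\<^sub>F n in sequentially. \<Gamma> \<le> \<eta> n ^ 3 / ((1 + u n) * D n ^ 2) * f n ^ 3"
      by (simp add: filterlim_at_top)
    then show ?thesis using q_eq x_eq xD ev_D ev_r ev_f
    proof eventually_elim
      case (elim n)
      have u0: "0 < u n" using elim by (simp add: u_def)
      have "(x n)\<^sup>2 * (x n * D n) / q n = (\<eta> n * u n / D n)\<^sup>2 * (\<eta> n * u n) / ((1 + u n) / r n ^ 3)"
        by (simp only: elim(4)) (simp only: elim(2,3))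
      also have "\<dots> = \<eta> n ^ 3 / ((1 + u n) * D n ^ 2) * (u n * r n) ^ 3"
        using elim u0 by (simp add: divide_simps power2_eq_square power3_eq_cube)
      also have "u n * r n = f n" using elim by (simp add: u_def)
      finally show ?case using elim(1) by (simp only:)
    qed
  qed
  have ev_Lq: "\<forall>\<^sub>F n in sequentially. 8 * L * q n \<le> \<delta>\<^sup>2 * x n * (x n * D n)"
  proof -
    have A: "(\<lambda>n. \<delta>\<^sup>2 * \<eta> n ^ 2 / ((1 + u n) * D n)) \<longlonglongrightarrow> \<delta>\<^sup>2 * 1 ^ 2 / ((1 + 0) * C)"
      using \<open>0 < C\<close> by (intro tendsto_intros \<eta> u D) auto
    have B: "filterlim (\<lambda>n. f n ^ 2 * r n) at_top sequentially"
      by (intro filterlim_at_top_mult_at_top filterlim_pow_at_top[OF _ f_top] r_top) simp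
    have "filterlim (\<lambda>n. \<delta>\<^sup>2 * \<eta> n ^ 2 / ((1 + u n) * D n) * (f n ^ 2 * r n)) at_top sequentially"
      by (rule filterlim_tendsto_pos_mult_at_top[OF A _ B]) (use \<open>0 < C\<close> \<delta> in auto)
    then have "\<forall>\<^sub>F n in sequentially. 8 * L \<le> \<delta>\<^sup>2 * \<eta> n ^ 2 / ((1 + u n) * D n) * (f n ^ 2 * r n)"
      by (simp add: filterlim_at_top)
    then show ?thesis using q_eq x_eq xD ev_D ev_r ev_f q_inv
    proof eventually_elim
      case (elim n)
      have u0: "0 < u n" using elim by (simp add: u_def)
      have "\<delta>\<^sup>2 * x n * (x n * D n) / q n = \<delta>\<^sup>2 * (\<eta> n * u n / D n) * (\<eta> n * u n) / ((1 + u n) / r n ^ 3)"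
        by (simp only: elim(4)) (simp only: elim(2,3))
      also have "\<dots> = \<delta>\<^sup>2 * \<eta> n ^ 2 / ((1 + u n) * D n) * ((u n * r n) ^ 2 * r n)"
        using elim u0 by (simp add: divide_simps power2_eq_square power3_eq_cube)
      also have "u n * r n = f n" using elim by (simp add: u_def)
      finally have eq: "\<delta>\<^sup>2 * x n * (x n * D n) / q n
        = \<delta>\<^sup>2 * \<eta> n ^ 2 / ((1 + u n) * D n) * (f n ^ 2 * r n)" .
      show ?case using elim(1) unfolding eq[symmetric] by (subst (asm) pos_le_divide_eq[OF elim(8)])
    qed
  qed
  \<comment> \<open>\<open>rest_bound\<close> in terms of \<open>r\<close>. Its two parts are of
    order \<open>1 / r\<close> and \<open>1 / f\<close>, so the squared sizes of the small
    components sum to less than any fixed multiple of \<open>r^4\<close>, with high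
    probability.\<close>
  define R where "R n = 4 / \<delta> * ((real n + q n * (r n ^ 3)\<^sup>2 / (x n * D n / 2)) / (\<tau> * r n ^ 4))" for n
  have R0: "R \<longlonglongrightarrow> 0"
  proof -
    have "(\<lambda>n. 4 / \<delta> / \<tau> * (real n / r n ^ 3 * (1 / r n) + 2 * (1 + u n) / \<eta> n * (1 / f n)))
      \<longlonglongrightarrow> 4 / \<delta> / \<tau> * (\<gamma> * 0 + 2 * (1 + 0) / 1 * 0)"
      by (intro tendsto_intros n_r inv_r inv_f u \<eta>) auto
    then have lim: "(\<lambda>n. 4 / \<delta> / \<tau> * (real n / r n ^ 3 * (1 / r n) + 2 * (1 + u n) / \<eta> n * (1 / f n))) \<longlonglongrightarrow> 0"
      by simp
    have "\<forall>\<^sub>F n in sequentially. 4 / \<delta> / \<tau> * (real n / r n ^ 3 * (1 / r n) + 2 * (1 + u n) / \<eta> n * (1 / f n)) = R n"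
      using q_eq xD ev_r ev_f ev_\<eta>
    proof eventually_elim
      case (elim n)
      have 1: "real n / r n ^ 3 * (1 / r n) = real n / r n ^ 4"
        using elim by (simp add: power3_eq_cube power4_eq_xxxx)
      have "q n * (r n ^ 3)\<^sup>2 / (x n * D n / 2) = (1 + u n) / r n ^ 3 * (r n ^ 3)\<^sup>2 / (\<eta> n * (f n / r n) / 2)"
        by (simp only: elim(1,2)) (simp only: u_def)
      also have "\<dots> = 2 * (1 + u n) / \<eta> n * (1 / f n) * r n ^ 4"
        using elim by (simp add: divide_simps power2_eq_square power3_eq_cube power4_eq_xxxx)
      finally have 2: "q n * (r n ^ 3)\<^sup>2 / (x n * D n / 2) / r n ^ 4 = 2 * (1 + u n) / \<eta> n * (1 / f n)"
        using elim by simp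
      have "4 / \<delta> / \<tau> * (a / c + b / c) = 4 / \<delta> * ((a + b) / (\<tau> * c))" for a b c
        by (simp add: add_divide_distrib distrib_left mult_ac)
      then show ?case unfolding R_def 1 2[symmetric] .
    qed
    with lim show ?thesis using Lim_transform_eventually by blast
  qed
  have ev_R: "\<forall>\<^sub>F n in sequentially. R n * (1 + 1 / \<rho>') < \<zeta> / 2"
    using pos by (intro order_tendstoD(2)[OF tendsto_mult[OF R0 tendsto_const]]) simp
  have ev_xL: "\<forall>\<^sub>F n in sequentially. x n * L < \<delta>\<^sup>2 / 100"
    using \<delta> by (intro order_tendstoD(2)[OF tendsto_mult[OF x0 tendsto_const]]) simp
  have ev_e: "\<forall>\<^sub>F n in sequentially. \<eta> n * u n < \<delta>" by (rule order_tendstoD(2)[OF e0 \<delta>(1)])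
  show ?thesis
    using ev_r ev_f first q_eq ev_D xD x_eq ev_\<eta> ev_u T_eq ev_up ev_low q_inv ev_trunc' ev_\<Gamma> ev_Lq ev_R ev_xL ev_e
  proof eventually_elim
    case (elim n)
    have u0: "0 < u n" using elim(1,2) by (simp add: u_def)
    have x_pos: "0 < x n" using elim(5,7,8) u0 by simp
    have qr: "q n * r n ^ 3 = 1 + u n" using elim(1,4) by simp
    interpret N: near_critical "{1..n}" "w n" "q n" \<delta> L "x n" "D n" \<Gamma>
    proof
      show "finite {1..n}" by simp
      show "0 < w n i" if "i \<in> {1..n}" for i by (rule w_pos[OF that])
      show "1 \<le> q n * sum (w n) {1..n}" "q n * sum (w n) {1..n} \<le> 1 + \<delta>"
        using elim(3,9) qr u0 by auto
      show "q n * (\<Sum>i\<in>{1..n}. (w n i)\<^sup>2) = 1 + x n * D n" using elim(5) unfolding S2_def[symmetric] by (simp add: x_def)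
      show "1 / \<delta>\<^sup>2 \<le> \<Gamma>" by (simp add: \<Gamma>_def)
      show "q n * (\<Sum>i\<in>{1..n}. (w n i) ^ 3) = D n" unfolding S3_def[symmetric] by (simp add: D_def)
    qed (use elim \<delta> L x_pos in \<open>auto\<close>)
    have y: "0 < \<tau> * r n ^ 4" using pos elim(1) by simp
    have rb: "N.rest_bound (\<tau> * r n ^ 4) = R n"
      unfolding N.rest_bound_def R_def elim(3) by simp
    have T: "N.T = \<eta> n / (D n * (1 + u n)) * (2 * f n * r n ^ 2)"
      unfolding N.T_def by (rule elim(10))
    have fr0: "0 \<le> 2 * f n * r n ^ 2" using elim(2) by simp
    have "(1 + \<rho>') * N.T \<le> (1 + \<rho>) / C * (2 * f n * r n ^ 2)"
      unfolding T mult.assoc[symmetric, of "1 + \<rho>'"] using elim(11) fr0 by (intro mult_right_mono) auto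
    moreover have "(1 - \<rho>) / C * (2 * f n * r n ^ 2) \<le> (1 - 5 * \<delta>) * N.T"
      unfolding T mult.assoc[symmetric, of "1 - 5 * \<delta>"] using elim(12) fr0 by (intro mult_right_mono) auto
    ultimately have imp: "giant {1..n} ((1 - \<rho>) / C * (2 * f n * r n ^ 2)) ((1 + \<rho>) / C * (2 * f n * r n ^ 2)) (\<tau> * r n ^ 4) F"
      if "giant {1..n} ((1 - 5 * \<delta>) * N.T) ((1 + \<rho>') * N.T) (\<tau> * r n ^ 4) F" for F
      using that giant_mono by blast
    have "gexp (w n) (q n) {1..n} (\<lambda>F. of_bool (\<not> giant {1..n} ((1 - \<rho>) / C * (2 * f n * r n ^ 2)) ((1 + \<rho>) / C * (2 * f n * r n ^ 2)) (\<tau> * r n ^ 4) F))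
      \<le> gexp (w n) (q n) {1..n} (\<lambda>F. of_bool (\<not> giant {1..n} ((1 - 5 * \<delta>) * N.T) ((1 + \<rho>') * N.T) (\<tau> * r n ^ 4) F))"
      by (rule N.G_mono[OF order_refl]) (simp only: of_bool_eq_iff of_bool_less_eq_iff, use imp in blast)
    also have "\<dots> \<le> 5 * \<delta> + R n + (17 * \<delta> + R n) / \<rho>'"
      unfolding rb[symmetric] using exp\<Gamma> m \<rho>'
      by (intro N.not_giant_le[OF y]) (auto simp only: N.p_def less_imp_le)
    also have "\<dots> = 5 * \<delta> + 17 * \<delta> / \<rho>' + R n * (1 + 1 / \<rho>')" by (simp add: field_simps add_divide_distrib)
    also have "\<dots> < \<zeta>"
    proof -
      have "\<delta> * \<rho>' \<le> \<delta> * 1" using \<delta> \<rho>' by (intro mult_left_mono) auto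
      then have "\<delta> \<le> \<delta> / \<rho>'" using \<rho>' by (simp add: pos_le_divide_eq)
      moreover have "\<delta> / \<rho>' \<le> \<zeta> / 88" using \<delta>(4) \<rho>' by (simp add: pos_divide_le_eq)
      moreover have "17 * \<delta> / \<rho>' = 17 * (\<delta> / \<rho>')" by simp
      ultimately show ?thesis using elim(17) pos by linarith
    qed
    finally show ?case .
  qed
qed

section \<open>Transfer to the given model and its moment conditions\<close>

lemma prob_random_graph:
  assumes "rank_one {1..n} v q"
  shows "measure_pmf.prob (random_graph n v q) A = gexp v q {1..n} (\<lambda>F. of_bool (F \<in> A))"
proof -
  interpret rank_one "{1..n}" v q by fact
  have "random_graph n v q = map_pmf (\<lambda>b. {e \<in> eds {1..n}. b e})
      (Pi_pmf (eds {1..n}) False (\<lambda>e. bernoulli_pmf (edge_prob v q e)))"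
    by (simp add: random_graph_def possible_edges_eq_eds edge_prob_def)
  then show ?thesis
    using edge_prob01 by (simp only: gexp_def) (rule prob_eq_bexp, auto)
qed

lemma integrable_of_cube:
  fixes W :: "'a \<Rightarrow> real"
  assumes "prob_space M" "W \<in> borel_measurable M" "integrable M (\<lambda>x. W x ^ 3)"
  shows "integrable M W"
proof -
  interpret prob_space M by fact
  show ?thesis
  proof (rule Bochner_Integration.integrable_bound)
    show "integrable M (\<lambda>x. 1 + \<bar>W x ^ 3\<bar>)" using assms(3) by simp
    show "AE x in M. norm (W x) \<le> norm (1 + \<bar>W x ^ 3\<bar>)"
    proof (rule AE_I2)
      fix x
      show "norm (W x) \<le> norm (1 + \<bar>W x ^ 3\<bar>)"
      proof (cases "\<bar>W x\<bar> \<le> 1")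
        case False
        then have "\<bar>W x\<bar> ^ 1 \<le> \<bar>W x\<bar> ^ 3" by (intro power_increasing) auto
        then show ?thesis by (simp add: power_abs)
      qed simp
    qed
  qed (rule assms(2))
qed

lemma integral_pos_AE:
  fixes g :: "'a \<Rightarrow> real"
  assumes "prob_space M" "integrable M g" "AE x in M. 0 < g x"
  shows "0 < integral\<^sup>L M g"
proof -
  interpret prob_space M by fact
  have "integral\<^sup>L M (\<lambda>x. 0) < integral\<^sup>L M g"
    using assms(2,3) emeasure_space_1 by (intro integral_less_AE_space) auto
  then show ?thesis by simp
qed

lemma root_total_weight:
  assumes "weight_array w"
  defines "r \<equiv> \<lambda>n. total_weight w n powr (1 / 3)"
  shows "total_weight w n = r n ^ 3" "total_weight w n powr (2 / 3) = r n ^ 2"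
    "crit_param w f n = (r n + f n) / r n ^ 4"
proof -
  have nonneg: "0 \<le> total_weight w n"
    unfolding total_weight_def using assms(1) by (intro sum_nonneg) (auto simp: weight_array_def less_imp_le)
  \<comment> \<open>If the total weight vanishes, as for \<open>n = 0\<close>, both sides are 0;
    this is where \<open>0 < k\<close> matters.\<close>
  have "r n ^ k = total_weight w n powr (real k / 3)" if "0 < k" for k
    using that by (cases "total_weight w n = 0") (simp_all add: r_def powr_power)
  from this[of 2] this[of 3] this[of 4] show "total_weight w n = r n ^ 3"
    "total_weight w n powr (2 / 3) = r n ^ 2" "crit_param w f n = (r n + f n) / r n ^ 4"
    using nonneg by (simp_all add: crit_param_def r_def)
qed

theorem corollary38p2:
  fixes w :: "nat \<Rightarrow> nat \<Rightarrow> real" and M :: "'a measure" and W :: "'a \<Rightarrow> real"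
    and f :: "nat \<Rightarrow> real" and p :: real and C :: real
  assumes "weight_array w"
    and "conditions1 w M W"
    and "C = (\<integral>x. W x ^ 3 \<partial>M) / (\<integral>x. W x \<partial>M)"
    and "f \<in> o(\<lambda>n. real n powr (1/3))"
    and "filterlim f at_top sequentially"
    and "p > 7/3"
  shows "lp_tendsto_in_prob p
           (\<lambda>n. random_graph n (w n) (crit_param w f n))
           (\<lambda>n E i. if i = 0
              then real (component_size n E 0) / (2 * f n * total_weight w n powr (2/3))
              else real (component_size n E i) / total_weight w n powr (2/3))
           (\<lambda>i. if i = 0 then 1 / C else 0)"
proof -
  define r where "r n = total_weight w n powr (1 / 3)" for n
  note r = root_total_weight[OF assms(1), folded r_def]
  define \<mu> where "\<mu> = (\<integral>x. W x \<partial>M)"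
  define m3 where "m3 = (\<integral>x. W x ^ 3 \<partial>M)"
  let ?W2 = "\<lambda>n. \<Sum>k=1..n. w n k ^ 2" and ?W3 = "\<lambda>n. \<Sum>k=1..n. w n k ^ 3"
  let ?t = "\<lambda>n. real n powr (1 / 3)"
  have M: "prob_space M" and W: "W \<in> borel_measurable M" "AE x in M. 0 < W x" "integrable M (\<lambda>x. W x ^ 3)"
    and conv: "weak_conv_m (\<lambda>n. distr (measure_pmf (pmf_of_set {1..n})) borel (w n)) (distr M borel W)"
    and W2: "(\<integral>x. W x ^ 2 \<partial>M) = \<mu>"
    and s1: "(\<lambda>n. total_weight w n - \<mu> * real n) \<in> o(\<lambda>n. real n powr (2/3))"
    and s2: "(\<lambda>n. ?W2 n - (\<integral>x. W x ^ 2 \<partial>M) * real n) \<in> o(\<lambda>n. real n powr (2/3))"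
    and s3: "(\<lambda>n. ?W3 n - m3 * real n) \<in> o(\<lambda>n. 1)"
    using assms(2) unfolding conditions1_def \<mu>_def m3_def by blast+
  have w_pos: "0 < w n i" if "i \<in> {1..n}" for n i
    using assms(1) that by (simp add: weight_array_def)
  have \<mu>: "0 < \<mu>" unfolding \<mu>_def
    using integral_pos_AE[OF M integrable_of_cube[OF M W(1,3)] W(2)] .
  have m3: "0 < m3" unfolding m3_def
    by (rule integral_pos_AE[OF M W(3)]) (use W(2) in \<open>auto elim: eventually_mono\<close>)
  have C: "C = m3 / \<mu>" "0 < C" using assms(3) \<mu> m3 by (simp_all add: \<mu>_def m3_def)
  have ev1: "\<forall>\<^sub>F n in sequentially. 1 \<le> n" by (rule eventually_ge_at_top)
  have t_inv: "(\<lambda>n. 1 / ?t n) \<longlonglongrightarrow> 0"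
    using tendsto_neg_powr[of "- (1 / 3)" real sequentially] filterlim_real_sequentially
    by (simp add: powr_minus_divide)
  have "filterlim (\<lambda>n. inverse (1 / ?t n)) at_top sequentially"
    by (rule filterlim_inverse_at_top[OF t_inv]) (use ev1 in eventually_elim, simp)
  then have t_top: "filterlim ?t at_top sequentially" by simp
  have t_pow: "?t n ^ 2 = real n powr (2 / 3)" "?t n ^ 3 = real n" if "1 \<le> n" for n
    using that by (simp_all add: powr_power)
  have l1: "(\<lambda>n. (total_weight w n - \<mu> * real n) / ?t n ^ 2) \<longlonglongrightarrow> 0"
    by (rule Lim_transform_eventually[OF smalloD_tendsto[OF s1]])
      (use ev1 in eventually_elim, simp only: t_pow(1))
  have l2: "(\<lambda>n. (?W2 n - \<mu> * real n) / ?t n ^ 2) \<longlonglongrightarrow> 0"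
    by (rule Lim_transform_eventually[OF smalloD_tendsto[OF s2]])
      (use ev1 in eventually_elim, simp only: t_pow(1) W2)
  have l3: "(\<lambda>n. ?W3 n - m3 * real n) \<longlonglongrightarrow> 0" using smalloD_tendsto[OF s3] by simp
  have lf: "(\<lambda>n. f n / ?t n) \<longlonglongrightarrow> 0" by (rule smalloD_tendsto[OF assms(4)])
  have ln: "(\<lambda>n. r n ^ 3 / real n) \<longlonglongrightarrow> \<mu>"
  proof -
    have "(\<lambda>n. (total_weight w n - \<mu> * real n) / ?t n ^ 2 * (1 / ?t n) + \<mu>) \<longlonglongrightarrow> 0 * 0 + \<mu>"
      by (intro tendsto_intros l1 t_inv)
    moreover have "\<forall>\<^sub>F n in sequentially.
      (total_weight w n - \<mu> * real n) / ?t n ^ 2 * (1 / ?t n) + \<mu> = r n ^ 3 / real n"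
      using ev1
    proof eventually_elim
      case (elim n)
      have t3: "?t n ^ 2 * ?t n = real n" using t_pow(2)[OF elim] by (simp only: power2_eq_square power3_eq_cube)
      have "(total_weight w n - \<mu> * real n) / ?t n ^ 2 * (1 / ?t n) + \<mu>
        = (total_weight w n - \<mu> * real n) / (?t n ^ 2 * ?t n) + \<mu>"
        by (simp only: times_divide_times_eq mult_1_right)
      also have "\<dots> = total_weight w n / real n"
        unfolding t3 using elim by (simp add: diff_divide_distrib)
      finally show ?case unfolding r(1)[symmetric] .
    qed
    ultimately show ?thesis using Lim_transform_eventually by fastforce
  qed
  have nr: "(\<lambda>n. real n / r n ^ 3) \<longlonglongrightarrow> 1 / \<mu>"
    using tendsto_inverse[OF ln] \<mu> by (simp add: inverse_eq_divide)
  have r_root: "(r n ^ 3) powr (1 / 3) = r n" for n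
    by (simp only: r(1)[symmetric]) (simp only: r_def)
  have tr: "(\<lambda>n. ?t n / r n) \<longlonglongrightarrow> (1 / \<mu>) powr (1 / 3)"
  proof -
    have "(\<lambda>n. (real n / r n ^ 3) powr (1 / 3)) \<longlonglongrightarrow> (1 / \<mu>) powr (1 / 3)"
      using \<mu> by (intro tendsto_powr nr tendsto_const) auto
    moreover have "(real n / r n ^ 3) powr (1 / 3) = ?t n / r n" for n
      by (simp add: powr_divide r_root)
    ultimately show ?thesis by simp
  qed
  have ev_r: "\<forall>\<^sub>F n in sequentially. 0 < r n"
    using ev1
  proof eventually_elim
    case (elim n)
    have "0 < total_weight w n"
      unfolding total_weight_def using elim w_pos by (intro sum_pos) auto
    then show ?case by (simp add: r_def)
  qed
  have r_top: "filterlim r at_top sequentially"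
  proof -
    have "(\<lambda>n. (r n ^ 3 / real n) powr (1 / 3)) \<longlonglongrightarrow> \<mu> powr (1 / 3)"
      using \<mu> by (intro tendsto_powr ln tendsto_const) auto
    then have A: "filterlim (\<lambda>n. (r n ^ 3 / real n) powr (1 / 3) * ?t n) at_top sequentially"
      by (rule filterlim_tendsto_pos_mult_at_top[OF _ _ t_top]) (use \<mu> in simp)
    have B: "\<forall>\<^sub>F n in sequentially. (r n ^ 3 / real n) powr (1 / 3) * ?t n = r n"
      using ev1 ev_r
    proof eventually_elim
      case (elim n)
      then show ?case by (simp add: powr_divide r_root)
    qed
    show ?thesis by (rule iffD1[OF filterlim_cong[OF refl refl B] A])
  qed
  have giant: "\<forall>\<^sub>F n in sequentially. gexp (w n) ((r n + f n) / r n ^ 4) {1..n} (\<lambda>F. of_bool (\<not> giant {1..n} ((1 - \<rho>) / C * (2 * f n * r n ^ 2)) ((1 + \<rho>) / C * (2 * f n * r n ^ 2)) (\<tau> * r n ^ 4) F)) < \<zeta>"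
    if "0 < \<rho>" "\<rho> \<le> 1" "0 < \<tau>" "0 < \<zeta>" for \<rho> \<tau> \<zeta>
  proof (rule eventually_giant[where \<gamma> = "1 / \<mu>", OF w_pos r_top assms(5)])
    show "(\<lambda>n. f n / r n) \<longlonglongrightarrow> 0"
    proof -
      have "(\<lambda>n. f n / ?t n * (?t n / r n)) \<longlonglongrightarrow> 0 * (1 / \<mu>) powr (1 / 3)"
        by (intro tendsto_mult lf tr)
      then have A: "(\<lambda>n. f n / ?t n * (?t n / r n)) \<longlonglongrightarrow> 0" by (simp only: mult_zero_left)
      moreover have "\<forall>\<^sub>F n in sequentially. f n / ?t n * (?t n / r n) = f n / r n"
        using ev1
      proof eventually_elim
        case (elim n)
        have gen: "a / t * (t / s) = a / s" if "t \<noteq> 0" for a s t :: real using that by simp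
        show ?case by (rule gen) (use elim in simp)
      qed
      ultimately show ?thesis by (intro Lim_transform_eventually[OF A])
    qed
    show "\<forall>\<^sub>F n in sequentially. (\<Sum>i=1..n. w n i) = r n ^ 3"
      by (intro always_eventually allI) (simp only: r(1)[symmetric] total_weight_def)
    show "(\<lambda>n. (?W2 n - r n ^ 3) / r n ^ 2) \<longlonglongrightarrow> 0"
    proof -
      \<comment> \<open>The two centrings coincide because \<open>W\<close> has equal first and
        second moments, so the difference of the errors is \<open>?W2 n - r n ^ 3\<close>; the last
        factor changes the scale from \<open>n\<close> to \<open>r\<close>.\<close>
      have "(\<lambda>n. ((?W2 n - \<mu> * real n) / ?t n ^ 2 - (total_weight w n - \<mu> * real n) / ?t n ^ 2) * (?t n / r n) ^ 2)
        \<longlonglongrightarrow> (0 - 0) * ((1 / \<mu>) powr (1 / 3)) ^ 2"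
        by (intro tendsto_mult tendsto_diff tendsto_power l1 l2 tr)
      then have A: "(\<lambda>n. ((?W2 n - \<mu> * real n) / ?t n ^ 2 - (total_weight w n - \<mu> * real n) / ?t n ^ 2) * (?t n / r n) ^ 2)
        \<longlonglongrightarrow> 0" by (simp only: mult_zero_left diff_self)
      moreover have "\<forall>\<^sub>F n in sequentially.
        ((?W2 n - \<mu> * real n) / ?t n ^ 2 - (total_weight w n - \<mu> * real n) / ?t n ^ 2) * (?t n / r n) ^ 2
        = (?W2 n - r n ^ 3) / r n ^ 2"
        using ev1 ev_r
      proof eventually_elim
        case (elim n)
        have gen: "((a - c) / t ^ 2 - (b - c) / t ^ 2) * (t / s) ^ 2 = (a - b) / s ^ 2" if "t \<noteq> 0" for a b c s t :: real
          using that by (simp add: diff_divide_distrib[symmetric] power_divide)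
        show ?case unfolding r(1)[of n, symmetric] by (rule gen) (use elim in simp)
      qed
      ultimately show ?thesis by (intro Lim_transform_eventually[OF A])
    qed
    show "(\<lambda>n. ?W3 n / r n ^ 3) \<longlonglongrightarrow> C"
    proof -
      have "(\<lambda>n. ((?W3 n - m3 * real n) * (1 / real n) + m3) * (real n / r n ^ 3)) \<longlonglongrightarrow> (0 * 0 + m3) * (1 / \<mu>)"
        by (intro tendsto_mult tendsto_add tendsto_const l3 nr lim_1_over_n)
      then have A: "(\<lambda>n. ((?W3 n - m3 * real n) * (1 / real n) + m3) * (real n / r n ^ 3)) \<longlonglongrightarrow> C"
        unfolding C(1) by simp
      moreover have "\<forall>\<^sub>F n in sequentially. ((?W3 n - m3 * real n) * (1 / real n) + m3) * (real n / r n ^ 3) = ?W3 n / r n ^ 3"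
        using ev1
      proof eventually_elim
        case (elim n)
        have gen: "((a - m3 * b) * (1 / b) + m3) * (b / c) = a / c" if "b \<noteq> 0" for a b c
        proof -
          have "(a - m3 * b) * (1 / b) + m3 = a / b" using that by (simp add: diff_divide_distrib)
          then show ?thesis using that by simp
        qed
        show ?case by (rule gen) (use elim in simp)
      qed
      ultimately show ?thesis by (intro Lim_transform_eventually[OF A])
    qed
    show "\<exists>L\<ge>1. \<forall>\<^sub>F n in sequentially. \<kappa> * real n \<le> (\<Sum>i\<in>{i\<in>{1..n}. w n i \<le> L}. w n i ^ 3)"
      if "\<kappa> < C / (1 / \<mu>)" for \<kappa>
    proof (rule truncated_third_moment[OF M W conv w_pos])
      show "\<kappa> < (\<integral>x. W x ^ 3 \<partial>M)" using that C(1) \<mu> by (simp add: m3_def[symmetric])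
    qed
    show "0 < C" "0 < 1 / \<mu>" "(\<lambda>n. real n / r n ^ 3) \<longlonglongrightarrow> 1 / \<mu>"
      using C(2) \<mu> nr by simp_all
    show "0 < \<rho>" "\<rho> \<le> 1" "0 < \<tau>" "0 < \<zeta>" by (rule that)+
  qed
  show ?thesis
    unfolding lp_tendsto_in_prob_def
  proof (intro conjI allI ballI impI)
    show "(\<lambda>i. if i = 0 then 1 / C else 0) \<in> lp_space p"
      unfolding lp_space_def mem_Collect_eq by (rule summable_finite[of "{0}"]) auto
  next
    fix n E
    let ?a = "2 * f n * total_weight w n powr (2/3)" and ?s = "total_weight w n powr (2/3)"
    have "summable (\<lambda>i. (\<lambda>i k. \<bar>if i = 0 then real k / ?a else real k / ?s\<bar> powr p) i (component_size n E i))"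
      by (rule suminf_eq_sum_component_size(1)) auto
    moreover have "(\<lambda>i. \<bar>if i = 0 then real (component_size n E i) / ?a else real (component_size n E i) / ?s\<bar> powr p)
      = (\<lambda>i. \<bar>if i = 0 then real (component_size n E 0) / ?a else real (component_size n E i) / ?s\<bar> powr p)"
      by (rule ext) simp
    ultimately show "(\<lambda>i. if i = 0 then real (component_size n E 0) / ?a
       else real (component_size n E i) / ?s) \<in> lp_space p"
      by (simp add: lp_space_def)
  next
    fix \<epsilon> :: real assume \<epsilon>: "0 < \<epsilon>"
    define \<tau> where "\<tau> = min 1 (\<epsilon> powr p / 2)"
    \<comment> \<open>The second entry turns the relative error \<open>\<rho>\<close> into an error
      \<open>\<epsilon> / 2\<close> around \<open>1 / C\<close>; the first keeps the giant above
      \<open>f / C * r^2\<close>.\<close>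
    define \<rho> where "\<rho> = min (1 / 2) (\<epsilon> * C / 2)"
    have \<tau>: "0 < \<tau>" "\<tau> \<le> 1" "\<tau> \<le> \<epsilon> powr p / 2" using \<epsilon> by (auto simp: \<tau>_def)
    have \<rho>: "0 < \<rho>" "\<rho> \<le> 1 / 2" "\<rho> \<le> \<epsilon> * C / 2" using \<epsilon> C(2) by (auto simp: \<rho>_def)
    let ?X = "\<lambda>n E i. if i = 0 then real (component_size n E 0) / (2 * f n * total_weight w n powr (2/3))
      else real (component_size n E i) / total_weight w n powr (2/3)"
    let ?P = "\<lambda>n. measure_pmf.prob (random_graph n (w n) (crit_param w f n))
      {E. \<epsilon> < lp_norm p (\<lambda>i. ?X n E i - (if i = 0 then 1 / C else 0))}"
    have ev_f: "\<forall>\<^sub>F n in sequentially. C < f n" using assms(5) by (simp add: filterlim_at_top_dense)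
    show "?P \<longlonglongrightarrow> 0"
    proof (rule order_tendstoI)
      fix a :: real assume "a < 0"
      then show "\<forall>\<^sub>F n in sequentially. a < ?P n"
        by (intro always_eventually allI) (meson less_le_trans measure_nonneg)
    next
      fix \<zeta> :: real assume "0 < \<zeta>"
      have "\<rho> \<le> 1" using \<rho> by simp
      show "\<forall>\<^sub>F n in sequentially. ?P n < \<zeta>"
        using giant[OF \<rho>(1) \<open>\<rho> \<le> 1\<close> \<tau>(1) \<open>0 < \<zeta>\<close>] ev_f ev_r
      proof eventually_elim
        case (elim n)
        have f0: "0 < f n" using elim C(2) by simp
        interpret N: rank_one "{1..n}" "w n" "(r n + f n) / r n ^ 4"
          by standard (use w_pos elim f0 in auto)
        have "?P n = gexp (w n) ((r n + f n) / r n ^ 4) {1..n} (\<lambda>E. of_bool (\<epsilon> < lp_norm p (\<lambda>i. ?X n E i - (if i = 0 then 1 / C else 0))))"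
          unfolding r(3) by (subst prob_random_graph[OF N.rank_one_axioms]) simp
        also have "\<dots> \<le> gexp (w n) ((r n + f n) / r n ^ 4) {1..n} (\<lambda>F. of_bool (\<not> giant {1..n} ((1 - \<rho>) / C * (2 * f n * r n ^ 2)) ((1 + \<rho>) / C * (2 * f n * r n ^ 2)) (\<tau> * r n ^ 4) F))"
        proof (rule N.G_mono[OF order_refl])
          fix F assume F: "F \<subseteq> eds {1..n}"
          have "lp_norm p (\<lambda>i. ?X n F i - (if i = 0 then 1 / C else 0)) \<le> \<epsilon>"
            if v: "v \<in> {1..n}" and lo: "(1 - \<rho>) / C * (2 * f n * r n ^ 2) \<le> real (card (reach {v} F))"
              and up: "real (card (reach {v} F)) \<le> (1 + \<rho>) / C * (2 * f n * r n ^ 2)"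
              and rest: "(\<Sum>i\<in>{1..n} - reach {v} F. real (card (reach {i} F))) \<le> \<tau> * r n ^ 4" for v
          proof -
            have a0: "0 < 2 * f n * r n ^ 2" using f0 elim by simp
            have "(1 - \<rho>) / C \<le> real (card (reach {v} F)) / (2 * f n * r n ^ 2)"
              "real (card (reach {v} F)) / (2 * f n * r n ^ 2) \<le> (1 + \<rho>) / C"
              using lo up by (simp_all only: pos_le_divide_eq[OF a0] pos_divide_le_eq[OF a0])
            moreover have "(1 - \<rho>) / C = 1 / C - \<rho> / C" "(1 + \<rho>) / C = 1 / C + \<rho> / C"
              by (simp_all add: diff_divide_distrib add_divide_distrib)
            moreover have "\<rho> / C \<le> \<epsilon> / 2" using \<rho>(3) C(2) by (simp add: pos_divide_le_eq)
            moreover have "\<bar>z - c\<bar> \<le> e" if "c - d \<le> z" "z \<le> c + d" "d \<le> e" for z c d e :: real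
              using that by linarith
            ultimately have close: "\<bar>real (card (reach {v} F)) / (2 * f n * r n ^ 2) - 1 / C\<bar> \<le> \<epsilon> / 2"
              by (simp only:)
            \<comment> \<open>Once \<open>f n > C\<close>, the giant has more than
              \<open>r n ^ 2\<close> vertices, the bound that holds for every other component, so it
              is the unique largest one.\<close>
            have "1 < f n / C" using elim(2) C(2) by (simp add: pos_less_divide_eq)
            then have "1 * r n ^ 2 < f n / C * r n ^ 2" using elim(3) by (intro mult_strict_right_mono) auto
            then have "r n ^ 2 < f n / C * r n ^ 2" by simp
            also have "\<dots> = (1 / 2) / C * (2 * f n * r n ^ 2)" by simp
            also have "\<dots> \<le> (1 - \<rho>) / C * (2 * f n * r n ^ 2)"
              using \<rho> C(2) a0 by (intro mult_right_mono divide_right_mono) auto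
            also note lo
            finally have big: "r n ^ 2 < real (card (reach {v} F))" .
            have rest': "(\<Sum>i\<in>{1..n} - reach {v} F. real (card (reach {i} F))) \<le> \<tau> * (r n ^ 2)\<^sup>2"
              using rest by simp
            show ?thesis unfolding r(2)
              by (rule lp_norm_component_sizes_le[OF F v rest' \<tau>(2,3) _ big close]) (use elim assms(6) \<epsilon> in auto)
          qed
          then show "of_bool (\<epsilon> < lp_norm p (\<lambda>i. ?X n F i - (if i = 0 then 1 / C else 0)))
            \<le> (of_bool (\<not> giant {1..n} ((1 - \<rho>) / C * (2 * f n * r n ^ 2)) ((1 + \<rho>) / C * (2 * f n * r n ^ 2)) (\<tau> * r n ^ 4) F) :: real)"
            unfolding of_bool_less_eq_iff giant_def by (meson not_less)
        qed
        also note elim(1)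
        finally show ?case .
      qed
    qed
  qed
qed

end
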